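(* Let $F$ be an algebraic number field with ring of integers $\mathfrak{g}$, $(V,\varphi)$ a quadratic space of dimension $n\,(>1)$ over $F$, and $L$ a $\mathfrak{g}$-maximal lattice in $V$ with respect to $\varphi$. Let $h\in V$ with $\varphi[h]\in F^\times$, put $W=(Fh)^\perp=\{x\in V\mid\varphi(x,h)=0\}$, let $\psi$ be the restriction of $\varphi$ to $W$, and let $M$ be a $\mathfrak{g}$-maximal lattice in $W$ with respect to $\psi$. Then $L\cap W$ is $\mathfrak{g}$-maximal in $W$ with respect to $\psi$ if and only if $$\varphi[h]\,(\varphi(h,L))^{-2}=2[\widetilde M/M][\widetilde L/L]^{-1}.$$
   Context: A quadratic space $(V,\varphi)$ is a finite-dimensional vector space with a nondegenerate symmetric bilinear form; $\varphi[x]=\varphi(x,x)$. A $\mathfrak{g}$-lattice in $V$ is a finitely generated $\mathfrak{g}$-submodule containing a basis of $V$; it is $\mathfrak{g}$-maximal with respect to $\varphi$ if it is maximal among the $\mathfrak{g}$-lattices on which all values $\varphi[x]$ lie in $\mathfrak{g}$. $\widetilde L=\{x\in V\mid2\varphi(x,L)\subset\mathfrak{g}\}$, and $\widetilde M=\{x\in W\mid2\psi(x,M)\subset\mathfrak{g}\}$. For two $\mathfrak{g}$-lattices $N,N'$ in a space $X$, $[N/N']$ is the fractional ideal of $F$ generated over $\mathfrak{g}$ by $\det(\alpha)$ for all $F$-linear automorphisms $\alpha$ of $X$ (acting on the right) with $N\alpha\subset N'$. The ideals $[\widetilde L/L]$ and $[\widetilde M/M]$ do not depend on the choice of the maximal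 lattices. $\varphi(h,L)=\{\varphi(h,x)\mid x\in L\}$ is a fractional ideal. *)

theory Defs
  imports
    "HOL-Computational_Algebra.Polynomial"
    "Jordan_Normal_Form.Determinant"
begin

text \<open>
  The number field is a whole type. The ambient vector space is a whole type as well, with scalar
  multiplication \<open>scale\<close>, but the notions below are relative to a linear subspace \<open>X\<close> of it, so that
  they apply both to the ambient space (\<open>X = UNIV\<close>) and to the orthogonal complement of a vector.
\<close>

definition algebraic_number_field :: "'a::field_char_0 itself \<Rightarrow> bool" where
  "algebraic_number_field _ \<longleftrightarrow>
     (\<exists>B. finite B \<and> module.span (\<lambda>(q::rat) (x::'a). of_rat q * x) B = UNIV)"

definition ring_of_integers :: "'a::field_char_0 set" where
  "ring_of_integers = {x. algebraic_int x}"

definition integral_span :: "('a::field_char_0 \<Rightarrow> 'b::ab_group_add \<Rightarrow> 'b) \<Rightarrow> 'b set \<Rightarrow> 'b set" where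
  "integral_span scale S =
     {(\<Sum>v\<in>T. scale (c v) v) | T c. finite T \<and> T \<subseteq> S \<and> (\<forall>v\<in>T. c v \<in> ring_of_integers)}"

definition quadratic_space ::
  "('a::field_char_0 \<Rightarrow> 'b::ab_group_add \<Rightarrow> 'b) \<Rightarrow> 'b set \<Rightarrow> ('b \<Rightarrow> 'b \<Rightarrow> 'a) \<Rightarrow> bool" where
  "quadratic_space scale X \<phi> \<longleftrightarrow>
     vector_space scale \<and> module.subspace scale X \<and>
     (\<exists>B. finite B \<and> module.span scale B = X) \<and>
     (\<forall>x\<in>X. \<forall>y\<in>X. \<phi> x y = \<phi> y x) \<and>
     (\<forall>x\<in>X. \<forall>y\<in>X. \<forall>z\<in>X. \<phi> (x + y) z = \<phi> x z + \<phi> y z) \<and>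
     (\<forall>c. \<forall>x\<in>X. \<forall>y\<in>X. \<phi> (scale c x) y = c * \<phi> x y) \<and>
     (\<forall>x\<in>X. (\<forall>y\<in>X. \<phi> x y = 0) \<longrightarrow> x = 0)"

definition is_lattice ::
  "('a::field_char_0 \<Rightarrow> 'b::ab_group_add \<Rightarrow> 'b) \<Rightarrow> 'b set \<Rightarrow> 'b set \<Rightarrow> bool" where
  "is_lattice scale X N \<longleftrightarrow>
     N \<subseteq> X \<and>
     (\<exists>S. finite S \<and> N = integral_span scale S) \<and>
     (\<exists>B\<subseteq>N. \<not> module.dependent scale B \<and> module.span scale B = X)"

definition integral_lattice ::
  "('a::field_char_0 \<Rightarrow> 'b::ab_group_add \<Rightarrow> 'b) \<Rightarrow> 'b set \<Rightarrow> ('b \<Rightarrow> 'b \<Rightarrow> 'a) \<Rightarrow> 'b set \<Rightarrow> bool" where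
  "integral_lattice scale X \<phi> N \<longleftrightarrow> is_lattice scale X N \<and> (\<forall>x\<in>N. \<phi> x x \<in> ring_of_integers)"

definition maximal_lattice ::
  "('a::field_char_0 \<Rightarrow> 'b::ab_group_add \<Rightarrow> 'b) \<Rightarrow> 'b set \<Rightarrow> ('b \<Rightarrow> 'b \<Rightarrow> 'a) \<Rightarrow> 'b set \<Rightarrow> bool" where
  "maximal_lattice scale X \<phi> N \<longleftrightarrow>
     integral_lattice scale X \<phi> N \<and>
     (\<forall>N'. integral_lattice scale X \<phi> N' \<and> N \<subseteq> N' \<longrightarrow> N' = N)"

definition dual_lattice :: "'b set \<Rightarrow> ('b \<Rightarrow> 'b \<Rightarrow> 'a::field_char_0) \<Rightarrow> 'b set \<Rightarrow> 'b set" where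
  "dual_lattice X \<phi> N = {x\<in>X. \<forall>y\<in>N. 2 * \<phi> x y \<in> ring_of_integers}"

definition linear_automorphism ::
  "('a::field_char_0 \<Rightarrow> 'b::ab_group_add \<Rightarrow> 'b) \<Rightarrow> 'b set \<Rightarrow> ('b \<Rightarrow> 'b) \<Rightarrow> bool" where
  "linear_automorphism scale X \<alpha> \<longleftrightarrow>
     bij_betw \<alpha> X X \<and>
     (\<forall>x\<in>X. \<forall>y\<in>X. \<alpha> (x + y) = \<alpha> x + \<alpha> y) \<and>
     (\<forall>c. \<forall>x\<in>X. \<alpha> (scale c x) = scale c (\<alpha> x))"

definition ordered_basis ::
  "('a::field_char_0 \<Rightarrow> 'b::ab_group_add \<Rightarrow> 'b) \<Rightarrow> 'b set \<Rightarrow> 'b list \<Rightarrow> bool" where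
  "ordered_basis scale X bs \<longleftrightarrow>
     distinct bs \<and> \<not> module.dependent scale (set bs) \<and> module.span scale (set bs) = X"

text \<open>
  Row \<open>i\<close> of the matrix holds the coordinates of the image of the \<open>i\<close>-th basis vector, as is usual for
  maps written on the right.
\<close>

definition endo_matrix ::
  "('a::field_char_0 \<Rightarrow> 'b::ab_group_add \<Rightarrow> 'b) \<Rightarrow> 'b list \<Rightarrow> ('b \<Rightarrow> 'b) \<Rightarrow> 'a mat" where
  "endo_matrix scale bs \<alpha> =
     mat (length bs) (length bs)
       (\<lambda>(i, j). module.representation scale (set bs) (\<alpha> (bs ! i)) (bs ! j))"

text \<open>The choice of the basis is immaterial: another one gives a similar matrix.\<close>

definition endo_det ::
  "('a::field_char_0 \<Rightarrow> 'b::ab_group_add \<Rightarrow> 'b) \<Rightarrow> 'b set \<Rightarrow> ('b \<Rightarrow> 'b) \<Rightarrow> 'a" where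
  "endo_det scale X \<alpha> = det (endo_matrix scale (SOME bs. ordered_basis scale X bs) \<alpha>)"

text \<open>The ideal \<open>[N/N']\<close>.\<close>

definition lattice_index ::
  "('a::field_char_0 \<Rightarrow> 'b::ab_group_add \<Rightarrow> 'b) \<Rightarrow> 'b set \<Rightarrow> 'b set \<Rightarrow> 'b set \<Rightarrow> 'a set" where
  "lattice_index scale X N N' =
     integral_span (*) {endo_det scale X \<alpha> | \<alpha>. linear_automorphism scale X \<alpha> \<and> \<alpha> ` N \<subseteq> N'}"

definition ideal_mult :: "'a::field_char_0 set \<Rightarrow> 'a set \<Rightarrow> 'a set" where
  "ideal_mult I J = integral_span (*) {a * b | a b. a \<in> I \<and> b \<in> J}"

definition ideal_inverse :: "'a::field_char_0 set \<Rightarrow> 'a set" where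
  "ideal_inverse I = {x. \<forall>a\<in>I. x * a \<in> ring_of_integers}"

end

theory Submission
  imports Defs "Jordan_Normal_Form.Char_Poly"
begin

text \<open>
  The theorem compares two discriminants. Put \<open>K = L \<inter> W\<close>. As \<open>x \<mapsto> \<phi>(h,x)\<close> maps \<open>L\<close> onto the
  fractional ideal \<open>\<phi>(h,L)\<close> with kernel \<open>K\<close>, locally \<open>L\<close> is \<open>K\<close> plus one further generator \<open>y\<close>, and the
  component of \<open>y\<close> along \<open>h\<close> is \<open>\<phi>(h,y)/\<phi>[h]\<close>. Hence the discriminants of \<open>L\<close> and \<open>K\<close> always differ by
  the factor \<open>2 \<phi>(h,L)\<^sup>2 / \<phi>[h]\<close> (lemma \<open>det_gram_Cons\<close>), and the equation of the theorem says
  exactly that \<open>K\<close> and \<open>M\<close> have the same discriminant. What remains is that, among the integral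
  lattices of a quadratic space, the maximal ones are those with the largest discriminant
  ideal.

  That fact has an elementary reason. Let \<open>I\<close> be integral and \<open>J\<close> maximal, and let \<open>J~\<close> be the dual
  lattice of \<open>J\<close>. Maximality forces \<open>I \<inter> J~ = I \<inter> J\<close>, because an element \<open>x\<close> of the left side makes
  \<open>J + \<O>x\<close> integral. Therefore the form embeds \<open>I / (I \<inter> J)\<close> into the dual of \<open>J / (I \<inter> J)\<close>, so that
  \<open>I\<close> is at most as large as \<open>J\<close>; in terms of determinants, the matrix expressing a local basis of
  \<open>I\<close> by one of \<open>J\<close> has integral determinant (lemma \<open>det_integral_in_maximal\<close>). If both are maximal
  the determinant is a unit, and if \<open>I\<close> is properly contained in a larger integral lattice it
  cannot be a unit everywhere (lemma \<open>maximal_iff_local\<close>).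

  All ideals and lattices are compared after localizing at the prime ideals \<open>m\<close> of the ring of
  integers \<open>\<O>\<close> (lemma \<open>local_global\<close>). The local rings are valuation rings (lemma
  \<open>valuation_loc_ring\<close>): if \<open>u\<close> is a root of a primitive integer polynomial, its Horner partial
  sums are algebraic integers witnessing that \<open>u\<close> or \<open>1/u\<close> is \<open>m\<close>-integral. Over a valuation ring
  every lattice is free, so indices become determinants of base changes (lemma
  \<open>loc_lattice_index\<close>), and the comparison of \<open>I\<close> with \<open>J\<close> becomes a statement about square matrices
  (lemma \<open>det_in_valuation_ring\<close>), which follows from the Smith normal form. Finite generation of
  the dual lattice and of \<open>L \<inter> W\<close> comes from the local-global principle as well: applied to
  suitable ideals of scalars, it shows that the identity factors through finitely many elements
  of the lattice and its dual, and that \<open>\<phi>(h,L)\<close> is invertible, so that \<open>L\<close> projects onto \<open>L \<inter> W\<close>.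
\<close>

section \<open>Spans over subrings\<close>

definition submodule_over :: "'a set \<Rightarrow> ('a \<Rightarrow> 'b::ab_group_add \<Rightarrow> 'b) \<Rightarrow> 'b set \<Rightarrow> bool" where
  "submodule_over R scale N \<longleftrightarrow>
     0 \<in> N \<and> (\<forall>x\<in>N. \<forall>y\<in>N. x + y \<in> N) \<and> (\<forall>c\<in>R. \<forall>x\<in>N. scale c x \<in> N)"

definition ring_span :: "'a set \<Rightarrow> ('a \<Rightarrow> 'b::ab_group_add \<Rightarrow> 'b) \<Rightarrow> 'b set \<Rightarrow> 'b set" where
  "ring_span R scale S =
     {(\<Sum>v\<in>T. scale (c v) v) | T c. finite T \<and> T \<subseteq> S \<and> (\<forall>v\<in>T. c v \<in> R)}"

lemma submodule_overD:
  assumes "submodule_over R scale N"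
  shows "0 \<in> N" "x \<in> N \<Longrightarrow> y \<in> N \<Longrightarrow> x + y \<in> N" "c \<in> R \<Longrightarrow> x \<in> N \<Longrightarrow> scale c x \<in> N"
  using assms by (auto simp: submodule_over_def)

lemma submodule_over_sum:
  assumes "submodule_over R scale N" "\<And>i. i \<in> A \<Longrightarrow> f i \<in> N" shows "sum f A \<in> N"
  using assms(2) by (induction A rule: infinite_finite_induct) (auto intro: submodule_overD[OF assms(1)])

lemma ring_span_minimal:
  assumes "submodule_over R scale N" "S \<subseteq> N" shows "ring_span R scale S \<subseteq> N"
proof
  fix x assume "x \<in> ring_span R scale S"
  then obtain T c where x: "x = (\<Sum>v\<in>T. scale (c v) v)" "T \<subseteq> S" "\<forall>v\<in>T. c v \<in> R"
    by (auto simp: ring_span_def)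
  have "scale (c v) v \<in> N" if "v \<in> T" for v
    using that x(2,3) assms(2) by (intro submodule_overD(3)[OF assms(1)]) auto
  then show "x \<in> N" unfolding x(1) by (rule submodule_over_sum[OF assms(1)])
qed

lemma ring_span_finite:
  assumes "vector_space scale" "finite S" "0 \<in> R"
  shows "ring_span R scale S = {(\<Sum>v\<in>S. scale (c v) v) | c. \<forall>v\<in>S. c v \<in> R}"
proof -
  interpret vector_space scale by fact
  show ?thesis
  proof (intro equalityI subsetI)
    fix x assume "x \<in> ring_span R scale S"
    then obtain T c where x: "x = (\<Sum>v\<in>T. scale (c v) v)" "finite T" "T \<subseteq> S" "\<forall>v\<in>T. c v \<in> R"
      by (auto simp: ring_span_def)
    have "x = (\<Sum>v\<in>S. scale (if v \<in> T then c v else 0) v)"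
      using x assms(2) by (simp add: if_distrib[of "\<lambda>a. scale a _"] sum.If_cases Int_absorb1 cong: if_cong)
    moreover have "\<forall>v\<in>S. (if v \<in> T then c v else 0) \<in> R" using x assms(3) by auto
    ultimately show "x \<in> {(\<Sum>v\<in>S. scale (c v) v) | c. \<forall>v\<in>S. c v \<in> R}"
      by (intro CollectI exI[of _ "\<lambda>v. if v \<in> T then c v else 0"]) simp
  qed (use assms(2) in \<open>auto simp: ring_span_def\<close>)
qed

definition subring :: "'a::field set \<Rightarrow> bool" where
  "subring R \<longleftrightarrow> 1 \<in> R \<and> (\<forall>x\<in>R. \<forall>y\<in>R. x - y \<in> R) \<and> (\<forall>x\<in>R. \<forall>y\<in>R. x * y \<in> R)"

lemma subringD:
  assumes "subring R"
  shows "0 \<in> R" "1 \<in> R" "x \<in> R \<Longrightarrow> - x \<in> R" "x \<in> R \<Longrightarrow> y \<in> R \<Longrightarrow> x + y \<in> R"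
    "x \<in> R \<Longrightarrow> y \<in> R \<Longrightarrow> x - y \<in> R" "x \<in> R \<Longrightarrow> y \<in> R \<Longrightarrow> x * y \<in> R"
proof -
  show 0: "0 \<in> R" "1 \<in> R" using assms by (metis subring_def diff_self)+
  show m: "- x \<in> R" if "x \<in> R" for x using assms that 0 by (metis subring_def diff_0)
  show "x \<in> R \<Longrightarrow> y \<in> R \<Longrightarrow> x + y \<in> R"
    using assms m[of y] by (metis subring_def diff_minus_eq_add)
qed (use assms in \<open>auto simp: subring_def\<close>)

lemma subring_sum:
  assumes "subring R" "\<And>i. i \<in> A \<Longrightarrow> f i \<in> R" shows "sum f A \<in> R"
  using assms(2) by (induction A rule: infinite_finite_induct) (auto intro: subringD[OF assms(1)])

lemma subring_prod:
  assumes "subring R" "\<And>i. i \<in> A \<Longrightarrow> f i \<in> R" shows "prod f A \<in> R"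
  using assms(2) by (induction A rule: infinite_finite_induct) (auto intro: subringD[OF assms(1)])

lemma vector_space_self: "vector_space ((*) :: 'a::field \<Rightarrow> 'a \<Rightarrow> 'a)"
  by unfold_locales (auto simp: algebra_simps)

lemma submodule_ring_span:
  assumes "vector_space scale" "subring R"
  shows "submodule_over R scale (ring_span R scale S)"
proof -
  interpret vector_space scale by fact
  note R = subringD[OF assms(2)]
  have add: "x + y \<in> ring_span R scale S" if xy: "x \<in> ring_span R scale S" "y \<in> ring_span R scale S" for x y
  proof -
    obtain T c where x: "x = (\<Sum>v\<in>T. scale (c v) v)" "finite T" "T \<subseteq> S" "\<forall>v\<in>T. c v \<in> R"
      using xy(1) by (auto simp: ring_span_def)
    obtain U d where y: "y = (\<Sum>v\<in>U. scale (d v) v)" "finite U" "U \<subseteq> S" "\<forall>v\<in>U. d v \<in> R"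
      using xy(2) by (auto simp: ring_span_def)
    have sub: "ring_span R scale (T \<union> U) \<subseteq> ring_span R scale S"
      using x y by (fastforce simp: ring_span_def)
    have "x \<in> ring_span R scale (T \<union> U)" "y \<in> ring_span R scale (T \<union> U)"
      using x y by (auto simp: ring_span_def)
    then obtain a b where ab: "x = (\<Sum>v\<in>T\<union>U. scale (a v) v)" "\<forall>v\<in>T\<union>U. a v \<in> R"
      "y = (\<Sum>v\<in>T\<union>U. scale (b v) v)" "\<forall>v\<in>T\<union>U. b v \<in> R"
      using x(2) y(2) R(1) assms(1) by (auto simp: ring_span_finite)
    then have "x + y = (\<Sum>v\<in>T\<union>U. scale (a v + b v) v)"
      by (simp add: scale_left_distrib sum.distrib)
    then have "x + y \<in> ring_span R scale (T \<union> U)"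
      unfolding ring_span_finite[OF assms(1) finite_UnI[OF x(2) y(2)] R(1)] using ab R
      by (intro CollectI exI[of _ "\<lambda>v. a v + b v"]) auto
    then show ?thesis using sub by blast
  qed
  moreover have "scale k x \<in> ring_span R scale S" if k: "k \<in> R" and m: "x \<in> ring_span R scale S" for k x
  proof -
    obtain T c where x: "x = (\<Sum>v\<in>T. scale (c v) v)" "finite T" "T \<subseteq> S" "\<forall>v\<in>T. c v \<in> R"
      using m by (auto simp: ring_span_def)
    then have "scale k x = (\<Sum>v\<in>T. scale (k * c v) v)" by (simp add: scale_sum_right)
    then show ?thesis unfolding ring_span_def using x k R
      by (intro CollectI exI[of _ T] exI[of _ "\<lambda>v. k * c v"]) auto
  qed
  moreover have "0 \<in> ring_span R scale S" unfolding ring_span_def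
    by (intro CollectI exI[of _ "{}"] exI[of _ "\<lambda>v. 0"]) auto
  ultimately show ?thesis by (simp add: submodule_over_def)
qed

lemma ring_span_superset:
  assumes "vector_space scale" "subring R" shows "S \<subseteq> ring_span R scale S"
proof
  interpret vector_space scale by fact
  fix x assume "x \<in> S"
  then show "x \<in> ring_span R scale S" unfolding ring_span_def using subringD[OF assms(2)]
    by (intro CollectI exI[of _ "{x}"] exI[of _ "\<lambda>_. 1"]) auto
qed

section \<open>Algebraic integers\<close>

abbreviation integers ("\<O>") where "\<O> \<equiv> ring_of_integers"

lemma subring_Ints: "subring \<int>"
  by (auto simp: subring_def)

abbreviation int_span :: "'a::field_char_0 set \<Rightarrow> 'a set" where
  "int_span \<equiv> ring_span \<int> (*)"

lemmas submodule_int_span = submodule_ring_span[OF vector_space_self subring_Ints]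

lemma int_span_add: "a \<in> int_span S \<Longrightarrow> b \<in> int_span S \<Longrightarrow> a + b \<in> int_span S"
  by (rule submodule_overD(2)[OF submodule_int_span])

lemma int_span_mult_int: "a \<in> int_span S \<Longrightarrow> of_int k * a \<in> int_span S"
  by (rule submodule_overD(3)[OF submodule_int_span]) auto

lemma int_span_sum: "(\<And>i. i \<in> A \<Longrightarrow> f i \<in> int_span S) \<Longrightarrow> sum f A \<in> int_span S"
  by (rule submodule_over_sum[OF submodule_int_span])

lemma int_span_base: "s \<in> S \<Longrightarrow> s \<in> int_span S"
  using ring_span_superset[OF vector_space_self subring_Ints] by blast

lemma int_span_stable:
  assumes "\<And>s. s \<in> S \<Longrightarrow> x * s \<in> int_span S" and "a \<in> int_span S"
  shows "x * a \<in> int_span S"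
proof -
  note I = submodule_overD[OF submodule_int_span]
  have "x * (c * a) \<in> int_span S" if "c \<in> \<int>" "x * a \<in> int_span S" for c a
    using I(3)[OF that] by (simp add: mult.left_commute)
  then have "submodule_over \<int> (*) {a. x * a \<in> int_span S}"
    using I(1,2) by (auto simp: submodule_over_def distrib_left)
  then have "int_span S \<subseteq> {a. x * a \<in> int_span S}"
    by (rule ring_span_minimal) (use assms(1) in auto)
  then show ?thesis using assms(2) by blast
qed

text \<open>
  Multiplication by \<open>x\<close> acts on the generators through an integer matrix, of which \<open>x\<close> is an
  eigenvalue; the characteristic polynomial is the required monic equation.
\<close>

lemma algebraic_int_of_stable:
  fixes x :: "'a::field_char_0"
  assumes fin: "finite S" and ne: "s0 \<in> S" "s0 \<noteq> 0"
    and st: "\<And>s. s \<in> S \<Longrightarrow> x * s \<in> int_span S"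
  shows "algebraic_int x"
proof -
  obtain ws where ws: "set ws = S" "distinct ws" using finite_distinct_list[OF fin] by blast
  define n where "n = length ws"
  have "\<exists>c. x * s = (\<Sum>t\<in>S. of_int (c t) * t)" if s: "s \<in> S" for s
  proof -
    obtain d where d: "x * s = (\<Sum>t\<in>S. d t * t)" "\<forall>t\<in>S. d t \<in> \<int>"
      using st[OF s] by (auto simp: ring_span_finite[OF vector_space_self fin])
    then have "\<forall>t\<in>S. \<exists>k. d t = of_int k" by (auto simp: Ints_def)
    then obtain c where "\<forall>t\<in>S. d t = of_int (c t)" by metis
    then show ?thesis using d(1) by (intro exI[of _ c]) simp
  qed
  then obtain c where c: "\<And>s. s \<in> S \<Longrightarrow> x * s = (\<Sum>t\<in>S. of_int (c s t) * t)" by metis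
  define A :: "int mat" where "A = mat n n (\<lambda>(i,j). c (ws!i) (ws!j))"
  define v where "v = vec n (\<lambda>j. ws ! j)"
  have A: "A \<in> carrier_mat n n" by (simp add: A_def)
  then have A': "map_mat of_int A \<in> carrier_mat n n" by simp
  have sum: "(\<Sum>t\<in>S. f t) = (\<Sum>j<n. f (ws!j))" for f :: "'a \<Rightarrow> 'a"
    using ws by (intro sum.reindex_bij_betw[symmetric] bij_betw_nth) (auto simp: n_def)
  have "map_mat of_int A *\<^sub>v v = x \<cdot>\<^sub>v v"
  proof (rule eq_vecI)
    fix i assume "i < dim_vec (x \<cdot>\<^sub>v v)"
    then have i: "i < n" by (simp add: v_def)
    then have "ws ! i \<in> S" using ws n_def by auto
    then show "(map_mat of_int A *\<^sub>v v) $ i = (x \<cdot>\<^sub>v v) $ i"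
      using i by (simp add: v_def A_def c sum scalar_prod_def atLeast0LessThan)
  qed (simp add: A_def v_def)
  moreover obtain j where "j < n" "ws ! j = s0" using ne ws n_def by (metis in_set_conv_nth)
  then have "v \<noteq> 0\<^sub>v n" using ne unfolding v_def by (metis index_vec index_zero_vec(1))
  ultimately have "eigenvector (map_mat of_int A) v x"
    using A' by (auto simp: eigenvector_def v_def)
  then have "eigenvalue (map_mat of_int A) x" unfolding eigenvalue_def by blast
  then have "poly (char_poly (map_mat of_int A)) x = 0"
    by (rule iffD1[OF eigenvalue_root_char_poly[OF A']])
  then have "poly (map_poly of_int (char_poly A)) x = 0"
    by (simp add: of_int_hom.char_poly_hom[OF A])
  then show ?thesis
    using degree_monic_char_poly[OF A] by (auto simp: algebraic_int_altdef_ipoly)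
qed

text \<open>
  The monomials \<open>x\<^sup>i y\<^sup>j\<close> with exponents below the degrees of monic equations for \<open>x\<close> and \<open>y\<close>
  generate one module that is stable under both elements, hence under their sum and product.
\<close>

lemma algebraic_int_pair_module:
  fixes x y :: "'a::field_char_0"
  assumes "algebraic_int x" "algebraic_int y"
  shows "\<exists>S. finite S \<and> 1 \<in> S \<and> (\<forall>s\<in>S. x * s \<in> int_span S) \<and> (\<forall>s\<in>S. y * s \<in> int_span S)"
proof -
  have pow: "\<exists>m>0. \<exists>c. z ^ m = (\<Sum>i<m. of_int (c i) * z ^ i)" if z: "algebraic_int z" for z :: 'a
  proof -
    obtain p where p: "poly (map_poly of_int p) z = 0" "lead_coeff p = 1"
      using z by (auto simp: algebraic_int_altdef_ipoly)
    have "degree p \<noteq> 0"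
    proof
      assume "degree p = 0"
      then obtain a where "p = [:a:]" by (metis degree_0_id)
      with p show False by (simp add: map_poly_pCons)
    qed
    moreover have "0 = (\<Sum>i\<le>degree p. of_int (coeff p i) * z ^ i)"
      using p(1) by (simp add: poly_altdef coeff_map_poly degree_map_poly)
    then have "z ^ degree p = (\<Sum>i<degree p. of_int (- coeff p i) * z ^ i)"
    proof -
      assume "0 = (\<Sum>i\<le>degree p. of_int (coeff p i) * z ^ i)"
      then have "z ^ degree p + (\<Sum>i<degree p. of_int (coeff p i) * z ^ i) = 0"
        using p(2) by (simp add: lessThan_Suc_atMost[symmetric] add.commute)
      then show ?thesis by (simp only: sum_negf eq_neg_iff_add_eq_0 of_int_minus mult_minus_left)
    qed
    ultimately show ?thesis
      by (intro exI[of _ "degree p"] conjI exI[of _ "\<lambda>i. - coeff p i"]) auto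
  qed
  obtain m c where m: "m > 0" "x ^ m = (\<Sum>i<m. of_int (c i) * x ^ i)" using pow[OF assms(1)] by auto
  obtain n d where n: "n > 0" "y ^ n = (\<Sum>i<n. of_int (d i) * y ^ i)" using pow[OF assms(2)] by auto
  define S where "S = (\<lambda>(i,j). x ^ i * y ^ j) ` ({..<m} \<times> {..<n})"
  have fin: "finite S" by (simp add: S_def)
  have mem: "x ^ i * y ^ j \<in> int_span S" if "i < m" "j < n" for i j
    using that by (intro int_span_base) (auto simp: S_def)
  have "x * s \<in> int_span S" if s: "s \<in> S" for s
  proof -
    obtain i j where ij: "i < m" "j < n" "s = x ^ i * y ^ j" using s by (auto simp: S_def)
    show ?thesis
    proof (cases "Suc i < m")
      case True
      then show ?thesis using mem[OF True ij(2)] ij by (simp add: mult.assoc)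
    next
      case False
      then have "x * s = x ^ m * y ^ j" using ij by (simp add: mult.assoc le_less_Suc_eq flip: power_Suc)
         (metis Suc_lessI power_Suc mult.assoc)
      also have "\<dots> = (\<Sum>i<m. of_int (c i) * (x ^ i * y ^ j))"
        by (simp add: m(2) sum_distrib_right mult.assoc)
      finally show ?thesis
        by (simp only:) (intro int_span_sum int_span_mult_int mem; use ij in simp)
    qed
  qed
  moreover have "y * s \<in> int_span S" if s: "s \<in> S" for s
  proof -
    obtain i j where ij: "i < m" "j < n" "s = x ^ i * y ^ j" using s by (auto simp: S_def)
    show ?thesis
    proof (cases "Suc j < n")
      case True
      then show ?thesis using mem[OF ij(1) True] ij by (simp add: ac_simps)
    next
      case False
      then have "n = Suc j" using ij by simp
      then have "y * s = x ^ i * y ^ n" using ij by (simp add: ac_simps)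
      also have "\<dots> = (\<Sum>j<n. of_int (d j) * (x ^ i * y ^ j))"
        by (simp add: n(2) sum_distrib_left ac_simps)
      finally show ?thesis
        by (simp only:) (intro int_span_sum int_span_mult_int mem; use ij in simp)
    qed
  qed
  moreover have "1 \<in> S" using m(1) n(1) by (auto simp: S_def intro!: image_eqI[of _ _ "(0,0)"])
  ultimately show ?thesis using fin by blast
qed

lemma algebraic_int_add:
  fixes x y :: "'a::field_char_0"
  assumes "algebraic_int x" "algebraic_int y" shows "algebraic_int (x + y)"
proof -
  obtain S where S: "finite S" "1 \<in> S" "\<forall>s\<in>S. x * s \<in> int_span S" "\<forall>s\<in>S. y * s \<in> int_span S"
    using algebraic_int_pair_module[OF assms] by blast
  then show ?thesis
    by (intro algebraic_int_of_stable[of S 1]) (auto simp: distrib_right int_span_add)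
qed

lemma algebraic_int_mult:
  fixes x y :: "'a::field_char_0"
  assumes "algebraic_int x" "algebraic_int y" shows "algebraic_int (x * y)"
proof -
  obtain S where S: "finite S" "1 \<in> S" "\<forall>s\<in>S. x * s \<in> int_span S" "\<forall>s\<in>S. y * s \<in> int_span S"
    using algebraic_int_pair_module[OF assms] by blast
  then show ?thesis
    by (intro algebraic_int_of_stable[of S 1]) (auto simp: mult.assoc int_span_stable)
qed

lemma ring_of_integers_closed [simp, intro]:
  shows "0 \<in> \<O>" "1 \<in> \<O>" "of_int k \<in> \<O>"
    "x \<in> \<O> \<Longrightarrow> y \<in> \<O> \<Longrightarrow> x + y \<in> \<O>"
    "x \<in> \<O> \<Longrightarrow> y \<in> \<O> \<Longrightarrow> x * y \<in> \<O>"
    "x \<in> \<O> \<Longrightarrow> - x \<in> \<O>"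
    "x \<in> \<O> \<Longrightarrow> y \<in> \<O> \<Longrightarrow> x - y \<in> \<O>"
  using algebraic_int_add[of x "- y"]
  by (auto simp: ring_of_integers_def algebraic_int_add algebraic_int_mult int_imp_algebraic_int)

lemma algebraic_number_field_algebraic:
  assumes "algebraic_number_field TYPE('a::field_char_0)"
  shows "algebraic (u :: 'a)"
proof -
  interpret Q: vector_space "\<lambda>(q::rat) (x::'a). of_rat q * x"
    by unfold_locales (auto simp: of_rat_add of_rat_mult algebra_simps)
  obtain B :: "'a set" where B: "finite B" "Q.span B = UNIV"
    using assms unfolding algebraic_number_field_def by auto
  show ?thesis
  proof (cases "inj_on (\<lambda>i. u ^ i) {..card B}")
    case False
    then obtain i j where ij: "i \<noteq> j" "u ^ i = u ^ j" by (auto simp: inj_on_def)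
    define p :: "'a poly" where "p = monom 1 i - monom 1 j"
    have "coeff p i \<noteq> 0" using ij by (simp add: p_def)
    then have "p \<noteq> 0" by auto
    moreover have "poly p u = 0" using ij by (simp add: p_def poly_monom)
    moreover have "coeff p k \<in> \<int>" for k by (auto simp: p_def coeff_monom)
    ultimately show ?thesis by (intro algebraicI)
  next
    case inj: True
    let ?P = "(\<lambda>i. u ^ i) ` {..card B}"
    have "card ?P = Suc (card B)" using inj by (simp add: card_image)
    then have "Q.dependent ?P"
      using Q.independent_span_bound[OF B(1), of ?P] B by fastforce
    then obtain c v where c: "v \<in> ?P" "c v \<noteq> 0" "(\<Sum>v\<in>?P. of_rat (c v) * v) = 0"
      by (subst (asm) Q.dependent_finite) auto
    define p :: "'a poly" where "p = (\<Sum>i\<le>card B. monom (of_rat (c (u ^ i))) i)"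
    have co: "coeff p k = (if k \<le> card B then of_rat (c (u ^ k)) else 0)" for k
      by (simp add: p_def coeff_sum coeff_monom if_distrib)
    obtain k where "k \<le> card B" "v = u ^ k" using c(1) by auto
    then have "coeff p k \<noteq> 0" using c by (simp add: co)
    then have "p \<noteq> 0" by auto
    moreover have "poly p u = (\<Sum>v\<in>?P. of_rat (c v) * v)"
      using inj by (simp add: p_def poly_sum poly_monom sum.reindex)
    ultimately show ?thesis using c(3) by (intro algebraicI'[of p]) (auto simp: co)
  qed
qed

text \<open>
  The \<open>b k\<close> are the partial sums of the Horner scheme for a primitive integer polynomial with
  root \<open>u\<close>. Both \<open>b k\<close> and \<open>u * b k\<close> preserve the module generated by \<open>1, u, \<dots>, u\<^bsup>n-1\<^esup>\<close>: products of
  low degree stay in it obviously, and in the others the leading part of the polynomial is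
  replaced by minus the remaining part. The recursion shows that every coefficient is an
  integral combination of these elements, so that they cannot all lie in one prime ideal.
\<close>

lemma algebraic_primitive_witness:
  fixes u :: "'a::field_char_0"
  assumes "algebraic u"
  obtains n :: nat and c :: "nat \<Rightarrow> int" and b :: "nat \<Rightarrow> 'a" where
    "c n \<noteq> 0" "n > 0" "Gcd (c ` {..n}) = 1" "b 0 = of_int (c n)" "b n = 0"
    "\<And>k. k < n \<Longrightarrow> b (Suc k) = u * b k + of_int (c (n - Suc k))"
    "\<And>k. k < n \<Longrightarrow> b k \<in> \<O>"
    "\<And>k. k < n \<Longrightarrow> u * b k \<in> \<O>"
proof -
  obtain q where q: "q \<noteq> 0" "poly (map_poly of_int q) u = 0"
    using assms by (elim algebraicE')
  define p where "p = primitive_part q"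
  have "map_poly of_int (smult k r) = smult (of_int k :: 'a) (map_poly of_int r)" for k r
    by (rule poly_eqI) (simp add: coeff_map_poly)
  moreover have "q = smult (content q) p" by (simp add: p_def content_times_primitive_part)
  ultimately have "poly (map_poly of_int q) u = of_int (content q) * poly (map_poly of_int p) u"
    by (metis poly_smult)
  then have p0: "poly (map_poly of_int p) u = 0" using q by simp
  have pn: "p \<noteq> 0" using q by (simp add: p_def)
  define n where "n = degree p"
  define c where "c = coeff p"
  have cn: "c n \<noteq> 0" using pn by (simp add: c_def n_def)
  have root: "(\<Sum>i\<le>n. of_int (c i) * u ^ i) = 0"
    using p0 by (simp add: poly_altdef coeff_map_poly degree_map_poly n_def c_def)
  then have npos: "n > 0" using cn by (intro Nat.gr0I) auto
  have gcd: "Gcd (c ` {..n}) = 1"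
  proof -
    have "set (coeffs p) = c ` {..n}"
      using pn by (simp add: coeffs_def c_def n_def atLeast0LessThan lessThan_Suc_atMost del: upt_Suc)
    then have "content p = Gcd (c ` {..n})" by (simp add: content_def)
    then show ?thesis using q by (simp add: p_def)
  qed
  define b where "b k = (\<Sum>j\<le>k. of_int (c (n - j)) * u ^ (k - j))" for k
  have b0: "b 0 = of_int (c n)" by (simp add: b_def)
  have bS: "b (Suc k) = u * b k + of_int (c (n - Suc k))" for k
    by (simp add: b_def sum_distrib_left Suc_diff_le algebra_simps)
  \<comment> \<open>\<open>u\<^bsup>n-k\<^esup> b\<^sub>k\<close> is the leading part of the polynomial, evaluated at \<open>u\<close>.\<close>
  have top: "u ^ (n - k) * b k = (\<Sum>i=n-k..n. of_int (c i) * u ^ i)" if "k \<le> n" for k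
    using that
  proof (induction k)
    case (Suc k)
    have e: "n - k = Suc (n - Suc k)" using Suc.prems by simp
    have "u ^ (n - Suc k) * b (Suc k) = u ^ (n - k) * b k + of_int (c (n - Suc k)) * u ^ (n - Suc k)"
      unfolding bS e by (simp add: algebra_simps)
    also have "\<dots> = (\<Sum>i=n - Suc k..n. of_int (c i) * u ^ i)"
      using Suc by (simp add: e sum.atLeast_Suc_atMost[of "n - Suc k" n])
    finally show ?case .
  qed (simp add: b0 mult.commute)
  have bn: "b n = 0" using top[of n] root by (simp add: atMost_atLeast0)
  define S where "S = (\<lambda>i. u ^ i) ` {..<n}"
  have fin: "finite S" by (simp add: S_def)
  have mem: "u ^ i \<in> int_span S" if "i < n" for i
    using that by (intro int_span_base) (auto simp: S_def)
  have low: "b k * u ^ i \<in> int_span S" if "i + k < n" for i k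
    using that
  proof (induction k arbitrary: i)
    case 0 then show ?case by (simp add: b0 int_span_mult_int mem)
  next
    case (Suc k)
    have "b (Suc k) * u ^ i = b k * u ^ Suc i + of_int (c (n - Suc k)) * u ^ i"
      by (simp add: bS algebra_simps)
    then show ?case using Suc.IH[of "Suc i"] Suc.prems
      by (simp only:) (intro int_span_add int_span_mult_int mem; simp)
  qed
  \<comment> \<open>The exponent \<open>i = n\<close> is included, since it accounts for \<open>u * b k\<close> acting on the last generator.\<close>
  have stab: "b k * u ^ i \<in> int_span S" if k: "k < n" and i: "i \<le> n" for k i
  proof (cases "i + k < n")
    case False
    define d where "d = i - (n - k)"
    have di: "i = d + (n - k)" "d + (n - k) \<le> n" using False i k by (auto simp: d_def)
    have "{..n} = {..<n-k} \<union> {n-k..n}" "{..<n-k} \<inter> {n-k..n} = {}" by auto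
    then have "(\<Sum>i<n-k. of_int (c i) * u ^ i) + u ^ (n-k) * b k = 0"
      using root top[of k] k by (simp add: sum.union_disjoint)
    then have eq: "u ^ (n - k) * b k = (\<Sum>l<n-k. of_int (- c l) * u ^ l)"
      by (simp only: sum_negf eq_neg_iff_add_eq_0 of_int_minus mult_minus_left add.commute)
    have "b k * u ^ i = u ^ d * (u ^ (n - k) * b k)" by (simp add: di(1) power_add ac_simps)
    also have "\<dots> = (\<Sum>l<n-k. of_int (- c l) * u ^ (d + l))"
      unfolding eq by (simp add: sum_distrib_left power_add ac_simps)
    finally show ?thesis
      using di by (simp only:) (intro int_span_sum int_span_mult_int mem; simp)
  qed (rule low)
  have one: "1 \<in> S" using npos by (auto simp: S_def intro!: image_eqI[of _ _ 0])
  have int: "b k \<in> \<O>" if k: "k < n" for k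
    unfolding ring_of_integers_def
    by (intro CollectI algebraic_int_of_stable[OF fin one]) (use stab[OF k] in \<open>auto simp: S_def\<close>)
  have int': "u * b k \<in> \<O>" if k: "k < n" for k
  proof -
    have "u * b k * u ^ i \<in> int_span S" if "i < n" for i
      using stab[OF k, of "Suc i"] that by (simp add: ac_simps)
    then show ?thesis unfolding ring_of_integers_def
      by (intro CollectI algebraic_int_of_stable[OF fin one]) (auto simp: S_def)
  qed
  show ?thesis
    by (rule that[where n = n and c = c and b = b, OF cn npos gcd b0 bn bS int int'])
qed

lemma integral_span_eq: "integral_span scale S = ring_span \<O> scale S"
  by (simp add: integral_span_def ring_span_def)

lemma subring_ring_of_integers: "subring \<O>"
  by (auto simp: subring_def)

section \<open>Localization at prime ideals\<close>

definition prime_ideal :: "'a::field_char_0 set \<Rightarrow> bool" where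
  "prime_ideal m \<longleftrightarrow> m \<subseteq> \<O> \<and> submodule_over \<O> (*) m \<and> 1 \<notin> m \<and>
     (\<forall>x\<in>\<O>. \<forall>y\<in>\<O>. x * y \<in> m \<longrightarrow> x \<in> m \<or> y \<in> m)"

text \<open>
  An ideal that is maximal among the proper ones containing \<open>T\<close> is prime.
\<close>

lemma ideal_in_prime_ideal:
  fixes T :: "'a::field_char_0 set"
  assumes T: "T \<subseteq> \<O>" "submodule_over \<O> (*) T" "1 \<notin> T"
  shows "\<exists>m. prime_ideal m \<and> T \<subseteq> m"
proof -
  let ?g = "\<O> :: 'a set"
  define A where "A = {I. I \<subseteq> ?g \<and> submodule_over ?g (*) I \<and> 1 \<notin> I \<and> T \<subseteq> I}"
  have "A \<noteq> {}" using T by (auto simp: A_def)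
  moreover have "\<Union>C \<in> A" if C: "C \<noteq> {}" "subset.chain A C" for C
  proof -
    have sub: "I \<in> A" if "I \<in> C" for I using C that by (auto simp: subset.chain_def)
    have add: "x + y \<in> \<Union>C" if xy: "x \<in> \<Union>C" "y \<in> \<Union>C" for x y
    proof -
      obtain I J where I: "I \<in> C" "x \<in> I" "J \<in> C" "y \<in> J" using xy by blast
      then have "I \<subseteq> J \<or> J \<subseteq> I" using C(2) by (auto simp: subset_chain_def)
      then obtain K where "K \<in> C" "x \<in> K" "y \<in> K" using I by blast
      moreover from this have "submodule_over ?g (*) K" using sub by (auto simp: A_def)
      ultimately show ?thesis using submodule_overD(2)[of ?g "(*)" K x y] by blast
    qed
    have mult: "c * x \<in> \<Union>C" if cx: "c \<in> ?g" "x \<in> \<Union>C" for c x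
    proof -
      obtain I where "I \<in> C" "x \<in> I" using cx by blast
      moreover from this have "submodule_over ?g (*) I" using sub by (auto simp: A_def)
      ultimately show ?thesis using submodule_overD(3)[of ?g "(*)" I c x] cx(1) by blast
    qed
    obtain I where I: "I \<in> C" using C by blast
    then have "submodule_over ?g (*) I" "T \<subseteq> I" using sub[of I] unfolding A_def by blast+
    then have "0 \<in> \<Union>C" "T \<subseteq> \<Union>C" using I submodule_overD(1)[of ?g "(*)" I] by blast+
    then have "submodule_over ?g (*) (\<Union>C)" unfolding submodule_over_def by (intro conjI ballI add mult)
    moreover have "\<Union>C \<subseteq> ?g" "1 \<notin> \<Union>C" using sub unfolding A_def by blast+
    ultimately show ?thesis unfolding A_def using \<open>T \<subseteq> \<Union>C\<close> by blast
  qed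
  ultimately obtain m where m: "m \<in> A" and max: "\<And>X. X \<in> A \<Longrightarrow> m \<subseteq> X \<Longrightarrow> X = m"
    using subset_Zorn_nonempty[of A] by metis
  have ms: "submodule_over ?g (*) m" "m \<subseteq> ?g" using m by (auto simp: A_def)
  note md = submodule_overD[OF ms(1)]
  have one: "\<exists>a\<in>m. \<exists>c\<in>?g. 1 = a + c * x" if x: "x \<in> ?g" "x \<notin> m" for x
  proof (rule ccontr)
    assume no: "\<not> (\<exists>a\<in>m. \<exists>c\<in>?g. 1 = a + c * x)"
    define X where "X = {a + c * x | a c. a \<in> m \<and> c \<in> ?g}"
    have memX: "a + c * x \<in> X" if "a \<in> m" "c \<in> ?g" for a c using that by (auto simp: X_def)
    have "m \<subseteq> X" using memX[of _ 0] by auto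
    have "X \<subseteq> ?g" using ms(2) x(1) by (auto simp: X_def)
    moreover have "submodule_over ?g (*) X" unfolding submodule_over_def
    proof (intro conjI ballI)
      show "0 \<in> X" using memX[of 0 0] md(1) by simp
    next
      fix y z assume "y \<in> X" "z \<in> X"
      then obtain a c b d where "y = a + c * x" "z = b + d * x" "a \<in> m" "b \<in> m" "c \<in> ?g" "d \<in> ?g"
        by (auto simp: X_def)
      then show "y + z \<in> X" using memX[of "a + b" "c + d"] md(2) by (simp add: algebra_simps)
    next
      fix k y assume "k \<in> ?g" "y \<in> X"
      then obtain a c where y: "y = a + c * x" "a \<in> m" "c \<in> ?g" by (auto simp: X_def)
      show "k * y \<in> X"
        using memX[OF md(3)[OF \<open>k \<in> ?g\<close> y(2)] ring_of_integers_closed(5)[OF \<open>k \<in> ?g\<close> y(3)]]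
        by (simp add: y(1) algebra_simps)
    qed
    moreover have "1 \<notin> X" using no by (auto simp: X_def)
    ultimately have "X \<in> A" using \<open>m \<subseteq> X\<close> m by (auto simp: A_def)
    then have "X = m" using max \<open>m \<subseteq> X\<close> by blast
    moreover have "x \<in> X" using memX[of 0 1] md(1) by simp
    ultimately show False using x by simp
  qed
  have "x \<in> m \<or> y \<in> m" if xy: "x \<in> ?g" "y \<in> ?g" "x * y \<in> m" for x y
  proof (rule ccontr)
    assume "\<not> (x \<in> m \<or> y \<in> m)"
    then obtain a c b d where *: "a \<in> m" "c \<in> ?g" "1 = a + c * x" "b \<in> m" "d \<in> ?g" "1 = b + d * y"
      using one[of x] one[of y] xy by blast
    have "1 = (a + c * x) * (b + d * y)" using * by (metis mult_1)
    also have "\<dots> = (b + d * y) * a + ((c * x) * b + (c * d) * (x * y))" by (simp add: algebra_simps)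
    also have "\<dots> \<in> m" by (rule md(2)[OF md(3) md(2)[OF md(3) md(3)]]) (use * xy ms(2) in auto)
    finally show False using m by (simp add: A_def)
  qed
  then have "prime_ideal m" using m by (auto simp: prime_ideal_def A_def)
  then show ?thesis using m by (auto simp: A_def)
qed

definition loc :: "('a::field_char_0 \<Rightarrow> 'b::ab_group_add \<Rightarrow> 'b) \<Rightarrow> 'a set \<Rightarrow> 'b set \<Rightarrow> 'b set" where
  "loc scale m N = {x. \<exists>s\<in>\<O> - m. scale s x \<in> N}"

abbreviation loc_ring :: "'a::field_char_0 set \<Rightarrow> 'a set" where
  "loc_ring m \<equiv> loc (*) m \<O>"

context
  fixes m :: "'a::field_char_0 set"
  assumes m: "prime_ideal m"
begin

lemma denominators:
  "1 \<in> \<O> - m" "s \<in> \<O> - m \<Longrightarrow> s \<noteq> 0"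
  "s \<in> \<O> - m \<Longrightarrow> t \<in> \<O> - m \<Longrightarrow> s * t \<in> \<O> - m"
  using m by (auto simp: prime_ideal_def submodule_over_def)

lemma loc_superset:
  assumes "vector_space scale" shows "N \<subseteq> loc scale m N"
proof -
  interpret vector_space scale by fact
  show ?thesis using denominators(1) by (force simp: loc_def)
qed

lemma loc_mono: "A \<subseteq> B \<Longrightarrow> loc scale m A \<subseteq> loc scale m B"
  by (auto simp: loc_def)

lemma subring_loc_ring: "subring (loc_ring m)"
proof -
  have "x - y \<in> loc_ring m" "x * y \<in> loc_ring m" if xy: "x \<in> loc_ring m" "y \<in> loc_ring m" for x y
  proof -
    obtain s t where st: "s \<in> \<O> - m" "t \<in> \<O> - m"
      "s * x \<in> \<O>" "t * y \<in> \<O>" using xy by (auto simp: loc_def)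
    have "(s * t) * (x - y) = t * (s * x) - s * (t * y)" "(s * t) * (x * y) = (s * x) * (t * y)"
      by (simp_all add: algebra_simps)
    moreover have "t * (s * x) - s * (t * y) \<in> \<O>"
      by (rule ring_of_integers_closed(7)[OF ring_of_integers_closed(5) ring_of_integers_closed(5)]) (use st in auto)
    moreover have "(s * x) * (t * y) \<in> \<O>" by (rule ring_of_integers_closed(5)) (use st in auto)
    ultimately show "x - y \<in> loc_ring m" "x * y \<in> loc_ring m"
      unfolding loc_def using denominators(3)[OF st(1,2)] by (metis (mono_tags, lifting) mem_Collect_eq)+
  qed
  moreover have "1 \<in> loc_ring m" using denominators(1) by (auto simp: loc_def)
  ultimately show ?thesis by (simp add: subring_def)
qed

lemma ring_of_integers_subset_loc_ring: "\<O> \<subseteq> loc_ring m"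
  by (rule loc_superset[OF vector_space_self])

lemma inverse_denominator: "s \<in> \<O> - m \<Longrightarrow> inverse s \<in> loc_ring m"
  using denominators(2)[of s] by (auto simp: loc_def intro!: bexI[of _ s])

lemma submodule_loc:
  assumes "vector_space scale" "submodule_over \<O> scale N"
  shows "submodule_over (loc_ring m) scale (loc scale m N)"
proof -
  interpret vector_space scale by fact
  note N = submodule_overD[OF assms(2)]
  have "x + y \<in> loc scale m N" if xy: "x \<in> loc scale m N" "y \<in> loc scale m N" for x y
  proof -
    obtain s t where st: "s \<in> \<O> - m" "t \<in> \<O> - m"
      "scale s x \<in> N" "scale t y \<in> N" using xy by (auto simp: loc_def)
    have "scale (s * t) (x + y) = scale t (scale s x) + scale s (scale t y)"
      by (simp add: scale_right_distrib mult.commute)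
    also have "\<dots> \<in> N" by (rule N(2)[OF N(3) N(3)]) (use st in auto)
    finally show ?thesis using denominators(3)[OF st(1,2)] unfolding loc_def by blast
  qed
  moreover have "scale c x \<in> loc scale m N" if xy: "c \<in> loc_ring m" "x \<in> loc scale m N" for c x
  proof -
    obtain s t where st: "s \<in> \<O> - m" "t \<in> \<O> - m"
      "s * c \<in> \<O>" "scale t x \<in> N" using xy by (auto simp: loc_def)
    have "scale (s * t) (scale c x) = scale (s * c) (scale t x)" by (simp add: ac_simps)
    also have "\<dots> \<in> N" by (rule N(3)) (use st in auto)
    finally show ?thesis using denominators(3)[OF st(1,2)] unfolding loc_def by blast
  qed
  moreover have "0 \<in> loc scale m N" using N(1) loc_superset[OF assms(1)] by blast
  ultimately show ?thesis by (simp add: submodule_over_def)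
qed

lemma loc_ring_span:
  assumes "vector_space scale"
  shows "loc scale m (integral_span scale S) = ring_span (loc_ring m) scale S"
proof
  interpret vector_space scale by fact
  let ?N = "integral_span scale S" and ?M = "ring_span (loc_ring m) scale S"
  have N: "submodule_over \<O> scale ?N"
    by (simp add: integral_span_eq submodule_ring_span assms subring_ring_of_integers)
  have M: "submodule_over (loc_ring m) scale ?M"
    by (simp add: submodule_ring_span assms subring_loc_ring)
  show "?M \<subseteq> loc scale m ?N"
    using submodule_loc[OF assms N] loc_superset[OF assms, of ?N]
      ring_span_superset[OF assms subring_ring_of_integers, of S]
    by (intro ring_span_minimal) (auto simp: integral_span_eq)
  show "loc scale m ?N \<subseteq> ?M"
  proof
    fix x assume "x \<in> loc scale m ?N"
    then obtain s where s: "s \<in> \<O> - m" "scale s x \<in> ?N" by (auto simp: loc_def)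
    have "?N \<subseteq> ?M"
      using ring_of_integers_subset_loc_ring by (fastforce simp: ring_span_def integral_span_def)
    then have "scale (inverse s) (scale s x) \<in> ?M"
      by (intro submodule_overD(3)[OF M inverse_denominator]) (use s in auto)
    then show "x \<in> ?M" using denominators(2)[OF s(1)] by simp
  qed
qed

text \<open>
  A single denominator serves finitely many elements. This is what turns a local statement
  about a finitely generated lattice into a global one.
\<close>

lemma common_denominator:
  assumes "vector_space scale" "submodule_over \<O> scale N" "finite S" "S \<subseteq> loc scale m N"
  shows "\<exists>s\<in>\<O> - m. \<forall>x\<in>S. scale s x \<in> N"
  using assms(3,4)
proof (induction S)
  case empty then show ?case using denominators(1) by blast
next
  case (insert x S)
  interpret vector_space scale by fact
  obtain s t where st: "s \<in> \<O> - m" "\<forall>x\<in>S. scale s x \<in> N" "t \<in> \<O> - m" "scale t x \<in> N"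
    using insert by (auto simp: loc_def)
  have "scale (s * t) y \<in> N" if y: "y \<in> insert x S" for y
  proof (cases "y = x")
    case True
    have "scale s (scale t y) \<in> N" by (rule submodule_overD(3)[OF assms(2)]) (use st True in auto)
    then show ?thesis by simp
  next
    case False
    have "scale t (scale s y) \<in> N" by (rule submodule_overD(3)[OF assms(2)]) (use st y False in auto)
    then show ?thesis by (simp add: mult.commute)
  qed
  then show ?case using denominators(3)[OF st(1,3)] by blast
qed

end

text \<open>
  The scalars \<open>s\<close> with \<open>s x \<in> N\<close> form an ideal, which by assumption lies in no prime ideal.
\<close>

lemma local_global:
  assumes "vector_space scale" "submodule_over \<O> scale N"
    and x: "\<And>m. prime_ideal m \<Longrightarrow> x \<in> loc scale m N"
  shows "x \<in> N"
proof (rule ccontr)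
  interpret vector_space scale by fact
  note N = submodule_overD[OF assms(2)]
  define T where "T = {s\<in>\<O>. scale s x \<in> N}"
  assume "x \<notin> N"
  then have "1 \<notin> T" by (simp add: T_def)
  moreover have "submodule_over \<O> (*) T"
    using N by (auto simp: submodule_over_def T_def scale_left_distrib simp flip: scale_scale)
  moreover have "T \<subseteq> \<O>" by (auto simp: T_def)
  ultimately obtain m where "prime_ideal m" "T \<subseteq> m" using ideal_in_prime_ideal by blast
  with x[of m] show False by (auto simp: loc_def T_def)
qed

definition valuation_ring :: "'a::field set \<Rightarrow> bool" where
  "valuation_ring R \<longleftrightarrow> subring R \<and> (\<forall>u. u \<in> R \<or> inverse u \<in> R)"

text \<open>
  If neither \<open>u\<close> nor its inverse were \<open>m\<close>-integral, then all \<open>b k\<close> and \<open>u * b k\<close> of the Horner scheme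
  would lie in \<open>m\<close>: an element \<open>b k\<close> outside \<open>m\<close> is a denominator for \<open>u\<close>, and \<open>u * b k\<close> outside \<open>m\<close> is one
  for \<open>1/u\<close>. Then \<open>m\<close> would contain all coefficients, hence their greatest common divisor \<open>1\<close>.
\<close>

lemma valuation_loc_ring:
  fixes m :: "'a::field_char_0 set"
  assumes "algebraic_number_field TYPE('a)" "prime_ideal m"
  shows "valuation_ring (loc_ring m)"
proof -
  have ms: "submodule_over \<O> (*) m" "1 \<notin> m" using assms(2) by (auto simp: prime_ideal_def)
  note md = submodule_overD[OF ms(1)]
  have neg: "- x \<in> m" if "x \<in> m" for x using md(3)[of "-1" x] that by auto
  have "u \<in> loc_ring m \<or> inverse u \<in> loc_ring m" for u
  proof (rule ccontr)
    assume no: "\<not> (u \<in> loc_ring m \<or> inverse u \<in> loc_ring m)"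
    then have u0: "u \<noteq> 0" using subringD(1)[OF subring_loc_ring[OF assms(2)]] by auto
    obtain n c b where w: "c n \<noteq> (0::int)" "n > 0" "Gcd (c ` {..n}) = 1" "b 0 = of_int (c n)" "b n = 0"
      "\<And>k. k < n \<Longrightarrow> b (Suc k) = u * b k + of_int (c (n - Suc k))"
      "\<And>k. k < n \<Longrightarrow> b k \<in> \<O>"
      "\<And>k. k < n \<Longrightarrow> u * b k \<in> \<O>"
      using algebraic_primitive_witness[OF algebraic_number_field_algebraic[OF assms(1)], of u] by metis
    have ub: "u * b k \<in> m" if "k < n" for k
    proof (rule ccontr)
      assume "u * b k \<notin> m"
      then have "inverse u \<in> loc_ring m" using w(7,8)[OF that] u0
        by (auto simp: loc_def field_simps intro!: bexI[of _ "u * b k"])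
      with no show False by simp
    qed
    have bm: "b k \<in> m" if "k \<le> n" for k
    proof (cases "k = n")
      case True then show ?thesis using w(5) md(1) by simp
    next
      case False
      show ?thesis
      proof (rule ccontr)
        assume "b k \<notin> m"
        then have "u \<in> loc_ring m" using w(7,8)[of k] that False
          by (auto simp: loc_def mult.commute intro!: bexI[of _ "b k"])
        with no show False by simp
      qed
    qed
    have cm: "of_int (c i) \<in> m" if i: "i \<le> n" for i
    proof (cases "i = n")
      case True then show ?thesis using bm[of 0] w(4) by simp
    next
      case False
      define k where "k = n - Suc i"
      have k: "k < n" "n - Suc k = i" using i False by (auto simp: k_def)
      have "of_int (c i) = b (Suc k) + - (u * b k)" using w(6)[OF k(1)] k(2) by simp
      also have "\<dots> \<in> m" by (rule md(2)[OF _ neg]) (use bm[of "Suc k"] ub[OF k(1)] k(1) in auto)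
      finally show ?thesis .
    qed
    \<comment> \<open>The integers in \<open>m\<close> form an ideal, which is closed under greatest common divisors.\<close>
    define J where "J = {z::int. of_int z \<in> m}"
    have J: "of_int 0 \<in> m" "x \<in> J \<Longrightarrow> y \<in> J \<Longrightarrow> x + y \<in> J" "x \<in> J \<Longrightarrow> k * x \<in> J" for x y k :: int
      using md by (auto simp: J_def)
    have "Gcd A \<in> J" if "finite A" "A \<subseteq> J" for A
      using that
    proof (induction A)
      case empty then show ?case using J by (simp add: J_def)
    next
      case (insert a A)
      obtain x y where "x * a + y * Gcd A = gcd a (Gcd A)" using bezout_int by blast
      then show ?case using insert J(2)[OF J(3)[of a x] J(3)[of "Gcd A" y]] by simp
    qed
    from this[of "c ` {..n}"] have "1 \<in> J" using cm w(3) by (auto simp: J_def)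
    then show False using ms(2) by (simp add: J_def)
  qed
  then show ?thesis using subring_loc_ring[OF assms(2)] by (simp add: valuation_ring_def)
qed

lemma integral_denominator:
  fixes u :: "'a::field_char_0"
  assumes "algebraic_number_field TYPE('a)"
  shows "\<exists>d\<in>\<O>. d \<noteq> 0 \<and> d * u \<in> \<O>"
proof -
  obtain n c b where w: "c n \<noteq> (0::int)" "n > 0" "Gcd (c ` {..n}) = 1" "b 0 = of_int (c n)" "b n = 0"
      "\<And>k. k < n \<Longrightarrow> b (Suc k) = u * b k + of_int (c (n - Suc k))"
      "\<And>k. k < n \<Longrightarrow> b k \<in> \<O>"
      "\<And>k. k < n \<Longrightarrow> u * b k \<in> \<O>"
      using algebraic_primitive_witness[OF algebraic_number_field_algebraic[OF assms(1)], of u] by metis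
  then show ?thesis
    using w(7)[of 0] w(8)[of 0] by (intro bexI[of _ "b 0"]) (auto simp: mult.commute)
qed

lemma valuation_ringD:
  assumes "valuation_ring R"
  shows "subring R" "u \<notin> R \<Longrightarrow> inverse u \<in> R"
  using assms by (auto simp: valuation_ring_def)

text \<open>
  Divisibility in a valuation ring is total; the element found here serves as pivot below.
\<close>

lemma valuation_ring_dominant:
  assumes R: "valuation_ring R" and "finite A" "a0 \<in> A" "a0 \<noteq> 0"
  shows "\<exists>a\<in>A. a \<noteq> 0 \<and> (\<forall>b\<in>A. b / a \<in> R)"
proof -
  note Rd = subringD[OF valuation_ringD(1)[OF R]]
  have "A \<noteq> {} \<Longrightarrow> (\<exists>a\<in>A. a \<noteq> 0) \<Longrightarrow> \<exists>a\<in>A. a \<noteq> 0 \<and> (\<forall>b\<in>A. b / a \<in> R)"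
    using assms(2)
  proof (induction rule: finite_induct)
    case (insert x A)
    show ?case
    proof (cases "\<exists>a\<in>A. a \<noteq> 0")
      case False
      then have "x \<noteq> 0" using insert.prems by auto
      then show ?thesis using False Rd(1,2) by (intro bexI[of _ x]) auto
    next
      case True
      then obtain a where a: "a \<in> A" "a \<noteq> 0" "\<forall>b\<in>A. b / a \<in> R" using insert.IH by blast
      show ?thesis
      proof (cases "x / a \<in> R")
        case True then show ?thesis using a by blast
      next
        case False
        then have x0: "x \<noteq> 0" using Rd(1) by auto
        have ax: "a / x \<in> R" using valuation_ringD(2)[OF R False] by simp
        have "b / x \<in> R" if "b \<in> A" for b
        proof -
          have "b / a * (a / x) \<in> R" using a that ax by (intro Rd) auto
          then show ?thesis using a(2) by simp
        qed
        then show ?thesis using x0 Rd(2) by (intro bexI[of _ x]) auto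
      qed
    qed
  qed simp
  then show ?thesis using assms by blast
qed

lemma loc_mult_image:
  assumes m: "prime_ideal m"
  shows "loc (*) m ((\<lambda>a. c * a) ` A) = (\<lambda>a. c * a) ` loc (*) m A"
proof (intro equalityI subsetI)
  fix x assume "x \<in> loc (*) m ((\<lambda>a. c * a) ` A)"
  then obtain s a where s: "s \<in> \<O> - m" "s * x = c * a" "a \<in> A" by (auto simp: loc_def)
  note s0 = denominators(2)[OF m s(1)]
  have "a / s \<in> loc (*) m A" using s s0 by (auto simp: loc_def intro!: bexI[of _ s])
  moreover have "x = c * (a / s)" using s(2) s0 by (simp add: field_simps)
  ultimately show "x \<in> (\<lambda>a. c * a) ` loc (*) m A" by blast
next
  fix x assume "x \<in> (\<lambda>a. c * a) ` loc (*) m A"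
  then obtain s a where s: "s \<in> \<O> - m" "x = c * a" "s * a \<in> A" by (auto simp: loc_def)
  then have "s * x = c * (s * a)" by simp
  then show "x \<in> loc (*) m ((\<lambda>a. c * a) ` A)" using s unfolding loc_def by blast
qed

lemma loc_ideal_mult:
  assumes m: "prime_ideal m"
    and A: "loc (*) m A = (\<lambda>r. a * r) ` loc_ring m" and B: "loc (*) m B = (\<lambda>r. b * r) ` loc_ring m"
  shows "loc (*) m (ideal_mult A B) = (\<lambda>r. a * b * r) ` loc_ring m"
proof -
  let ?R = "loc_ring m"
  note R = subring_loc_ring[OF m]
  note Rd = subringD[OF R]
  define P where "P = {x * y | x y. x \<in> A \<and> y \<in> B}"
  have eq: "loc (*) m (ideal_mult A B) = ring_span ?R (*) P"
    unfolding ideal_mult_def P_def by (rule loc_ring_span[OF m vector_space_self])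
  have sub: "submodule_over ?R (*) ((\<lambda>r. c * r) ` ?R)" for c
    unfolding submodule_over_def using Rd
    by (auto simp: image_iff distrib_left[symmetric] intro: bexI[of _ 0])
  have "P \<subseteq> (\<lambda>r. a * b * r) ` ?R"
  proof
    fix p assume "p \<in> P"
    then obtain x y where xy: "p = x * y" "x \<in> A" "y \<in> B" by (auto simp: P_def)
    then have "x \<in> loc (*) m A" "y \<in> loc (*) m B" using loc_superset[OF m vector_space_self] by blast+
    then obtain r s where rs: "r \<in> ?R" "x = a * r" "s \<in> ?R" "y = b * s" unfolding A B by blast
    then have "p = a * b * (r * s)" using xy by simp
    then show "p \<in> (\<lambda>r. a * b * r) ` ?R" using Rd(6) rs by blast
  qed
  then have 1: "ring_span ?R (*) P \<subseteq> (\<lambda>r. a * b * r) ` ?R" by (rule ring_span_minimal[OF sub])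
  have "a \<in> loc (*) m A" "b \<in> loc (*) m B" unfolding A B using Rd(2) by force+
  then obtain s t where st: "s \<in> \<O> - m" "s * a \<in> A" "t \<in> \<O> - m" "t * b \<in> B"
    by (auto simp: loc_def)
  have "(s * a) * (t * b) \<in> P" using st by (auto simp: P_def)
  then have st_ab: "(s * t) * (a * b) \<in> ring_span ?R (*) P"
    using ring_span_superset[OF vector_space_self R, of P] by (auto simp: ac_simps)
  have "inverse (s * t) * ((s * t) * (a * b)) \<in> ring_span ?R (*) P"
    by (rule submodule_overD(3)[OF submodule_ring_span[OF vector_space_self R]
          inverse_denominator[OF m denominators(3)[OF m st(1,3)]] st_ab])
  moreover have "inverse (s * t) * ((s * t) * (a * b)) = a * b"
    using left_inverse[OF denominators(2)[OF m denominators(3)[OF m st(1,3)]]] by (metis mult.assoc mult_1)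
  ultimately have ab: "a * b \<in> ring_span ?R (*) P" by (simp only:)
  have "(\<lambda>r. a * b * r) ` ?R \<subseteq> ring_span ?R (*) P"
    using submodule_overD(3)[OF submodule_ring_span[OF vector_space_self R] _ ab] by (auto simp: mult.commute)
  then show ?thesis using 1 eq by blast
qed

lemma submodules_eq_iff_local:
  assumes A: "submodule_over \<O> (*) A" and B: "submodule_over \<O> (*) B"
  shows "A = B \<longleftrightarrow> (\<forall>m. prime_ideal m \<longrightarrow> loc (*) m A = loc (*) m B)"
proof
  assume loc: "\<forall>m. prime_ideal m \<longrightarrow> loc (*) m A = loc (*) m B"
  show "A = B"
  proof (intro equalityI subsetI)
    fix x assume "x \<in> A"
    then show "x \<in> B" using loc loc_superset[OF _ vector_space_self, of _ A]
      by (intro local_global[OF vector_space_self B]) blast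
  next
    fix x assume "x \<in> B"
    then show "x \<in> A" using loc loc_superset[OF _ vector_space_self, of _ B]
      by (intro local_global[OF vector_space_self A]) blast
  qed
qed simp

section \<open>Matrices over a valuation ring\<close>

definition over :: "'a set \<Rightarrow> 'a mat \<Rightarrow> bool" where
  "over R A \<longleftrightarrow> (\<forall>i<dim_row A. \<forall>j<dim_col A. A $$ (i, j) \<in> R)"

lemma overD: "over R A \<Longrightarrow> A \<in> carrier_mat n k \<Longrightarrow> i < n \<Longrightarrow> j < k \<Longrightarrow> A $$ (i, j) \<in> R"
  by (auto simp: over_def)

context
  fixes R :: "'a::field set" assumes R: "subring R"
begin

lemma over_mult:
  assumes "over R A" "over R B" "A \<in> carrier_mat n k" "B \<in> carrier_mat k l"
  shows "over R (A * B)"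
  using assms by (auto simp: over_def scalar_prod_def intro!: subring_sum[OF R] subringD(6)[OF R])

lemma over_add:
  assumes "over R A" "over R B" "A \<in> carrier_mat n k" "B \<in> carrier_mat n k"
  shows "over R (A + B)"
  using assms subringD(4)[OF R] by (auto simp: over_def)

lemma over_one: "over R (1\<^sub>m n)"
  using subringD(1,2)[OF R] by (auto simp: over_def)

lemma over_transpose: "over R A \<Longrightarrow> over R (transpose_mat A)"
  by (auto simp: over_def)

lemma over_diag: "(\<And>i. i < n \<Longrightarrow> d i \<in> R) \<Longrightarrow> over R (mat_diag n d)"
  using subringD(1)[OF R] by (auto simp: over_def mat_diag_def)

lemma over_det: "over R A \<Longrightarrow> A \<in> carrier_mat n n \<Longrightarrow> det A \<in> R"
proof -
  assume A: "over R A" "A \<in> carrier_mat n n"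
  have "signof p \<in> R" for p
    using subringD(2,3)[OF R] by (cases p rule: sign_cases) auto
  moreover have "A $$ (i, p i) \<in> R" if "p permutes {0..<n}" "i < n" for p i
    using overD[OF A] permutes_in_image[OF that(1), of i] that(2) by simp
  ultimately show ?thesis unfolding det_def'[OF A(2)]
    by (intro subring_sum[OF R] subringD(6)[OF R] subring_prod[OF R]) auto
qed

end

definition unimodular :: "'a::field set \<Rightarrow> nat \<Rightarrow> 'a mat \<Rightarrow> bool" where
  "unimodular R n A \<longleftrightarrow> A \<in> carrier_mat n n \<and> over R A \<and>
     (\<exists>B\<in>carrier_mat n n. over R B \<and> A * B = 1\<^sub>m n \<and> B * A = 1\<^sub>m n)"

lemma unimodularE:
  assumes "unimodular R n A"
  obtains B where "A \<in> carrier_mat n n" "over R A" "B \<in> carrier_mat n n" "over R B"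
    "A * B = 1\<^sub>m n" "B * A = 1\<^sub>m n"
  using assms by (auto simp: unimodular_def)

lemma unimodularI:
  assumes "A \<in> carrier_mat n n" "over R A" "B \<in> carrier_mat n n" "over R B"
    "A * B = 1\<^sub>m n" "B * A = 1\<^sub>m n"
  shows "unimodular R n A"
  using assms by (auto simp: unimodular_def)

lemma unimodular_one: "subring R \<Longrightarrow> unimodular R n (1\<^sub>m n)"
  by (rule unimodularI[of _ _ _ "1\<^sub>m n"]) (auto simp: over_one)

lemma unimodular_mult:
  assumes R: "subring R" and "unimodular R n A" "unimodular R n B"
  shows "unimodular R n (A * B)"
proof -
  obtain A' where A: "A \<in> carrier_mat n n" "over R A" "A' \<in> carrier_mat n n" "over R A'"
    "A * A' = 1\<^sub>m n" "A' * A = 1\<^sub>m n" using assms(2) by (elim unimodularE)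
  obtain B' where B: "B \<in> carrier_mat n n" "over R B" "B' \<in> carrier_mat n n" "over R B'"
    "B * B' = 1\<^sub>m n" "B' * B = 1\<^sub>m n" using assms(3) by (elim unimodularE)
  note as = assoc_mult_mat[of _ n n _ n _ n]
  note [simp] = mult_carrier_mat[of _ n n _ n]
  have "A * B * (B' * A') = A * ((B * B') * A')" using A(1,3) B(1,3) by (simp add: as)
  also have "\<dots> = 1\<^sub>m n" using A B(5) by simp
  finally have 1: "A * B * (B' * A') = 1\<^sub>m n" .
  have "B' * A' * (A * B) = B' * ((A' * A) * B)" using A(1,3) B(1,3) by (simp add: as)
  also have "\<dots> = 1\<^sub>m n" using A(6) B by simp
  finally have 2: "B' * A' * (A * B) = 1\<^sub>m n" .
  show ?thesis
    by (rule unimodularI[OF _ _ _ _ 1 2]) (use A B over_mult[OF R] in auto)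
qed

lemma unimodular_swap:
  assumes "subring R" "k < n" "l < n" shows "unimodular R n (swaprows_mat n k l)"
proof -
  have "over R (swaprows_mat n k l)"
    using subringD(1,2)[OF assms(1)] by (auto simp: over_def swaprows_mat_def)
  then show ?thesis using swaprows_mat_inv[OF assms(2,3)]
    by (intro unimodularI[of _ _ _ "swaprows_mat n k l"]) auto
qed

lemma four_block_one: "four_block_mat (1\<^sub>m 1) (0\<^sub>m 1 n) (0\<^sub>m n 1) (1\<^sub>m n) = 1\<^sub>m (Suc n)"
  by (rule eq_matI) auto

lemma over_four_block:
  assumes "over R A" "over R B" "over R C" "over R D"
    "A \<in> carrier_mat 1 1" "B \<in> carrier_mat 1 n" "C \<in> carrier_mat n 1" "D \<in> carrier_mat n n"
  shows "over R (four_block_mat A B C D)"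
  using assms by (auto simp: over_def)

lemma uminus_add_zero: 
  fixes A :: "'a::field mat"
  assumes "A \<in> carrier_mat n k" shows "- A + A = 0\<^sub>m n k" "A + - A = 0\<^sub>m n k"
  using assms by (auto intro!: eq_matI)

lemma lower_block_mult:
  fixes X :: "'a::field mat"
  assumes "X \<in> carrier_mat n 1" "Z \<in> carrier_mat n 1" "U \<in> carrier_mat n n" "W \<in> carrier_mat n n"
  shows "four_block_mat (1\<^sub>m 1) (0\<^sub>m 1 n) X U * four_block_mat (1\<^sub>m 1) (0\<^sub>m 1 n) Z W =
    four_block_mat (1\<^sub>m 1) (0\<^sub>m 1 n) (X + U * Z) (U * W)"
proof -
  have "four_block_mat (1\<^sub>m 1) (0\<^sub>m 1 n) X U * four_block_mat (1\<^sub>m 1) (0\<^sub>m 1 n) Z W =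
    four_block_mat (1\<^sub>m 1 * 1\<^sub>m 1 + 0\<^sub>m 1 n * Z) (1\<^sub>m 1 * 0\<^sub>m 1 n + 0\<^sub>m 1 n * W)
      (X * 1\<^sub>m 1 + U * Z) (X * 0\<^sub>m 1 n + U * W)"
    by (rule mult_four_block_mat) (use assms in auto)
  also have "1\<^sub>m 1 * 1\<^sub>m 1 + 0\<^sub>m 1 n * Z = 1\<^sub>m 1" using assms by simp
  also have "1\<^sub>m 1 * 0\<^sub>m 1 n + 0\<^sub>m 1 n * W = 0\<^sub>m 1 n" using assms by simp
  also have "X * 1\<^sub>m 1 = X" using assms by simp
  also have "X * 0\<^sub>m 1 n + U * W = U * W" using assms by simp
  finally show ?thesis .
qed

text \<open>
  Left factors of this form clear the column below a pivot; right factors of the transposed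
  form clear the row beside it.
\<close>

lemma unimodular_lower_block:
  assumes R: "subring R" and "unimodular R n U" and X: "X \<in> carrier_mat n 1" "over R X"
  shows "unimodular R (Suc n) (four_block_mat (1\<^sub>m 1) (0\<^sub>m 1 n) X U)"
proof -
  obtain U' where U: "U \<in> carrier_mat n n" "over R U" "U' \<in> carrier_mat n n" "over R U'"
    "U * U' = 1\<^sub>m n" "U' * U = 1\<^sub>m n" using assms(2) by (elim unimodularE)
  have UX: "over R (U' * X)" using over_mult[OF R] U X by blast
  have X': "- (U' * X) \<in> carrier_mat n 1" "over R (- (U' * X))"
    using U X UX subringD(3)[OF R] by (auto simp: over_def)
  have 0: "over R (0\<^sub>m 1 n)" using subringD(1)[OF R] by (auto simp: over_def)
  have "U * - (U' * X) = - (U * (U' * X))" using U X by (auto intro!: eq_matI)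
  also have "U * (U' * X) = (U * U') * X" using U X by (intro assoc_mult_mat[symmetric]) auto
  finally have e: "U * - (U' * X) = - X" using U(5) X by simp
  have 1: "four_block_mat (1\<^sub>m 1) (0\<^sub>m 1 n) X U * four_block_mat (1\<^sub>m 1) (0\<^sub>m 1 n) (- (U' * X)) U' = 1\<^sub>m (Suc n)"
    by (subst lower_block_mult) (use U X X' e in \<open>auto simp: uminus_add_zero[OF X(1)] four_block_one simp del: One_nat_def\<close>)
  have 2: "four_block_mat (1\<^sub>m 1) (0\<^sub>m 1 n) (- (U' * X)) U' * four_block_mat (1\<^sub>m 1) (0\<^sub>m 1 n) X U = 1\<^sub>m (Suc n)"
    by (subst lower_block_mult) (use U X X' in \<open>auto simp: uminus_add_zero[of "U' * X" n 1] four_block_one simp del: One_nat_def\<close>)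
  have c: "four_block_mat (1\<^sub>m 1) (0\<^sub>m 1 n) X U \<in> carrier_mat (Suc n) (Suc n)"
    "four_block_mat (1\<^sub>m 1) (0\<^sub>m 1 n) (- (U' * X)) U' \<in> carrier_mat (Suc n) (Suc n)"
    using U X by auto
  show ?thesis
    by (rule unimodularI[OF c(1) _ c(2) _ 1 2])
      (use U X X' 0 over_one[OF R] in \<open>auto intro!: over_four_block\<close>)
qed

lemma unimodular_transpose:
  assumes "subring R" "unimodular R n A" shows "unimodular R n (transpose_mat A)"
proof -
  obtain B where B: "A \<in> carrier_mat n n" "over R A" "B \<in> carrier_mat n n" "over R B"
    "A * B = 1\<^sub>m n" "B * A = 1\<^sub>m n" using assms(2) by (elim unimodularE)
  have "transpose_mat A * transpose_mat B = 1\<^sub>m n" "transpose_mat B * transpose_mat A = 1\<^sub>m n"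
    by (simp_all only: transpose_mult[OF B(1,3), symmetric] transpose_mult[OF B(3,1), symmetric]
        B(5,6) transpose_one)
  then show ?thesis using B over_transpose[OF assms(1)] by (intro unimodularI[of _ _ _ "transpose_mat B"]) auto
qed

lemma unimodular_upper_block:
  assumes R: "subring R" and "unimodular R n V" and Y: "Y \<in> carrier_mat 1 n" "over R Y"
  shows "unimodular R (Suc n) (four_block_mat (1\<^sub>m 1) Y (0\<^sub>m n 1) V)"
proof -
  have "unimodular R (Suc n) (transpose_mat (four_block_mat (1\<^sub>m 1) (0\<^sub>m 1 n) (transpose_mat Y) (transpose_mat V)))"
    using assms by (intro unimodular_transpose unimodular_lower_block over_transpose[OF R]) auto
  also have "transpose_mat (four_block_mat (1\<^sub>m 1) (0\<^sub>m 1 n) (transpose_mat Y) (transpose_mat V))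
     = four_block_mat (1\<^sub>m 1) Y (0\<^sub>m n 1) V"
    using assms(2) Y by (subst transpose_four_block_mat[of _ 1 1 _ n _ n]) (auto simp: unimodular_def)
  finally show ?thesis .
qed

text \<open>
  Choosing as pivot an entry that divides all others, the first row and column can be cleared
  at once, since all quotients by the pivot lie in \<open>R\<close>.
\<close>

lemma smith_normal_form:
  assumes R: "valuation_ring R" and "B \<in> carrier_mat n n"
  shows "\<exists>U V d. unimodular R n U \<and> unimodular R n V \<and> B = U * mat_diag n d * V"
  using assms(2)
proof (induction n arbitrary: B)
  case 0
  then have "B = 1\<^sub>m 0 * mat_diag 0 (\<lambda>_. 0) * 1\<^sub>m 0" by (auto intro!: eq_matI simp: mat_diag_def)
  then show ?case using unimodular_one[OF valuation_ringD(1)[OF R], of 0] by blast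
next
  case (Suc n)
  note S = valuation_ringD(1)[OF R]
  note Sd = subringD[OF S]
  let ?n = "Suc n"
  show ?case
  proof (cases "\<exists>i<?n. \<exists>j<?n. B $$ (i,j) \<noteq> 0")
    case False
    then have "B = 1\<^sub>m ?n * mat_diag ?n (\<lambda>_. 0) * 1\<^sub>m ?n"
      using Suc.prems by (auto intro!: eq_matI simp: mat_diag_def)
    then show ?thesis using unimodular_one[OF S, of ?n] by blast
  next
    case True
    define A where "A = (\<lambda>(i,j). B $$ (i,j)) ` ({..<?n} \<times> {..<?n})"
    have "\<exists>a\<in>A. a \<noteq> 0 \<and> (\<forall>b\<in>A. b / a \<in> R)"
    proof -
      obtain i j where "i < ?n" "j < ?n" "B $$ (i,j) \<noteq> 0" using True by blast
      then show ?thesis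
        by (intro valuation_ring_dominant[OF R, of A "B $$ (i,j)"]) (auto simp: A_def)
    qed
    then obtain p q where pq: "p < ?n" "q < ?n" "B $$ (p,q) \<noteq> 0"
      and dom: "\<And>i j. i < ?n \<Longrightarrow> j < ?n \<Longrightarrow> B $$ (i,j) / B $$ (p,q) \<in> R"
      by (fastforce simp: A_def)
    define P :: "'a mat" where "P = swaprows_mat ?n 0 p"
    define Q :: "'a mat" where "Q = swaprows_mat ?n 0 q"
    have P: "unimodular R ?n P" "P * P = 1\<^sub>m ?n" "P \<in> carrier_mat ?n ?n"
      using unimodular_swap[OF S, of 0 ?n p] swaprows_mat_inv[of 0 ?n p] pq by (auto simp: P_def)
    have Q: "unimodular R ?n Q" "Q * Q = 1\<^sub>m ?n" "Q \<in> carrier_mat ?n ?n"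
      using unimodular_swap[OF S, of 0 ?n q] swaprows_mat_inv[of 0 ?n q] pq by (auto simp: Q_def)
    define C where "C = swapcols 0 q (swaprows 0 p B)"
    have C: "C \<in> carrier_mat ?n ?n" using Suc.prems by (auto simp: C_def)
    have CB: "C = P * B * Q"
      using Suc.prems pq unfolding C_def P_def Q_def
      by (subst swapcols_mat[of _ ?n ?n], auto) (subst swaprows_mat[of _ ?n ?n], auto)
    define b where "b = B $$ (p,q)"
    have b: "b \<noteq> 0" "C $$ (0,0) = b" using pq Suc.prems by (auto simp: b_def C_def)
    have domC: "C $$ (i,j) / b \<in> R" if "i < ?n" "j < ?n" for i j
      using dom[of i j] dom[of p j] dom[of 0 j] dom[of i q] dom[of i 0] dom[of p q] dom[of p 0] dom[of 0 q] dom[of 0 0]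
        that pq Suc.prems by (auto simp: C_def b_def)
    define X where "X = mat n 1 (\<lambda>(i,j). C $$ (Suc i, 0) / b)"
    define Y where "Y = mat 1 n (\<lambda>(i,j). C $$ (0, Suc j) / b)"
    define D where "D = mat n n (\<lambda>(i,j). C $$ (Suc i, Suc j) - C $$ (Suc i, 0) * C $$ (0, Suc j) / b)"
    have XY: "X \<in> carrier_mat n 1" "over R X" "Y \<in> carrier_mat 1 n" "over R Y"
      using domC by (auto simp: X_def Y_def over_def)
    have D: "D \<in> carrier_mat n n" by (simp add: D_def)
    obtain U V d where UV: "unimodular R n U" "unimodular R n V" "D = U * mat_diag n d * V"
      using Suc.IH[OF D] by blast
    have U: "U \<in> carrier_mat n n" "V \<in> carrier_mat n n" using UV by (auto simp: unimodular_def)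
    define d' where "d' i = (if i = 0 then b else d (i - 1))" for i
    define U' where "U' = four_block_mat (1\<^sub>m 1) (0\<^sub>m 1 n) X U"
    define V' where "V' = four_block_mat (1\<^sub>m 1) Y (0\<^sub>m n 1) V"
    have U': "unimodular R ?n U'" "unimodular R ?n V'"
      using unimodular_lower_block[OF S UV(1) XY(1,2)] unimodular_upper_block[OF S UV(2) XY(3,4)]
      by (auto simp: U'_def V'_def)
    define bm where "bm = mat 1 1 (\<lambda>_. b)"
    have bm: "bm \<in> carrier_mat 1 1" by (simp add: bm_def)
    have diag: "mat_diag ?n d' = four_block_mat bm (0\<^sub>m 1 n) (0\<^sub>m n 1) (mat_diag n d)"
      by (rule eq_matI) (auto simp: mat_diag_def d'_def bm_def)
    have "U' * mat_diag ?n d' = four_block_mat bm (0\<^sub>m 1 n) (X * bm) (U * mat_diag n d)"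
      unfolding U'_def diag using XY U bm left_mult_zero_mat[OF mat_diag_dim[of n d], of 1]
      by (subst mult_four_block_mat[of _ 1 1 _ n _ n _ _ 1 _ n]) (auto simp: )
    then have "U' * mat_diag ?n d' * V' = four_block_mat bm (bm * Y) (X * bm) (X * bm * Y + D)"
      unfolding V'_def using XY U bm D UV(3)
        right_mult_zero_mat[of "U * mat_diag n d" n n 1, OF mult_carrier_mat[OF U(1) mat_diag_dim]]
      by (simp, subst mult_four_block_mat[of _ 1 1 _ n _ n _ _ 1 _ n]) (auto simp: )
    also have "\<dots> = C"
    proof (rule eq_matI)
      fix i j assume "i < dim_row C" "j < dim_col C"
      then have ij: "i < ?n" "j < ?n" using C by auto
      have 1: "(bm * Y) $$ (0, k) = C $$ (0, Suc k)" if "k < n" for k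
        using that b by (simp add: bm_def Y_def scalar_prod_def)
      have 2: "(X * bm) $$ (k, 0) = C $$ (Suc k, 0)" if "k < n" for k
        using that b by (simp add: bm_def X_def scalar_prod_def)
      have 3: "(X * bm * Y + D) $$ (k, l) = C $$ (Suc k, Suc l)" if "k < n" "l < n" for k l
      proof -
        have "(X * bm * Y) $$ (k, l) = (X * bm) $$ (k, 0) * Y $$ (0, l)"
          using that XY bm by (simp add: scalar_prod_def)
        then show ?thesis using that XY bm D 2[OF that(1)] by (simp add: D_def Y_def)
      qed
      have dims: "dim_row bm = 1" "dim_col bm = 1" "dim_row (X * bm * Y + D) = n" "dim_col (X * bm * Y + D) = n"
        using bm D XY by auto
      show "four_block_mat bm (bm * Y) (X * bm) (X * bm * Y + D) $$ (i, j) = C $$ (i, j)"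
        using ij 1 2 3 b dims by (cases i; cases j) (auto simp: bm_def)
    qed (use C bm D XY in auto)
    finally have CD: "C = U' * mat_diag ?n d' * V'" by simp
    have carr: "U' \<in> carrier_mat ?n ?n" "V' \<in> carrier_mat ?n ?n" using U' by (auto simp: unimodular_def)
    note as = assoc_mult_mat[of _ ?n ?n _ ?n _ ?n]
    have "B = (P * P) * B * (Q * Q)" unfolding P(2) Q(2) using Suc.prems by simp
    also have "\<dots> = P * C * Q" using P(3) Q(3) Suc.prems by (simp add: CB as mult_carrier_mat[of _ ?n ?n _ ?n])
    also have "\<dots> = (P * U') * mat_diag ?n d' * (V' * Q)"
      using P(3) Q(3) carr by (simp add: CD as mult_carrier_mat[of _ ?n ?n _ ?n])
    finally have "B = (P * U') * mat_diag ?n d' * (V' * Q)" .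
    then show ?thesis using unimodular_mult[OF S P(1) U'(1)] unimodular_mult[OF S U'(2) Q(1)] by blast
  qed
qed

text \<open>
  A matrix over the field is written as a fraction of matrices over \<open>R\<close>, both with a left
  denominator \<open>E\<close> and with a right denominator \<open>E'\<close>; the Bezout identities say that numerator and
  denominator are coprime. The row lattice of \<open>E\<close> consists of the integral vectors \<open>v\<close> for which
  \<open>v B\<close> is integral, so \<open>det E\<close> measures the denominators of \<open>B\<close>. For a diagonal matrix everything
  reduces to one scalar \<open>d\<close>, which is \<open>d / 1\<close> or \<open>1 / (1/d)\<close>, and both denominators then have the
  same determinant up to a unit.
\<close>

lemma coprime_factorizations:
  assumes R: "valuation_ring R" and B: "B \<in> carrier_mat n n"
  obtains E N X Y E' N' X' Y' where
    "E \<in> carrier_mat n n" "N \<in> carrier_mat n n" "X \<in> carrier_mat n n" "Y \<in> carrier_mat n n"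
    "E' \<in> carrier_mat n n" "N' \<in> carrier_mat n n" "X' \<in> carrier_mat n n" "Y' \<in> carrier_mat n n"
    "over R E" "over R N" "over R X" "over R Y" "over R E'" "over R N'" "over R X'" "over R Y'"
    "E * B = N" "E * X + N * Y = 1\<^sub>m n" "B * E' = N'" "X' * E' + Y' * N' = 1\<^sub>m n"
    "det E \<noteq> 0" "det E' / det E \<in> R"
proof -
  note S = valuation_ringD(1)[OF R]
  note Sd = subringD[OF S]
  note as = assoc_mult_mat[of _ n n _ n _ n]
  note [simp] = mult_carrier_mat[of _ n n _ n]
  obtain U V d where UV: "unimodular R n U" "unimodular R n V" "B = U * mat_diag n d * V"
    using smith_normal_form[OF R B] by blast
  obtain Ui where U: "U \<in> carrier_mat n n" "over R U" "Ui \<in> carrier_mat n n" "over R Ui"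
    "U * Ui = 1\<^sub>m n" "Ui * U = 1\<^sub>m n" using UV(1) by (elim unimodularE)
  obtain Vi where V: "V \<in> carrier_mat n n" "over R V" "Vi \<in> carrier_mat n n" "over R Vi"
    "V * Vi = 1\<^sub>m n" "Vi * V = 1\<^sub>m n" using UV(2) by (elim unimodularE)
  have cU: "Ui * (U * Z) = Z" "U * (Ui * Z) = Z" if "Z \<in> carrier_mat n n" for Z
    using that U by (simp_all flip: as)
  have cV: "Vi * (V * Z) = Z" "V * (Vi * Z) = Z" if "Z \<in> carrier_mat n n" for Z
    using that V by (simp_all flip: as)
  define e where "e i = (if d i \<in> R then 1 else inverse (d i))" for i
  define f where "f i = (if d i \<in> R then d i else 1)" for i
  define x where "x i = (if d i \<in> R then 1 else 0 :: 'a)" for i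
  define y where "y i = (if d i \<in> R then 0 else 1 :: 'a)" for i
  have d0: "d i \<noteq> 0" if "d i \<notin> R" for i using that Sd(1) by auto
  have efxy: "e i \<in> R" "f i \<in> R" "x i \<in> R" "y i \<in> R" "e i * d i = f i" "e i * x i + f i * y i = 1" "e i \<noteq> 0" for i
    using Sd(1,2) d0[of i] valuation_ringD(2)[OF R, of "d i"] by (auto simp: e_def f_def x_def y_def)
  let ?D = "mat_diag n"
  have [simp]: "?D g \<in> carrier_mat n n" for g :: "nat \<Rightarrow> 'a" by simp
  have dd: "?D g * (?D h * Z) = ?D (\<lambda>i. g i * h i) * Z" if "Z \<in> carrier_mat n n" for g h and Z :: "'a mat"
    using that by (simp flip: as)
  have one: "?D (\<lambda>i. e i * x i) + ?D (\<lambda>i. f i * y i) = 1\<^sub>m n"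
    by (rule eq_matI) (auto simp: mat_diag_def efxy)
  have EB: "?D e * Ui * B = ?D f * V" using U V by (simp add: UV(3) as cU dd efxy)
  have EX: "?D e * Ui * (U * ?D x) + ?D f * V * (Vi * ?D y) = 1\<^sub>m n"
    using U V by (simp add: as cU cV one)
  have BE: "B * (Vi * ?D e) = U * ?D f" using U V by (simp add: UV(3) as cV efxy mult.commute[of "d _"])
  have XE: "?D x * V * (Vi * ?D e) + ?D y * Ui * (U * ?D f) = 1\<^sub>m n"
    using U V one by (simp add: as cU cV mult.commute[of "x _"] mult.commute[of "y _"])
  have "?D e * ?D (\<lambda>i. inverse (e i)) = 1\<^sub>m n" using efxy(7) by (simp)
  then have "det (?D e) * det (?D (\<lambda>i. inverse (e i))) = 1"
    by (metis det_mult det_one mat_diag_dim)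
  then have De: "det (?D e) \<noteq> 0" by auto
  have Du: "det U * det Ui = 1" using U by (metis det_mult det_one)
  have Du0: "det Ui \<noteq> 0" using Du by auto
  have Du': "det Ui \<noteq> 0" "det U = 1 / det Ui" using Du Du0 by (auto simp: eq_divide_eq)
  have "det (?D e * Ui) = det (?D e) * det Ui" "det (Vi * ?D e) = det Vi * det (?D e)"
    using U V by (auto intro!: det_mult)
  then have d1: "det (?D e * Ui) \<noteq> 0" "det (Vi * ?D e) / det (?D e * Ui) = det Vi * det U"
    using De Du' by auto
  have d2: "det Vi * det U \<in> R" using over_det[OF S] U V Sd(6) by blast
  have ov: "over R (?D e)" "over R (?D f)" "over R (?D x)" "over R (?D y)"
    using over_diag[OF S] efxy by blast+
  show ?thesis
    by (rule that[where E = "?D e * Ui" and N = "?D f * V" and X = "U * ?D x" and Y = "Vi * ?D y" and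
          E' = "Vi * ?D e" and N' = "U * ?D f" and X' = "?D x * V" and Y' = "?D y * Ui",
          OF _ _ _ _ _ _ _ _ _ _ _ _ _ _ _ _ EB EX BE XE d1(1)])
      (use U V ov d1 d2 in \<open>auto intro!: over_mult[OF S, where n = n and k = n and l = n]\<close>)
qed

text \<open>
  Read \<open>G\<close> as the Gram matrix of a lattice \<open>J\<close>, and the rows of \<open>A\<close> as a basis of a lattice \<open>I\<close> in
  coordinates of \<open>J\<close>. Hypothesis \<open>AG\<close> says that \<open>I\<close> is integral, and \<open>max\<close> that \<open>I \<inter> J~ \<subseteq> J\<close>. Let \<open>E1\<close> and
  \<open>N1\<close> be denominator and numerator of \<open>A\<close>, and let \<open>E2\<close> and \<open>E3\<close> be left and right denominators of
  \<open>A * G\<close>. Then \<open>E1\<close> divides \<open>E2\<close> by \<open>max\<close>, \<open>det E2\<close> divides \<open>det E3\<close>, and \<open>E3\<close> divides the transpose of \<open>N1\<close>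
  by \<open>AG\<close>. So \<open>det E1\<close> divides \<open>det N1\<close>, and \<open>det A = det N1 / det E1\<close>.
\<close>

lemma det_in_valuation_ring:
  assumes R: "valuation_ring R"
    and A: "A \<in> carrier_mat n n" and G: "G \<in> carrier_mat n n"
    and AG: "over R (A * G * transpose_mat A)"
    and max: "\<And>Z. Z \<in> carrier_mat n n \<Longrightarrow> over R Z \<Longrightarrow> over R (Z * A * G) \<Longrightarrow> over R (Z * A)"
  shows "det A \<in> R"
proof -
  note S = valuation_ringD(1)[OF R]
  note as = assoc_mult_mat[of _ n n _ n _ n]
  note [simp] = mult_carrier_mat[of _ n n _ n]
  note dist = add_mult_distrib_mat[of _ n n _ _ n] mult_add_distrib_mat[of _ n n _ n]
  have B: "A * G \<in> carrier_mat n n" using A G by simp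
  obtain E1 N1 X1 Y1 where 1: "E1 \<in> carrier_mat n n" "N1 \<in> carrier_mat n n" "X1 \<in> carrier_mat n n" "Y1 \<in> carrier_mat n n"
    "over R E1" "over R N1" "over R X1" "over R Y1" "E1 * A = N1" "E1 * X1 + N1 * Y1 = 1\<^sub>m n" "det E1 \<noteq> 0"
    by (rule coprime_factorizations[OF R A])
  obtain E2 N2 X2 Y2 E3 N3 X3 Y3 where 2: "E2 \<in> carrier_mat n n" "N2 \<in> carrier_mat n n" "X2 \<in> carrier_mat n n" "Y2 \<in> carrier_mat n n"
    "E3 \<in> carrier_mat n n" "N3 \<in> carrier_mat n n" "X3 \<in> carrier_mat n n" "Y3 \<in> carrier_mat n n"
    "over R E2" "over R N2" "over R X2" "over R Y2" "over R E3" "over R N3" "over R X3" "over R Y3"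
    "E2 * (A * G) = N2" "E2 * X2 + N2 * Y2 = 1\<^sub>m n" "(A * G) * E3 = N3" "X3 * E3 + Y3 * N3 = 1\<^sub>m n"
    "det E2 \<noteq> 0" "det E3 / det E2 \<in> R"
    by (rule coprime_factorizations[OF R B])
  have ov: "over R (Z * Z')" if "over R Z" "over R Z'" "Z \<in> carrier_mat n n" "Z' \<in> carrier_mat n n" for Z Z'
    using over_mult[OF S] that by blast
  have ova: "over R (Z + Z')" if "over R Z" "over R Z'" "Z \<in> carrier_mat n n" "Z' \<in> carrier_mat n n" for Z Z'
    using over_add[OF S] that by blast
  have inv_comm: "Z' * Z = 1\<^sub>m n" if "Z * Z' = 1\<^sub>m n" "Z \<in> carrier_mat n n" "Z' \<in> carrier_mat n n" for Z Z' :: "'a mat"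
    using mat_mult_left_right_inverse[OF that(2,3,1)] .
  \<comment> \<open>The rows of \<open>E2\<close> satisfy the premises of \<open>max\<close>, so \<open>E2\<close> is a multiple of \<open>E1\<close>.\<close>
  have E2A: "over R (E2 * A)" using max[OF 2(1) 2(9)] 2(10,17) A G by (simp add: as 2)
  define I1 where "I1 = X1 + A * Y1"
  have I1: "I1 \<in> carrier_mat n n" using 1 A by (simp add: I1_def)
  have "E1 * I1 = 1\<^sub>m n" using 1 A by (simp add: I1_def dist flip: as)
  then have I1E: "I1 * E1 = 1\<^sub>m n" using inv_comm 1 I1 by blast
  have "over R (E2 * I1)"
  proof -
    have "E2 * I1 = E2 * X1 + (E2 * A) * Y1" using 1 2 A by (simp add: I1_def dist as)
    moreover have "over R (E2 * X1 + (E2 * A) * Y1)"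
      by (rule ova[OF ov[OF 2(9) 1(7)] ov[OF E2A 1(8)]]) (use 1(3,4) 2(1) A in auto)
    ultimately show ?thesis by simp
  qed
  then have c1: "det (E2 * I1) \<in> R" by (rule over_det[OF S _ mult_carrier_mat[OF 2(1) I1]])
  have "E2 = E2 * I1 * E1" using I1E 1 2 I1 by (simp add: as)
  then have d1: "det E2 = det (E2 * I1) * det E1" using 2(1) I1 1(1) by (metis det_mult mult_carrier_mat)
  let ?T = "transpose_mat N1"
  \<comment> \<open>The Bezout identity for \<open>E3\<close>, multiplied by \<open>?T\<close>, exhibits \<open>?T\<close> as \<open>E3\<close> times an integral matrix.\<close>
  define W where "W = X3 * ?T + Y3 * (A * G * ?T)"
  have T: "?T = transpose_mat A * transpose_mat E1" using 1 A transpose_mult[of E1 n n A n] by auto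
  have "A * G * ?T = (A * G * transpose_mat A) * transpose_mat E1"
    using A G 1 by (simp add: T as)
  then have ovAT: "over R (A * G * ?T)" using ov[OF AG over_transpose[OF S 1(5)]] A G 1 by simp
  have "over R W" unfolding W_def
    by (rule ova[OF ov[OF 2(15) over_transpose[OF S 1(6)]] ov[OF 2(16) ovAT]]) (use 1(2) 2(7,8) A G in auto)
  then have W: "W \<in> carrier_mat n n" "over R W" using 1(2) 2(7,8) A G by (auto simp: W_def)
  define I3 where "I3 = X3 + Y3 * (A * G)"
  have I3: "I3 \<in> carrier_mat n n" using 2 A G by (simp add: I3_def)
  have "I3 * E3 = X3 * E3 + Y3 * ((A * G) * E3)" using 2 A G by (simp add: I3_def dist as)
  then have "I3 * E3 = 1\<^sub>m n" using 2(19,20) by simp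
  then have "E3 * I3 = 1\<^sub>m n" using inv_comm 2 I3 by blast
  moreover have "W = I3 * ?T" using 1 2 A G by (simp add: W_def I3_def dist as)
  ultimately have "E3 * W = ?T" using 1 2 I3 by (simp flip: as)
  then have "det ?T = det E3 * det W" using 2(5) W by (metis det_mult)
  then have d3: "det N1 = det E3 * det W" using det_transpose[OF 1(2)] by simp
  have "det N1 = det E1 * det A" using 1(1,9) A by (metis det_mult)
  then have "det A = det E3 * det W / det E1" using d3 1(11) by (simp add: field_simps)
  also have "\<dots> = (det E3 / det E2) * (det (E2 * I1) * det W)" using d1 2(21) 1(11) by simp
  also have "\<dots> \<in> R" using 2(22) c1 over_det[OF S W(2,1)] subringD(6)[OF S] by blast
  finally show ?thesis .
qed

lemma over_inverse:
  fixes R :: "'a::field set"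
  assumes R: "subring R" and C: "C \<in> carrier_mat n n" "over R C" and B: "B \<in> carrier_mat n n"
    and CB: "C * B = 1\<^sub>m n" and d: "1 / det C \<in> R"
  shows "over R B"
proof -
  have adj: "adj_mat C \<in> carrier_mat n n" "adj_mat C * C = det C \<cdot>\<^sub>m 1\<^sub>m n" using adj_mat[OF C(1)] by auto
  have "det C * det B = 1" using CB C(1) B by (metis det_mult det_one)
  then have d0: "det C \<noteq> 0" by auto
  have "adj_mat C = adj_mat C * (C * B)" using adj by (simp add: CB)
  also have "\<dots> = (adj_mat C * C) * B" by (rule assoc_mult_mat[symmetric]) (use adj C B in auto)
  also have "\<dots> = det C \<cdot>\<^sub>m B" unfolding adj(2) using mult_smult_assoc_mat[OF one_carrier_mat B, of "det C"] B by simp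
  finally have eq: "adj_mat C = det C \<cdot>\<^sub>m B" .
  have entry: "adj_mat C $$ (i, j) \<in> R" if ij: "i < n" "j < n" for i j
  proof -
    have md: "mat_delete C j i \<in> carrier_mat (n - 1) (n - 1)" using C(1) by (intro mat_delete_carrier)
    have "over R (mat_delete C j i)" using C by (auto simp: over_def mat_delete_def)
    then have "det (mat_delete C j i) \<in> R" using over_det[OF R _ md] by blast
    moreover have "(- 1) ^ k \<in> R" for k using subringD[OF R] by (induction k) auto
    ultimately show ?thesis using ij C(1) subringD(6)[OF R] by (simp add: adj_mat_def cofactor_def)
  qed
  have "B $$ (i, j) \<in> R" if ij: "i < n" "j < n" for i j
  proof -
    have "det C * B $$ (i, j) \<in> R" using entry[OF ij] ij B by (simp add: eq)
    then have "1 / det C * (det C * B $$ (i, j)) \<in> R" by (rule subringD(6)[OF R d])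
    then show ?thesis using d0 by simp
  qed
  then show ?thesis using B by (simp add: over_def)
qed

lemma det_first_column_zero:
  fixes A :: "'a::comm_ring_1 mat"
  assumes A: "A \<in> carrier_mat (Suc n) (Suc n)" and z: "\<And>i. i < n \<Longrightarrow> A $$ (Suc i, 0) = 0"
  shows "det A = A $$ (0, 0) * det (mat n n (\<lambda>(i, j). A $$ (Suc i, Suc j)))"
proof -
  have "det A = (\<Sum>i<Suc n. A $$ (i, 0) * cofactor A i 0)"
    using laplace_expansion_column[OF A, of 0] by simp
  also have "\<dots> = A $$ (0, 0) * cofactor A 0 0 + (\<Sum>i<n. A $$ (Suc i, 0) * cofactor A (Suc i) 0)"
    by (rule sum.lessThan_Suc_shift)
  also have "\<dots> = A $$ (0, 0) * det (mat_delete A 0 0)" using z by (simp add: cofactor_def)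
  also have "mat_delete A 0 0 = mat n n (\<lambda>(i, j). A $$ (Suc i, Suc j))"
    using A by (auto simp: mat_delete_def intro!: eq_matI)
  finally show ?thesis .
qed

section \<open>Bases and coordinates\<close>

definition coords :: "('a::field \<Rightarrow> 'b::ab_group_add \<Rightarrow> 'b) \<Rightarrow> 'b list \<Rightarrow> 'b list \<Rightarrow> 'a mat" where
  "coords scale v w = mat (length w) (length v)
     (\<lambda>(i, j). module.representation scale (set v) (w ! i) (v ! j))"

lemma coords_carrier [simp]: "coords scale v w \<in> carrier_mat (length w) (length v)"
  by (simp add: coords_def)

text \<open>
  The subspace \<open>X\<close> is a parameter because the results are used both for the ambient space and for
  the orthogonal complement of \<open>h\<close>.
\<close>

locale lattice_space = vector_space scale
  for scale :: "'f::field_char_0 \<Rightarrow> 'v::ab_group_add \<Rightarrow> 'v" +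
  fixes X :: "'v set"
  assumes number_field: "algebraic_number_field TYPE('f)"
    and subspace_X: "subspace X"
    and finite_dim: "\<exists>B. finite B \<and> span B = X"
begin

lemma vs: "vector_space scale" by (rule vector_space_axioms)

abbreviation "is_basis v \<equiv> ordered_basis scale X v"

lemma X_closed:
  "0 \<in> X" "x \<in> X \<Longrightarrow> y \<in> X \<Longrightarrow> x + y \<in> X" "x \<in> X \<Longrightarrow> scale c x \<in> X"
  "(\<And>i. i \<in> A \<Longrightarrow> f i \<in> X) \<Longrightarrow> sum f A \<in> X"
  using subspace_0[OF subspace_X] subspace_add[OF subspace_X] subspace_scale[OF subspace_X]
    subspace_sum[OF subspace_X, of A f] by auto

lemma is_basisD:
  assumes "is_basis v"
  shows "distinct v" "independent (set v)" "span (set v) = X" "set v \<subseteq> X"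
    "i < length v \<Longrightarrow> v ! i \<in> X"
  using assms span_superset[of "set v"] nth_mem[of i v] by (auto simp: ordered_basis_def)

lemma ex_basis: "\<exists>v. is_basis v"
proof -
  obtain B where B: "finite B" "span B = X" using finite_dim by blast
  obtain C where C: "C \<subseteq> B" "independent C" "span C = span B"
    using maximal_independent_subset[of B] by (metis span_eq span_superset subset_trans span_mono span_minimal subspace_span)
  obtain v where "set v = C" "distinct v" using finite_distinct_list[of C] C(1) B(1) finite_subset by blast
  then show ?thesis using B C by (auto simp: ordered_basis_def)
qed

lemma basis_length: "is_basis v \<Longrightarrow> is_basis w \<Longrightarrow> length v = length w"
  by (metis is_basisD(1-3) distinct_card basis_card_eq_dim span_superset order_refl)

lemma sum_basis:
  "is_basis v \<Longrightarrow> (\<Sum>b\<in>set v. f b) = (\<Sum>i<length v. f (v ! i))" for f :: "'v \<Rightarrow> 'c::comm_monoid_add"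
  by (intro sum.reindex_bij_betw[symmetric] bij_betw_nth) (auto dest: is_basisD)

lemma basis_expand:
  assumes "is_basis v" "x \<in> X"
  shows "(\<Sum>i<length v. scale (representation (set v) x (v ! i)) (v ! i)) = x"
  using sum_representation_eq[of "set v" x "set v"] is_basisD[OF assms(1)] assms(2)
  by (simp add: sum_basis[OF assms(1)])

lemma representation_lincomb:
  assumes v: "is_basis v" and w: "\<And>j. j < l \<Longrightarrow> w j \<in> X"
  shows "representation (set v) (\<Sum>j<l. scale (c j) (w j)) b = (\<Sum>j<l. c j * representation (set v) (w j) b)"
proof -
  have cw: "scale (c j) (w j) \<in> X" if "j < l" for j using X_closed(3) w that by blast
  have "representation (set v) (\<Sum>j<l. scale (c j) (w j))
      = (\<lambda>b. \<Sum>j<l. representation (set v) (scale (c j) (w j)) b)"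
    using is_basisD(2,3)[OF v] cw by (intro representation_sum) auto
  also have "\<dots> = (\<lambda>b. \<Sum>j<l. c j * representation (set v) (w j) b)"
    using is_basisD[OF v] w by (intro ext sum.cong) (auto simp: representation_scale)
  finally show ?thesis by simp
qed

lemma representation_nth:
  assumes "is_basis v" "i < length v" "j < length v"
  shows "representation (set v) (v ! i) (v ! j) = (if i = j then 1 else 0)"
  using is_basisD[OF assms(1)] assms(2,3) by (auto simp: representation_basis nth_eq_iff_index_eq)

lemma representation_unique_lincomb:
  assumes "is_basis v" "i < length v"
  shows "representation (set v) (\<Sum>j<length v. scale (c j) (v ! j)) (v ! i) = c i"
  using assms is_basisD(5)[OF assms(1)]
  by (simp add: representation_lincomb representation_nth if_distrib cong: if_cong)

lemma coords_lincomb: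
  assumes v: "is_basis v" and z: "set z \<subseteq> X"
    and P: "P \<in> carrier_mat (length w) (length z)"
    and w: "\<And>i. i < length w \<Longrightarrow> w ! i = (\<Sum>j<length z. scale (P $$ (i, j)) (z ! j))"
  shows "coords scale v w = P * coords scale v z"
proof (rule eq_matI)
  fix i k assume "i < dim_row (P * coords scale v z)" "k < dim_col (P * coords scale v z)"
  then have i: "i < length w" "k < length v" using P by (auto simp: coords_def)
  have "z ! j \<in> X" if "j < length z" for j using z that nth_mem by blast
  then have "representation (set v) (w ! i) (v ! k)
      = (\<Sum>j<length z. P $$ (i, j) * representation (set v) (z ! j) (v ! k))"
    using i by (simp add: w representation_lincomb[OF v])
  then show "coords scale v w $$ (i, k) = (P * coords scale v z) $$ (i, k)"
    using i P by (simp add: coords_def scalar_prod_def atLeast0LessThan)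
qed (use P in \<open>auto simp: coords_def\<close>)

lemma coords_trans:
  assumes "is_basis u" "is_basis v" "set w \<subseteq> X"
  shows "coords scale u w = coords scale v w * coords scale u v"
proof (rule coords_lincomb[OF assms(1) is_basisD(4)[OF assms(2)]])
  fix i assume i: "i < length w"
  then have "w ! i \<in> X" using assms(3) nth_mem by blast
  then show "w ! i = (\<Sum>j<length v. scale (coords scale v w $$ (i, j)) (v ! j))"
    using basis_expand[OF assms(2), of "w ! i"] i by (simp add: coords_def)
qed simp

lemma coords_self: "is_basis v \<Longrightarrow> coords scale v v = 1\<^sub>m (length v)"
  by (rule eq_matI) (auto simp: coords_def representation_nth)

lemma coords_inverse:
  assumes "is_basis u" "is_basis v"
  shows "coords scale u v * coords scale v u = 1\<^sub>m (length u)"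
  using coords_trans[OF assms(2,1) is_basisD(4)[OF assms(2)]] coords_self[OF assms(2)]
    basis_length[OF assms] by simp

lemma coords_square:
  assumes "is_basis u" "is_basis v" "length u = n"
  shows "coords scale u v \<in> carrier_mat n n"
  using coords_carrier[of scale u v] basis_length[OF assms(1,2)] assms(3) by simp

lemma det_coords_mult:
  assumes "is_basis u" "is_basis v" "set w \<subseteq> X" "length w = length v"
  shows "det (coords scale u w) = det (coords scale v w) * det (coords scale u v)"
proof -
  have "coords scale v w \<in> carrier_mat (length v) (length v)" using coords_carrier[of scale v w] assms(4) by simp
  then show ?thesis using coords_trans[OF assms(1,2,3)] coords_square[OF assms(1,2) basis_length[OF assms(1,2)]]
    by (metis det_mult)
qed

lemma det_coords_inverse:
  assumes "is_basis u" "is_basis v"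
  shows "det (coords scale u v) * det (coords scale v u) = 1" "det (coords scale u v) \<noteq> 0"
proof -
  have "det (coords scale u v * coords scale v u) = 1" using coords_inverse[OF assms] by simp
  then show "det (coords scale u v) * det (coords scale v u) = 1"
    using coords_square[OF assms refl] coords_square[OF assms(2,1) basis_length[OF assms(2,1)]]
    by (metis det_mult)
  then show "det (coords scale u v) \<noteq> 0" by auto
qed

definition linear_on :: "('v \<Rightarrow> 'v) \<Rightarrow> bool" where
  "linear_on \<alpha> \<longleftrightarrow> (\<forall>x\<in>X. \<alpha> x \<in> X) \<and> (\<forall>x\<in>X. \<forall>y\<in>X. \<alpha> (x + y) = \<alpha> x + \<alpha> y) \<and>
     (\<forall>c. \<forall>x\<in>X. \<alpha> (scale c x) = scale c (\<alpha> x))"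

lemma linear_automorphism_linear_on: "linear_automorphism scale X \<alpha> \<Longrightarrow> linear_on \<alpha>"
  by (auto simp: linear_automorphism_def linear_on_def bij_betw_def)

lemma linear_on_lincomb:
  assumes "linear_on \<alpha>" "\<And>i. i \<in> A \<Longrightarrow> w i \<in> X"
  shows "\<alpha> (\<Sum>i\<in>A. scale (c i) (w i)) = (\<Sum>i\<in>A. scale (c i) (\<alpha> (w i)))"
  using assms(2)
proof (induction A rule: infinite_finite_induct)
  case (insert x A)
  have "(\<Sum>i\<in>A. scale (c i) (w i)) \<in> X" using insert.prems by (intro X_closed) auto
  then show ?case using insert assms(1) X_closed(3) by (simp add: linear_on_def)
qed (use assms(1) X_closed(1) in \<open>force simp: linear_on_def dest: bspec[of _ _ 0]\<close>)+

text \<open>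
  A change of basis conjugates the matrix of an endomorphism.
\<close>

lemma endo_det_eq:
  assumes "linear_on \<alpha>" and v: "is_basis v"
  shows "endo_det scale X \<alpha> = det (coords scale v (map \<alpha> v))"
proof -
  define u where "u = (SOME bs. is_basis bs)"
  have u: "is_basis u" unfolding u_def by (rule someI_ex[OF ex_basis])
  note len = basis_length[OF u v]
  have im: "set (map \<alpha> z) \<subseteq> X" if "is_basis z" for z
    using that assms(1) is_basisD(4)[OF that] by (auto simp: linear_on_def)
  have e: "endo_det scale X \<alpha> = det (coords scale u (map \<alpha> u))"
    unfolding endo_det_def u_def[symmetric]
    by (rule arg_cong[of _ _ det], rule eq_matI) (auto simp: endo_matrix_def coords_def)
  have "coords scale u (map \<alpha> v) = coords scale u v * coords scale u (map \<alpha> u)"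
  proof (rule coords_lincomb[OF u im[OF u]])
    fix i assume i: "i < length (map \<alpha> v)"
    have "\<alpha> (v ! i) = \<alpha> (\<Sum>j<length u. scale (representation (set u) (v ! i) (u ! j)) (u ! j))"
      using i basis_expand[OF u is_basisD(5)[OF v]] by simp
    also have "\<dots> = (\<Sum>j<length u. scale (representation (set u) (v ! i) (u ! j)) (\<alpha> (u ! j)))"
      using is_basisD(5)[OF u] by (intro linear_on_lincomb[OF assms(1)]) auto
    finally show "map \<alpha> v ! i = (\<Sum>j<length (map \<alpha> u). scale (coords scale u v $$ (i, j)) (map \<alpha> u ! j))"
      using i by (simp add: coords_def)
  qed (simp add: coords_def)
  moreover have "coords scale u (map \<alpha> u) \<in> carrier_mat (length u) (length u)"
    using coords_carrier[of scale u "map \<alpha> u"] by simp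
  ultimately have "det (coords scale u (map \<alpha> v)) = det (coords scale u v) * det (coords scale u (map \<alpha> u))"
    using coords_square[OF u v refl] by (metis det_mult)
  moreover have "det (coords scale u (map \<alpha> v)) = det (coords scale v (map \<alpha> v)) * det (coords scale u v)"
    by (rule det_coords_mult[OF u v im[OF v]]) simp
  ultimately show ?thesis using det_coords_inverse(2)[OF u v] by (simp add: e)
qed

lemma ex_automorphism:
  assumes v: "is_basis v" and w: "is_basis w"
  obtains \<alpha> where "linear_automorphism scale X \<alpha>" "\<And>i. i < length v \<Longrightarrow> \<alpha> (v ! i) = w ! i"
proof -
  define T where "T a b x = (\<Sum>j<length a. scale (representation (set a) x (a ! j)) (b ! j))" for a b :: "'v list" and x
  note len = basis_length[OF v w]
  have lin: "linear_on (T a b)" if ab: "is_basis a" "is_basis b" "length a = length b" for a b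
    unfolding linear_on_def
  proof (intro conjI ballI allI)
    show "T a b x \<in> X" for x unfolding T_def using ab is_basisD(5)[OF ab(2)] by (intro X_closed(4,3)) auto
    show "T a b (x + y) = T a b x + T a b y" if "x \<in> X" "y \<in> X" for x y
      using that is_basisD[OF ab(1)]
      by (simp add: T_def representation_add scale_left_distrib sum.distrib)
    show "T a b (scale c x) = scale c (T a b x)" if "x \<in> X" for c x
      using that is_basisD[OF ab(1)] by (simp add: T_def representation_scale scale_sum_right)
  qed
  have nth: "T a b (a ! i) = b ! i" if ab: "is_basis a" "i < length a" for a b i
  proof -
    have "T a b (a ! i) = (\<Sum>j<length a. if j = i then b ! j else 0)"
      unfolding T_def using ab by (intro sum.cong) (auto simp: representation_nth)
    then show ?thesis using ab(2) by simp
  qed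
  have inv: "T a b (T b a x) = x" if ab: "is_basis a" "is_basis b" "length a = length b" and x: "x \<in> X" for a b x
  proof -
    have "T a b (T b a x) = (\<Sum>j<length b. scale (representation (set b) x (b ! j)) (T a b (a ! j)))"
      unfolding T_def[of b a x] using is_basisD(5)[OF ab(1)] ab(3)
      by (intro linear_on_lincomb[OF lin[OF ab]]) auto
    also have "\<dots> = x" using basis_expand[OF ab(2) x] nth[OF ab(1)] ab(3) by simp
    finally show ?thesis .
  qed
  have "bij_betw (T v w) X X"
    using lin[OF v w len] lin[OF w v len[symmetric]] inv[OF v w len] inv[OF w v len[symmetric]]
    by (intro bij_betw_byWitness[of _ "T w v"]) (auto simp: linear_on_def)
  then have "linear_automorphism scale X (T v w)"
    using lin[OF v w len] by (auto simp: linear_on_def linear_automorphism_def)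
  then show ?thesis using nth[OF v] that by blast
qed

section \<open>Lattices and their indices, locally\<close>

definition local_lattice :: "'f set \<Rightarrow> 'v list \<Rightarrow> 'v set" where
  "local_lattice R v = {x\<in>X. \<forall>i<length v. representation (set v) x (v ! i) \<in> R}"

lemma over_coords_iff:
  assumes "set w \<subseteq> X" shows "over R (coords scale v w) \<longleftrightarrow> set w \<subseteq> local_lattice R v"
  using assms by (fastforce simp: over_def coords_def local_lattice_def subset_iff in_set_conv_nth)

lemma basis_subset_local_lattice:
  assumes "subring R" "is_basis v" shows "set v \<subseteq> local_lattice R v"
  using over_one[OF assms(1), of "length v"] coords_self[OF assms(2)]
    over_coords_iff[OF is_basisD(4)[OF assms(2)], of R v] by (simp only:)

lemma submodule_local_lattice:
  assumes "subring R" "is_basis v" shows "submodule_over R scale (local_lattice R v)"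
  using is_basisD[OF assms(2)] subringD[OF assms(1)] X_closed
  by (auto simp: submodule_over_def local_lattice_def representation_zero representation_add representation_scale)

lemma local_lattice_minimal:
  assumes "is_basis v" "submodule_over R scale N" "set v \<subseteq> N"
  shows "local_lattice R v \<subseteq> N"
proof
  fix x assume x: "x \<in> local_lattice R v"
  then have "x = (\<Sum>i<length v. scale (representation (set v) x (v ! i)) (v ! i))"
    using basis_expand[OF assms(1), of x] by (simp add: local_lattice_def)
  also have "\<dots> \<in> N"
  proof (rule submodule_over_sum[OF assms(2)])
    fix i assume "i \<in> {..<length v}"
    then show "scale (representation (set v) x (v ! i)) (v ! i) \<in> N"
      using x assms(3) by (intro submodule_overD(3)[OF assms(2)]) (auto simp: local_lattice_def)
  qed
  finally show "x \<in> N" .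
qed

lemma ring_span_basis:
  assumes "subring R" "is_basis v" shows "ring_span R scale (set v) = local_lattice R v"
  using ring_span_minimal[OF submodule_local_lattice[OF assms] basis_subset_local_lattice[OF assms]]
    local_lattice_minimal[OF assms(2) submodule_ring_span[OF vs assms(1)] ring_span_superset[OF vs assms(1)]]
  by blast

text \<open>
  A generating set that cannot be shortened is linearly independent over the field: a
  dependency with a dominant coefficient expresses one generator by the others with
  coefficients in \<open>R\<close>.
\<close>

lemma free_over_valuation_ring:
  assumes R: "valuation_ring R" and S: "finite S" "span S = X"
  shows "\<exists>v. is_basis v \<and> set v \<subseteq> S \<and> ring_span R scale S = local_lattice R v"
proof -
  note sub = valuation_ringD(1)[OF R]
  let ?P = "\<lambda>T. T \<subseteq> S \<and> ring_span R scale T = ring_span R scale S"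
  obtain T where T: "?P T" and least: "\<And>T'. ?P T' \<Longrightarrow> card T \<le> card T'"
    using ex_has_least_nat[of ?P S card] by blast
  have fin: "finite T" using T S finite_subset by blast
  have "independent T"
  proof
    assume "dependent T"
    then obtain c s1 where c: "s1 \<in> T" "c s1 \<noteq> 0" "(\<Sum>s\<in>T. scale (c s) s) = 0"
      using dependent_finite[OF fin] by blast
    obtain a where a: "a \<in> c ` T" "a \<noteq> 0" "\<forall>b\<in>c ` T. b / a \<in> R"
      using valuation_ring_dominant[OF R, of "c ` T" "c s1"] fin c by auto
    then obtain s where s: "s \<in> T" "c s \<noteq> 0" "\<And>t. t \<in> T \<Longrightarrow> c t / c s \<in> R" by auto
    let ?U = "T - {s}"
    have "scale (c s) s + (\<Sum>t\<in>?U. scale (c t) t) = 0"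
      using c(3) sum.remove[OF fin s(1), of "\<lambda>t. scale (c t) t"] by simp
    then have "scale (inverse (c s)) (scale (c s) s + (\<Sum>t\<in>?U. scale (c t) t)) = 0" by simp
    then have "s + (\<Sum>t\<in>?U. scale (c t / c s) t) = 0"
      using s(2) by (simp add: scale_right_distrib scale_sum_right divide_inverse mult.commute)
    then have "s = (\<Sum>t\<in>?U. scale (- (c t / c s)) t)" by (simp add: sum_negf eq_neg_iff_add_eq_0)
    moreover have "\<forall>t\<in>?U. - (c t / c s) \<in> R" using s(3) subringD(3)[OF sub] by blast
    ultimately have "s \<in> ring_span R scale ?U" unfolding ring_span_def using fin
      by (intro CollectI exI[of _ ?U] exI[of _ "\<lambda>t. - (c t / c s)"]) auto
    then have "T \<subseteq> ring_span R scale ?U" using ring_span_superset[OF vs sub, of ?U] by blast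
    then have "ring_span R scale T \<subseteq> ring_span R scale ?U"
      by (intro ring_span_minimal submodule_ring_span vs sub)
    moreover have "ring_span R scale ?U \<subseteq> ring_span R scale T"
      using ring_span_superset[OF vs sub, of T] by (intro ring_span_minimal submodule_ring_span vs sub) auto
    ultimately have "?P ?U" using T by auto
    then have "card T \<le> card ?U" by (rule least)
    then show False using card_Diff1_less[OF fin s(1)] by simp
  qed
  moreover have "span T = X"
  proof
    show "span T \<subseteq> X" using T S span_mono by blast
    have "submodule_over R scale (span T)"
      by (auto simp: submodule_over_def span_zero span_add span_scale)
    then have "ring_span R scale T \<subseteq> span T" by (rule ring_span_minimal) (rule span_superset)
    then have "S \<subseteq> span T" using T ring_span_superset[OF vs sub, of S] by simp
    then show "X \<subseteq> span T" using S span_minimal subspace_span by blast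
  qed
  moreover obtain v where v: "set v = T" "distinct v" using finite_distinct_list[OF fin] by blast
  ultimately have "is_basis v" by (simp add: ordered_basis_def)
  then show ?thesis using T v ring_span_basis[OF sub, of v] by (intro exI[of _ v]) auto
qed

abbreviation "lattice_in_X N \<equiv> is_lattice scale X N"

lemma submodule_integral_span: "submodule_over \<O> scale (integral_span scale S)"
  by (simp add: integral_span_eq submodule_ring_span vs subring_ring_of_integers)

lemma integral_span_minimal:
  "submodule_over \<O> scale N \<Longrightarrow> S \<subseteq> N \<Longrightarrow> integral_span scale S \<subseteq> N"
  by (simp add: integral_span_eq ring_span_minimal)

lemma integral_span_superset: "S \<subseteq> integral_span scale S"
  by (simp add: integral_span_eq ring_span_superset vs subring_ring_of_integers)

lemma latticeE:
  assumes "lattice_in_X N"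
  obtains S where "finite S" "N = integral_span scale S" "S \<subseteq> N" "N \<subseteq> X" "span S = X"
    "submodule_over \<O> scale N"
proof -
  obtain S B where S: "finite S" "N = integral_span scale S" and B: "B \<subseteq> N" "span B = X" and N: "N \<subseteq> X"
    using assms by (auto simp: is_lattice_def)
  have SN: "S \<subseteq> N" using integral_span_superset S(2) by blast
  have "submodule_over \<O> scale (span S)"
    by (auto simp: submodule_over_def span_zero span_add span_scale)
  then have "N \<subseteq> span S" unfolding S(2) by (rule integral_span_minimal) (rule span_superset)
  then have "X \<subseteq> span S" using B span_minimal subspace_span by blast
  moreover have "span S \<subseteq> X" using SN N span_minimal subspace_X by blast
  ultimately show ?thesis using that[OF S SN N] submodule_integral_span S(2) by blast
qed

lemma latticeI:
  assumes "finite S" "N = integral_span scale S" "N \<subseteq> X" "X \<subseteq> span N"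
  shows "lattice_in_X N"
proof -
  obtain B where B: "B \<subseteq> N" "independent B" "N \<subseteq> span B" using maximal_independent_subset[of N] by blast
  have "span B \<subseteq> X" using B(1) assms(3) span_minimal subspace_X by blast
  moreover have "X \<subseteq> span B" using assms(4) span_minimal[OF B(3) subspace_span] by blast
  ultimately show ?thesis unfolding is_lattice_def using B assms by blast
qed

definition local_basis :: "'f set \<Rightarrow> 'v set \<Rightarrow> 'v list \<Rightarrow> bool" where
  "local_basis m N v \<longleftrightarrow> is_basis v \<and> loc scale m N = local_lattice (loc_ring m) v"

lemma local_basisD:
  assumes "local_basis m N v"
  shows "is_basis v" "loc scale m N = local_lattice (loc_ring m) v"
  using assms by (auto simp: local_basis_def)

lemma ex_local_basis:
  assumes m: "prime_ideal m" and N: "lattice_in_X N"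
  shows "\<exists>v. local_basis m N v \<and> set v \<subseteq> N"
proof -
  obtain S where S: "finite S" "N = integral_span scale S" "S \<subseteq> N" "span S = X"
    using latticeE[OF N] by metis
  show ?thesis
    using free_over_valuation_ring[OF valuation_loc_ring[OF number_field m] S(1,4)]
      loc_ring_span[OF m vs, of S] S by (auto simp: local_basis_def)
qed

lemma loc_subset_X: "prime_ideal m \<Longrightarrow> N \<subseteq> X \<Longrightarrow> loc scale m N \<subseteq> X"
proof
  fix x assume "prime_ideal m" "N \<subseteq> X" "x \<in> loc scale m N"
  then obtain s where s: "s \<in> \<O> - m" "scale s x \<in> X" by (auto simp: loc_def)
  then have "scale (inverse s) (scale s x) \<in> X" using X_closed(3) by blast
  then show "x \<in> X" using denominators(2)[OF \<open>prime_ideal m\<close> s(1)] by simp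
qed

lemma loc_linear_image:
  assumes "prime_ideal m" "linear_on \<alpha>" "N \<subseteq> X" "\<alpha> ` N \<subseteq> N'"
  shows "\<alpha> ` loc scale m N \<subseteq> loc scale m N'"
proof
  fix y assume "y \<in> \<alpha> ` loc scale m N"
  then obtain x s where s: "y = \<alpha> x" "s \<in> \<O> - m" "scale s x \<in> N" by (auto simp: loc_def)
  have "x \<in> X" using loc_subset_X[OF assms(1,3)] s by (auto simp: loc_def)
  then have "scale s y = \<alpha> (scale s x)" using assms(2) s by (simp add: linear_on_def)
  then show "y \<in> loc scale m N'" using s assms(4) by (auto simp: loc_def)
qed

text \<open>
  A map taking \<open>N\<close> into \<open>N'\<close> does so locally, hence its determinant is an integral multiple of that
  of the base change. Conversely the base change itself, multiplied by a denominator \<open>s\<close> outside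
  \<open>m\<close>, maps the finitely generated lattice \<open>N\<close> into \<open>N'\<close>, and powers of \<open>s\<close> are local units.
\<close>

lemma loc_lattice_index:
  assumes m: "prime_ideal m" and N: "lattice_in_X N" "lattice_in_X N'"
    and v: "local_basis m N v" and w: "local_basis m N' w"
  shows "loc (*) m (lattice_index scale X N N') = (\<lambda>r. det (coords scale v w) * r) ` loc_ring m"
proof -
  let ?R = "loc_ring m"
  define D where "D = {endo_det scale X \<alpha> | \<alpha>. linear_automorphism scale X \<alpha> \<and> \<alpha> ` N \<subseteq> N'}"
  let ?d = "det (coords scale v w)"
  note R = subring_loc_ring[OF m]
  note vb = local_basisD(1)[OF v]
  note wb = local_basisD(1)[OF w]
  note len = basis_length[OF vb wb]
  obtain S where S: "finite S" "N = integral_span scale S" "S \<subseteq> N" "N \<subseteq> X" "span S = X" using latticeE[OF N(1)] by metis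
  obtain S' where S': "N' \<subseteq> X" "submodule_over \<O> scale N'" using latticeE[OF N(2)] by metis
  have eq: "loc (*) m (lattice_index scale X N N') = ring_span ?R (*) D"
    unfolding lattice_index_def D_def by (rule loc_ring_span[OF m vector_space_self])
  have sub: "submodule_over ?R (*) ((\<lambda>r. ?d * r) ` ?R)"
    unfolding submodule_over_def using subringD[OF R]
    by (auto simp: image_iff distrib_left[symmetric] intro: bexI[of _ 0])
  have "D \<subseteq> (\<lambda>r. ?d * r) ` ?R"
  proof
    fix e assume "e \<in> D"
    then obtain \<alpha> where \<alpha>: "e = endo_det scale X \<alpha>" "linear_automorphism scale X \<alpha>" "\<alpha> ` N \<subseteq> N'" by (auto simp: D_def)
    note lin = linear_automorphism_linear_on[OF \<alpha>(2)]
    have im: "set (map \<alpha> v) \<subseteq> X" using lin is_basisD(4)[OF vb] by (auto simp: linear_on_def)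
    have "set (map \<alpha> v) \<subseteq> \<alpha> ` loc scale m N"
      using v basis_subset_local_lattice[OF R vb] by (auto simp: local_basis_def)
    also have "\<dots> \<subseteq> local_lattice ?R w"
      using loc_linear_image[OF m lin S(4) \<alpha>(3)] w by (simp add: local_basis_def)
    finally have "over ?R (coords scale w (map \<alpha> v))" using over_coords_iff[OF im] by blast
    then have "det (coords scale w (map \<alpha> v)) \<in> ?R"
      using over_det[OF R, of _ "length v"] coords_carrier[of scale w "map \<alpha> v"] len by simp
    moreover have "e = det (coords scale w (map \<alpha> v)) * ?d"
      unfolding \<alpha>(1) endo_det_eq[OF lin vb] by (rule det_coords_mult[OF vb wb im]) (simp add: len)
    ultimately show "e \<in> (\<lambda>r. ?d * r) ` ?R" by (auto simp: mult.commute)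
  qed
  then have 1: "ring_span ?R (*) D \<subseteq> (\<lambda>r. ?d * r) ` ?R" by (rule ring_span_minimal[OF sub])
  obtain \<alpha> where \<alpha>: "linear_automorphism scale X \<alpha>" "\<And>i. i < length v \<Longrightarrow> \<alpha> (v ! i) = w ! i"
    using ex_automorphism[OF vb wb] by metis
  note lin = linear_automorphism_linear_on[OF \<alpha>(1)]
  have locN': "submodule_over ?R scale (loc scale m N')" by (rule submodule_loc[OF m vs S'(2)])
  have "\<alpha> ` S \<subseteq> loc scale m N'"
  proof
    fix y assume "y \<in> \<alpha> ` S"
    then obtain x where x: "x \<in> S" "y = \<alpha> x" by blast
    have xX: "x \<in> X" using x S by auto
    have "x \<in> local_lattice ?R v" using x S(3) loc_superset[OF m vs, of N] v by (auto simp: local_basis_def)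
    then have r: "representation (set v) x (v ! i) \<in> ?R" if "i < length v" for i using that by (simp add: local_lattice_def)
    have "y = \<alpha> (\<Sum>i<length v. scale (representation (set v) x (v ! i)) (v ! i))"
      using basis_expand[OF vb xX] x by simp
    also have "\<dots> = (\<Sum>i<length v. scale (representation (set v) x (v ! i)) (\<alpha> (v ! i)))"
      using is_basisD(5)[OF vb] by (intro linear_on_lincomb[OF lin]) auto
    also have "\<dots> \<in> loc scale m N'"
    proof (rule submodule_over_sum[OF locN'])
      fix i assume i: "i \<in> {..<length v}"
      have "w ! i \<in> loc scale m N'"
        using basis_subset_local_lattice[OF R wb] w i len nth_mem[of i w] by (auto simp: local_basis_def)
      then show "scale (representation (set v) x (v ! i)) (\<alpha> (v ! i)) \<in> loc scale m N'"
        using i r \<alpha>(2) by (intro submodule_overD(3)[OF locN']) auto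
    qed
    finally show "y \<in> loc scale m N'" .
  qed
  then obtain s where s: "s \<in> \<O> - m" "\<And>x. x \<in> S \<Longrightarrow> scale s (\<alpha> x) \<in> N'"
    using common_denominator[OF m vs S'(2) finite_imageI[OF S(1)], of \<alpha>] by blast
  define \<beta> where "\<beta> x = scale s (\<alpha> x)" for x
  note s0 = denominators(2)[OF m s(1)]
  have lb: "linear_on \<beta>" using lin X_closed by (auto simp: linear_on_def \<beta>_def scale_right_distrib mult.commute)
  have "bij_betw (scale s) X X"
    using s0 X_closed(3) by (intro bij_betw_byWitness[of _ "scale (inverse s)"]) auto
  then have "bij_betw (scale s \<circ> \<alpha>) X X"
    using \<alpha>(1) bij_betw_trans by (auto simp: linear_automorphism_def)
  then have "bij_betw \<beta> X X" by (simp add: \<beta>_def[abs_def] comp_def)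
  then have "linear_automorphism scale X \<beta>"
    using lb by (auto simp: linear_automorphism_def linear_on_def)
  moreover have "\<beta> ` N \<subseteq> N'"
  proof -
    have "submodule_over \<O> scale {x\<in>X. \<beta> x \<in> N'}"
      using lb submodule_overD[OF S'(2)] X_closed linear_on_lincomb[OF lb, of "{}" "\<lambda>_. 0"]
      by (auto simp: submodule_over_def linear_on_def)
    then have "N \<subseteq> {x\<in>X. \<beta> x \<in> N'}" unfolding S(2)
      by (rule integral_span_minimal) (use S s(2) in \<open>auto simp: \<beta>_def\<close>)
    then show ?thesis by blast
  qed
  ultimately have bD: "endo_det scale X \<beta> \<in> D" by (auto simp: D_def)
  have "coords scale v (map \<beta> v) = (s \<cdot>\<^sub>m 1\<^sub>m (length v)) * coords scale v w"
  proof (rule coords_lincomb[OF vb is_basisD(4)[OF wb]])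
    fix i assume i: "i < length (map \<beta> v)"
    have "(\<Sum>j<length w. scale ((s \<cdot>\<^sub>m 1\<^sub>m (length v)) $$ (i, j)) (w ! j)) = (\<Sum>j<length w. if j = i then scale s (w ! j) else 0)"
      using i len by (intro sum.cong) auto
    then show "map \<beta> v ! i = (\<Sum>j<length w. scale ((s \<cdot>\<^sub>m 1\<^sub>m (length v)) $$ (i, j)) (w ! j))"
      using i len \<alpha>(2) by (simp add: \<beta>_def)
  qed (simp add: len)
  then have "coords scale v (map \<beta> v) = s \<cdot>\<^sub>m coords scale v w"
    using mult_smult_assoc_mat[OF one_carrier_mat coords_square[OF vb wb refl], of s]
      left_mult_one_mat[OF coords_square[OF vb wb refl]] by simp
  then have "endo_det scale X \<beta> = s ^ length v * ?d"
    using endo_det_eq[OF lb vb] coords_square[OF vb wb refl] by simp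
  then have d: "?d = inverse s ^ length v * endo_det scale X \<beta>"
    using s0 by (simp add: power_inverse)
  have ring_D: "submodule_over ?R (*) (ring_span ?R (*) D)" by (rule submodule_ring_span[OF vector_space_self R])
  have bD': "endo_det scale X \<beta> \<in> ring_span ?R (*) D" using bD ring_span_superset[OF vector_space_self R, of D] by blast
  have "inverse s ^ k \<in> ?R" for k
    using inverse_denominator[OF m s(1)] subringD[OF R] by (induction k) auto
  then have dD: "?d \<in> ring_span ?R (*) D" unfolding d using submodule_overD(3)[OF ring_D _ bD'] by blast
  have "(\<lambda>r. ?d * r) ` ?R \<subseteq> ring_span ?R (*) D"
    using submodule_overD(3)[OF ring_D _ dD] by (auto simp: mult.commute)
  then show ?thesis using 1 eq by blast
qed

text \<open>
  Locally the two indices are generated by mutually inverse determinants.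
\<close>

lemma ideal_inverse_lattice_index:
  assumes N: "lattice_in_X N" "lattice_in_X N'"
  shows "ideal_inverse (lattice_index scale X N N') = lattice_index scale X N' N"
proof (intro equalityI subsetI)
  let ?I = "lattice_index scale X N N'" and ?J = "lattice_index scale X N' N"
  have J: "submodule_over \<O> (*) ?J"
    by (simp add: lattice_index_def integral_span_eq submodule_ring_span vector_space_self subring_ring_of_integers)
  have local: "\<exists>d. d \<noteq> 0 \<and> loc (*) m ?I = (\<lambda>r. d * r) ` loc_ring m \<and> loc (*) m ?J = (\<lambda>r. r / d) ` loc_ring m"
    if m: "prime_ideal m" for m
  proof -
    obtain v w where v: "local_basis m N v" and w: "local_basis m N' w"
      using ex_local_basis[OF m N(1)] ex_local_basis[OF m N(2)] by blast
    let ?d = "det (coords scale v w)"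
    have b: "is_basis v" "is_basis w" using v w by (auto simp: local_basis_def)
    have "?d \<noteq> 0" "det (coords scale w v) = 1 / ?d"
      using det_coords_inverse[OF b] by (auto simp: eq_divide_eq mult.commute)
    then show ?thesis using loc_lattice_index[OF m N v w] loc_lattice_index[OF m N(2,1) w v]
      by (intro exI[of _ ?d]) simp
  qed
  fix x
  {
    assume x: "x \<in> ideal_inverse ?I"
    show "x \<in> ?J"
    proof (rule local_global[OF vector_space_self J])
      fix m :: "'f set" assume m: "prime_ideal m"
      obtain d where d: "d \<noteq> 0" "loc (*) m ?I = (\<lambda>r. d * r) ` loc_ring m" "loc (*) m ?J = (\<lambda>r. r / d) ` loc_ring m"
        using local[OF m] by blast
      have "d \<in> loc (*) m ?I" unfolding d(2) using subringD(2)[OF subring_loc_ring[OF m]] by force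
      then obtain s where s: "s \<in> \<O> - m" "s * d \<in> ?I" by (auto simp: loc_def)
      then have "x * (s * d) \<in> \<O>" using x by (auto simp: ideal_inverse_def)
      then have "s * (x * d) \<in> \<O>" by (simp add: ac_simps)
      then have "x * d \<in> loc_ring m" using s(1) by (auto simp: loc_def)
      then show "x \<in> loc (*) m ?J" unfolding d(3) using d(1) by (intro image_eqI[of _ _ "x * d"]) auto
    qed
  next
    assume x: "x \<in> ?J"
    have "x * a \<in> \<O>" if a: "a \<in> ?I" for a
    proof (rule local_global[OF vector_space_self])
      show "submodule_over \<O> (*) (\<O> :: 'f set)"
        by (auto simp: submodule_over_def)
      fix m :: "'f set" assume m: "prime_ideal m"
      obtain d where d: "d \<noteq> 0" "loc (*) m ?I = (\<lambda>r. d * r) ` loc_ring m" "loc (*) m ?J = (\<lambda>r. r / d) ` loc_ring m"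
        using local[OF m] by blast
      have "a \<in> loc (*) m ?I" "x \<in> loc (*) m ?J" using x a loc_superset[OF m vector_space_self] by blast+
      then obtain r r' where "r \<in> loc_ring m" "a = d * r" "r' \<in> loc_ring m" "x = r' / d"
        unfolding d by blast
      then show "x * a \<in> loc_ring m" using d(1) subringD(6)[OF subring_loc_ring[OF m]] by simp
    qed
    then show "x \<in> ideal_inverse ?I" by (simp add: ideal_inverse_def)
  }
qed

end

section \<open>Quadratic spaces and dual lattices\<close>

lemma submodule_over_sum_list:
  assumes "submodule_over R scale N" "\<And>x. x \<in> set xs \<Longrightarrow> x \<in> N" shows "sum_list xs \<in> N"
  using assms(2) by (induction xs) (auto intro: submodule_overD[OF assms(1)])

locale quadratic_lattice_space = lattice_space scale X
  for scale :: "'f::field_char_0 \<Rightarrow> 'v::ab_group_add \<Rightarrow> 'v" and X :: "'v set" +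
  fixes \<phi> :: "'v \<Rightarrow> 'v \<Rightarrow> 'f"
  assumes sym: "x \<in> X \<Longrightarrow> y \<in> X \<Longrightarrow> \<phi> x y = \<phi> y x"
    and add_left: "x \<in> X \<Longrightarrow> y \<in> X \<Longrightarrow> z \<in> X \<Longrightarrow> \<phi> (x + y) z = \<phi> x z + \<phi> y z"
    and scale_left: "x \<in> X \<Longrightarrow> y \<in> X \<Longrightarrow> \<phi> (scale c x) y = c * \<phi> x y"
    and nondegenerate: "x \<in> X \<Longrightarrow> (\<And>y. y \<in> X \<Longrightarrow> \<phi> x y = 0) \<Longrightarrow> x = 0"
begin

lemma add_right: "x \<in> X \<Longrightarrow> y \<in> X \<Longrightarrow> z \<in> X \<Longrightarrow> \<phi> z (x + y) = \<phi> z x + \<phi> z y"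
  using add_left[of x y z] sym[of z] X_closed(2) by simp

lemma scale_right: "x \<in> X \<Longrightarrow> y \<in> X \<Longrightarrow> \<phi> y (scale c x) = c * \<phi> y x"
  using scale_left[of x y c] sym[of y] X_closed(3) by simp

lemma zero_left: "y \<in> X \<Longrightarrow> \<phi> 0 y = 0" "y \<in> X \<Longrightarrow> \<phi> y 0 = 0"
  using scale_left[of 0 y 0] scale_right[of 0 y 0] X_closed(1) by simp_all

lemma lincomb_left:
  assumes "\<And>i. i \<in> A \<Longrightarrow> w i \<in> X" "y \<in> X"
  shows "\<phi> (\<Sum>i\<in>A. scale (c i) (w i)) y = (\<Sum>i\<in>A. c i * \<phi> (w i) y)"
  using assms(1)
proof (induction A rule: infinite_finite_induct)
  case (insert x A)
  have "(\<Sum>i\<in>A. scale (c i) (w i)) \<in> X" using insert.prems by (intro X_closed(4,3)) auto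
  then show ?case using insert assms(2) X_closed(3) by (simp add: add_left scale_left)
qed (use assms(2) zero_left in auto)

lemma lincomb_right:
  assumes "\<And>i. i \<in> A \<Longrightarrow> w i \<in> X" "y \<in> X"
  shows "\<phi> y (\<Sum>i\<in>A. scale (c i) (w i)) = (\<Sum>i\<in>A. c i * \<phi> y (w i))"
proof -
  have "(\<Sum>i\<in>A. scale (c i) (w i)) \<in> X" using assms(1) by (intro X_closed(4,3)) auto
  then have "\<phi> y (\<Sum>i\<in>A. scale (c i) (w i)) = \<phi> (\<Sum>i\<in>A. scale (c i) (w i)) y"
    using sym assms(2) by blast
  also have "\<dots> = (\<Sum>i\<in>A. c i * \<phi> (w i) y)" by (rule lincomb_left[OF assms])
  also have "\<dots> = (\<Sum>i\<in>A. c i * \<phi> y (w i))"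
    using assms sym by (intro sum.cong) auto
  finally show ?thesis .
qed

definition gram :: "'v list \<Rightarrow> 'f mat" where
  "gram v = mat (length v) (length v) (\<lambda>(i, j). 2 * \<phi> (v ! i) (v ! j))"

lemma gram_carrier [simp]: "gram v \<in> carrier_mat (length v) (length v)"
  by (simp add: gram_def)

lemma gram_change:
  assumes w: "is_basis w" and v: "set v \<subseteq> X" "length v = length w"
  shows "gram v = coords scale w v * gram w * transpose_mat (coords scale w v)"
proof (rule eq_matI)
  let ?C = "coords scale w v" and ?n = "length w"
  have C: "?C \<in> carrier_mat ?n ?n" using coords_carrier[of scale w v] v(2) by simp
  fix i j assume "i < dim_row (?C * gram w * transpose_mat ?C)" "j < dim_col (?C * gram w * transpose_mat ?C)"
  then have ij: "i < ?n" "j < ?n" using C by auto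
  have vX: "v ! k \<in> X" if "k < ?n" for k using v that nth_mem by (metis subsetD)
  have wX: "w ! k \<in> X" if "k < ?n" for k using is_basisD(5)[OF w that] .
  have ex: "v ! k = (\<Sum>l<?n. scale (?C $$ (k, l)) (w ! l))" if "k < ?n" for k
    using basis_expand[OF w vX[OF that]] that v(2) by (simp add: coords_def)
  have "\<phi> (v ! i) (v ! j) = (\<Sum>l<?n. ?C $$ (j, l) * \<phi> (v ! i) (w ! l))"
    by (subst ex[OF ij(2)], rule lincomb_right) (use vX wX ij in auto)
  also have "\<dots> = (\<Sum>l<?n. ?C $$ (j, l) * (\<Sum>k<?n. ?C $$ (i, k) * \<phi> (w ! k) (w ! l)))"
  proof (rule sum.cong[OF refl])
    fix l assume "l \<in> {..<?n}"
    then show "?C $$ (j, l) * \<phi> (v ! i) (w ! l) = ?C $$ (j, l) * (\<Sum>k<?n. ?C $$ (i, k) * \<phi> (w ! k) (w ! l))"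
      by (subst ex[OF ij(1)], subst lincomb_left) (use wX in auto)
  qed
  finally have e: "\<phi> (v ! i) (v ! j) = (\<Sum>l<?n. ?C $$ (j, l) * (\<Sum>k<?n. ?C $$ (i, k) * \<phi> (w ! k) (w ! l)))" .
  have "(?C * gram w * transpose_mat ?C) $$ (i, j) = (\<Sum>l<?n. (\<Sum>k<?n. ?C $$ (i, k) * (2 * \<phi> (w ! k) (w ! l))) * ?C $$ (j, l))"
    using ij C v(2) by (simp add: scalar_prod_def atLeast0LessThan gram_def)
  also have "\<dots> = 2 * \<phi> (v ! i) (v ! j)"
    by (simp add: e sum_distrib_left sum_distrib_right algebra_simps)
  finally show "gram v $$ (i, j) = (?C * gram w * transpose_mat ?C) $$ (i, j)"
    using ij v(2) by (simp add: gram_def)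
qed (use v in \<open>auto simp: gram_def coords_def\<close>)

lemma det_gram_change:
  assumes w: "is_basis w" and v: "set v \<subseteq> X" "length v = length w"
  shows "det (gram v) = det (coords scale w v) ^ 2 * det (gram w)"
proof -
  have C: "coords scale w v \<in> carrier_mat (length w) (length w)" using coords_carrier[of scale w v] v(2) by simp
  have T: "transpose_mat (coords scale w v) \<in> carrier_mat (length w) (length w)" using C by simp
  show ?thesis
    unfolding gram_change[OF assms] det_mult[OF mult_carrier_mat[OF C gram_carrier] T] det_mult[OF C gram_carrier]
      det_transpose[OF C] by (simp add: power2_eq_square)
qed

lemma nondegenerate_basis:
  assumes v: "is_basis v" and x: "x \<in> X" and z: "\<And>i. i < length v \<Longrightarrow> \<phi> x (v ! i) = 0"
  shows "x = 0"
proof (rule nondegenerate[OF x])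
  fix y assume y: "y \<in> X"
  have "\<phi> x (\<Sum>i<length v. scale (representation (set v) y (v ! i)) (v ! i)) = 0"
    by (subst lincomb_right) (use z x is_basisD(5)[OF v] in auto)
  then show "\<phi> x y = 0" using basis_expand[OF v y] by simp
qed

lemma det_gram_nonzero:
  assumes v: "is_basis v" shows "det (gram v) \<noteq> 0"
proof
  assume "det (gram v) = 0"
  then obtain a where a: "a \<in> carrier_vec (length v)" "a \<noteq> 0\<^sub>v (length v)" "gram v *\<^sub>v a = 0\<^sub>v (length v)"
    using det_0_iff_vec_prod_zero_field[OF gram_carrier[of v]] by blast
  define x where "x = (\<Sum>i<length v. scale (a $ i) (v ! i))"
  have x: "x \<in> X" unfolding x_def using is_basisD(5)[OF v] by (intro X_closed(4,3)) auto
  have "\<phi> x (v ! j) = 0" if j: "j < length v" for j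
  proof -
    have "(gram v *\<^sub>v a) $ j = (\<Sum>i<length v. 2 * \<phi> (v ! j) (v ! i) * a $ i)"
      using j a(1) by (simp add: gram_def scalar_prod_def atLeast0LessThan)
    also have "\<dots> = 2 * (\<Sum>i<length v. a $ i * \<phi> (v ! j) (v ! i))" by (simp add: sum_distrib_left ac_simps)
    also have "(\<Sum>i<length v. a $ i * \<phi> (v ! j) (v ! i)) = \<phi> (v ! j) x"
      unfolding x_def using is_basisD(5)[OF v] j by (subst lincomb_right) auto
    finally show ?thesis using a(3) j sym[OF x is_basisD(5)[OF v j]] by simp
  qed
  then have "x = 0" by (rule nondegenerate_basis[OF v x])
  then have "a $ i = 0" if "i < length v" for i
    using representation_unique_lincomb[OF v that, of "\<lambda>i. a $ i"] by (simp add: x_def representation_zero)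
  then have "a = 0\<^sub>v (length v)" using a(1) by (intro eq_vecI) auto
  then show False using a(2) by simp
qed

text \<open>
  The factor 2 is the one in the definition of the dual lattice.
\<close>

definition dual_basis :: "'v list \<Rightarrow> 'v list \<Rightarrow> bool" where
  "dual_basis v w \<longleftrightarrow> is_basis w \<and> length w = length v \<and>
     (\<forall>i<length v. \<forall>j<length v. 2 * \<phi> (w ! i) (v ! j) = (if i = j then 1 else 0))"

lemma ex_dual_basis:
  assumes v: "is_basis v" shows "\<exists>w. dual_basis v w"
proof -
  let ?n = "length v"
  have vX: "v ! k \<in> X" if "k < ?n" for k using is_basisD(5)[OF v that] .
  obtain H where H: "H \<in> carrier_mat ?n ?n" "H * gram v = 1\<^sub>m ?n"
    using det_non_zero_imp_unit[OF gram_carrier[of v] det_gram_nonzero[OF v]]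
    by (auto simp: Units_def ring_mat_def)
  define w where "w = map (\<lambda>i. \<Sum>j<?n. scale (H $$ (i, j)) (v ! j)) [0..<?n]"
  have len: "length w = ?n" by (simp add: w_def)
  have wX: "w ! i \<in> X" if "i < ?n" for i
    using that vX unfolding w_def by (simp, intro X_closed(4,3)) auto
  have pair: "2 * \<phi> (w ! i) (v ! k) = (if i = k then 1 else 0)" if "i < ?n" "k < ?n" for i k
  proof -
    have "\<phi> (w ! i) (v ! k) = (\<Sum>j<?n. H $$ (i, j) * \<phi> (v ! j) (v ! k))"
      using that vX unfolding w_def by (simp, subst lincomb_left) auto
    then have "2 * \<phi> (w ! i) (v ! k) = (H * gram v) $$ (i, k)"
      using that H(1) by (simp add: gram_def scalar_prod_def atLeast0LessThan sum_distrib_left ac_simps)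
    then show ?thesis using that by (simp add: H(2))
  qed
  have dist: "distinct w" unfolding distinct_conv_nth
  proof (intro allI impI)
    fix i j assume "i < length w" "j < length w" "i \<noteq> j"
    then show "w ! i \<noteq> w ! j" using pair[of i i] pair[of j i] len by auto
  qed
  have sumw: "(\<Sum>b\<in>set w. f b) = (\<Sum>i<?n. f (w ! i))" for f :: "'v \<Rightarrow> 'v"
    using dist len by (intro sum.reindex_bij_betw[symmetric] bij_betw_nth) auto
  have "independent (set w)"
  proof
    assume "dependent (set w)"
    then obtain c b where c: "b \<in> set w" "c b \<noteq> 0" "(\<Sum>b\<in>set w. scale (c b) b) = 0"
      using dependent_finite[of "set w"] by auto
    obtain k where k: "k < ?n" "b = w ! k" using c(1) len by (metis in_set_conv_nth)
    have "0 = 2 * \<phi> (\<Sum>i<?n. scale (c (w ! i)) (w ! i)) (v ! k)"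
      using c(3) zero_left(1)[OF vX[OF k(1)]] by (simp add: sumw)
    also have "\<dots> = (\<Sum>i<?n. c (w ! i) * (2 * \<phi> (w ! i) (v ! k)))"
      by (subst lincomb_left) (use wX vX k in \<open>auto simp: sum_distrib_left ac_simps\<close>)
    also have "\<dots> = (\<Sum>i<?n. if i = k then c (w ! i) else 0)"
      using pair k(1) by (intro sum.cong) auto
    finally show False using k c(2) by simp
  qed
  moreover have "span (set w) = X"
  proof
    have "set w \<subseteq> X" using wX len by (metis in_set_conv_nth subsetI)
    then show "span (set w) \<subseteq> X" using span_minimal subspace_X by blast
    show "X \<subseteq> span (set w)"
    proof
      fix x assume x: "x \<in> X"
      define y where "y = (\<Sum>k<?n. scale (2 * \<phi> x (v ! k)) (w ! k))"
      have y: "y \<in> X" unfolding y_def using wX by (intro X_closed(4,3)) auto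
      have xy: "x + scale (-1) y \<in> X" using x y X_closed(2,3) by blast
      have "\<phi> y (v ! k) = \<phi> x (v ! k)" if k: "k < ?n" for k
      proof -
        have "\<phi> y (v ! k) = (\<Sum>i<?n. \<phi> x (v ! i) * (2 * \<phi> (w ! i) (v ! k)))"
          unfolding y_def by (subst lincomb_left) (use wX vX k in \<open>auto simp: ac_simps\<close>)
        also have "\<dots> = (\<Sum>i<?n. if i = k then \<phi> x (v ! i) else 0)"
          using pair k by (intro sum.cong) auto
        finally show ?thesis using k by simp
      qed
      then have "\<phi> (x + scale (-1) y) (v ! k) = 0" if "k < ?n" for k
        using that x y vX X_closed(3) by (subst add_left) (auto simp: scale_left simp del: scale_minus_left)
      then have "x + scale (-1) y = 0" by (rule nondegenerate_basis[OF v xy])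
      then have "x = y" by simp
      also have "y \<in> span (set w)" unfolding y_def
        using len by (intro span_sum span_scale span_base) auto
      finally show "x \<in> span (set w)" .
    qed
  qed
  ultimately have "is_basis w" using dist by (simp add: ordered_basis_def)
  then show ?thesis using len pair unfolding dual_basis_def by blast
qed

lemma representation_dual_basis:
  assumes v: "is_basis v" and d: "dual_basis v w" and x: "x \<in> X" and k: "k < length v"
  shows "representation (set w) x (w ! k) = 2 * \<phi> x (v ! k)"
proof -
  have w: "is_basis w" "length w = length v" using d by (auto simp: dual_basis_def)
  let ?c = "\<lambda>i. representation (set w) x (w ! i)"
  have "2 * \<phi> x (v ! k) = 2 * \<phi> (\<Sum>i<length w. scale (?c i) (w ! i)) (v ! k)"
    using basis_expand[OF w(1) x] by simp
  also have "\<dots> = (\<Sum>i<length w. ?c i * (2 * \<phi> (w ! i) (v ! k)))"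
    by (subst lincomb_left) (use is_basisD(5)[OF w(1)] is_basisD(5)[OF v k] in \<open>auto simp: sum_distrib_left ac_simps\<close>)
  also have "\<dots> = (\<Sum>i<length w. if i = k then ?c i else 0)"
    using d k by (intro sum.cong) (auto simp: dual_basis_def)
  finally show ?thesis using k w(2) by simp
qed

lemma dual_basis_sym:
  assumes v: "is_basis v" and d: "dual_basis v w" shows "dual_basis w v"
  using assms is_basisD(5)[OF v] is_basisD(5)[of w] sym by (auto simp: dual_basis_def)

text \<open>
  Thus the Gram determinant is the determinant of the base change from the dual basis, which is
  how the index of a lattice in its dual becomes a discriminant.
\<close>

lemma gram_eq_coords:
  assumes v: "is_basis v" and d: "dual_basis v w" shows "gram v = coords scale w v"
  using d representation_dual_basis[OF v d is_basisD(5)[OF v]]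
  by (intro eq_matI) (auto simp: gram_def coords_def dual_basis_def)

abbreviation "dual N \<equiv> dual_lattice X \<phi> N"

lemma submodule_dual:
  assumes "N \<subseteq> X" shows "submodule_over \<O> scale (dual N)"
proof -
  have "2 * \<phi> (x + y) z \<in> \<O>" if "x \<in> dual N" "y \<in> dual N" "z \<in> N" for x y z
  proof -
    have "2 * \<phi> (x + y) z = 2 * \<phi> x z + 2 * \<phi> y z"
      using that assms by (subst add_left) (auto simp: dual_lattice_def algebra_simps)
    then show ?thesis using that by (simp add: dual_lattice_def)
  qed
  moreover have "2 * \<phi> (scale c x) z \<in> \<O>" if "x \<in> dual N" "c \<in> \<O>" "z \<in> N" for x c z
  proof -
    have "2 * \<phi> (scale c x) z = c * (2 * \<phi> x z)"
      using that assms by (subst scale_left) (auto simp: dual_lattice_def)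
    also have "\<dots> \<in> \<O>"
      by (rule ring_of_integers_closed(5)) (use that in \<open>auto simp: dual_lattice_def\<close>)
    finally show ?thesis .
  qed
  ultimately show ?thesis using X_closed assms zero_left
    by (auto simp: submodule_over_def dual_lattice_def)
qed

lemma loc_dual:
  assumes m: "prime_ideal m" and N: "lattice_in_X N" and v: "local_basis m N v"
  shows "loc scale m (dual N) = {x\<in>X. \<forall>i<length v. 2 * \<phi> x (v ! i) \<in> loc_ring m}"
proof (intro equalityI subsetI)
  note R = subring_loc_ring[OF m]
  note vb = local_basisD(1)[OF v]
  obtain S where S: "finite S" "N = integral_span scale S" "S \<subseteq> N" "N \<subseteq> X" using latticeE[OF N] by metis
  have vN: "v ! i \<in> loc scale m N" if "i < length v" for i
    using basis_subset_local_lattice[OF R vb] v that nth_mem[OF that] by (auto simp: local_basis_def)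
  {
    fix x assume x: "x \<in> loc scale m (dual N)"
    have "dual N \<subseteq> X" by (auto simp: dual_lattice_def)
    then have xX: "x \<in> X" using loc_subset_X[of m "dual N"] m x by auto
    have "2 * \<phi> x (v ! i) \<in> loc_ring m" if i: "i < length v" for i
    proof -
      obtain s where s: "s \<in> \<O> - m" "scale s x \<in> dual N" using x by (auto simp: loc_def)
      obtain t where t: "t \<in> \<O> - m" "scale t (v ! i) \<in> N" using vN[OF i] by (auto simp: loc_def)
      have "2 * \<phi> (scale s x) (scale t (v ! i)) \<in> \<O>" using s t by (auto simp: dual_lattice_def)
      moreover have "2 * \<phi> (scale s x) (scale t (v ! i)) = (s * t) * (2 * \<phi> x (v ! i))"
        using xX is_basisD(5)[OF vb i] X_closed(3) by (simp add: scale_left scale_right)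
      ultimately show ?thesis using denominators(3)[OF m s(1) t(1)] unfolding loc_def
        by (intro CollectI bexI[of _ "s * t"]) auto
    qed
    then show "x \<in> {x\<in>X. \<forall>i<length v. 2 * \<phi> x (v ! i) \<in> loc_ring m}" using xX by blast
  next
    fix x assume x: "x \<in> {x\<in>X. \<forall>i<length v. 2 * \<phi> x (v ! i) \<in> loc_ring m}"
    have val: "2 * \<phi> x y \<in> loc_ring m" if y: "y \<in> local_lattice (loc_ring m) v" for y
    proof -
      let ?c = "\<lambda>i. representation (set v) y (v ! i)"
      have "2 * \<phi> x y = 2 * \<phi> x (\<Sum>i<length v. scale (?c i) (v ! i))"
        using basis_expand[OF vb, of y] y by (simp add: local_lattice_def)
      also have "\<dots> = (\<Sum>i<length v. ?c i * (2 * \<phi> x (v ! i)))"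
        by (subst lincomb_right) (use is_basisD(5)[OF vb] x in \<open>auto simp: sum_distrib_left ac_simps\<close>)
      also have "\<dots> \<in> loc_ring m"
        by (rule subring_sum[OF R], rule subringD(6)[OF R]) (use x y in \<open>auto simp: local_lattice_def\<close>)
      finally show ?thesis .
    qed
    have "(\<lambda>y. 2 * \<phi> x y) ` S \<subseteq> loc_ring m"
    proof
      fix a assume "a \<in> (\<lambda>y. 2 * \<phi> x y) ` S"
      then obtain y where y: "y \<in> S" "a = 2 * \<phi> x y" by blast
      then have "y \<in> local_lattice (loc_ring m) v"
        using S(3) loc_superset[OF m vs, of N] v by (auto simp: local_basis_def)
      then show "a \<in> loc_ring m" using val y by blast
    qed
    then obtain s where s: "s \<in> \<O> - m" "\<And>y. y \<in> S \<Longrightarrow> s * (2 * \<phi> x y) \<in> \<O>"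
      using common_denominator[OF m vector_space_self _ finite_imageI[OF S(1)], of \<O> "\<lambda>y. 2 * \<phi> x y"]
      by (auto simp: submodule_over_def)
    have "submodule_over \<O> scale {y\<in>X. s * (2 * \<phi> x y) \<in> \<O>}"
    proof -
      have "s * (2 * \<phi> x (y + z)) = s * (2 * \<phi> x y) + s * (2 * \<phi> x z)" if "y \<in> X" "z \<in> X" for y z
        using that x by (subst add_right) (auto simp: algebra_simps)
      moreover have "s * (2 * \<phi> x (scale c y)) \<in> \<O>"
        if "y \<in> X" "c \<in> \<O>" "s * (2 * \<phi> x y) \<in> \<O>" for y c
      proof -
        have "s * (2 * \<phi> x (scale c y)) = c * (s * (2 * \<phi> x y))"
          using that x by (subst scale_right) auto
        also have "\<dots> \<in> \<O>" by (rule ring_of_integers_closed(5)[OF that(2,3)])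
        finally show ?thesis .
      qed
      ultimately show ?thesis using X_closed x zero_left
        by (auto simp: submodule_over_def simp del: mult_cancel_left)
    qed
    then have "N \<subseteq> {y\<in>X. s * (2 * \<phi> x y) \<in> \<O>}" unfolding S(2)
      by (rule integral_span_minimal) (use S s(2) in auto)
    then have "scale s x \<in> dual N"
      using x S(4) X_closed(3) by (auto simp: dual_lattice_def scale_left subset_iff ac_simps)
    then show "x \<in> loc scale m (dual N)" using s(1) by (auto simp: loc_def)
  }
qed

lemma local_basis_dual:
  assumes m: "prime_ideal m" and N: "lattice_in_X N" and v: "local_basis m N v" and d: "dual_basis v w"
  shows "local_basis m (dual N) w"
proof -
  note vb = local_basisD(1)[OF v]
  have "loc scale m (dual N) = local_lattice (loc_ring m) w"
    unfolding loc_dual[OF m N v] local_lattice_def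
    using representation_dual_basis[OF vb d] d by (auto simp: dual_basis_def)
  then show ?thesis using d by (simp add: local_basis_def dual_basis_def)
qed

text \<open>
  Only finite generation is at issue. The ideal \<open>T\<close> of all \<open>s\<close> for which \<open>s\<close> times the identity has
  the form \<open>z \<mapsto> \<Sum> 2\<phi>(z,f\<^sub>i) x\<^sub>i\<close> with \<open>f\<^sub>i\<close> in the dual and \<open>x\<^sub>i\<close> in \<open>N\<close> contains a local denominator
  for every prime ideal, by means of a local basis and its dual. So \<open>1 \<in> T\<close>, and the \<open>f\<^sub>i\<close>
  belonging to \<open>1\<close> generate the dual lattice.
\<close>

lemma dual_lattice_is_lattice:
  assumes N: "lattice_in_X N" shows "lattice_in_X (dual N)"
proof -
  obtain S where S: "finite S" "N = integral_span scale S" "S \<subseteq> N" "N \<subseteq> X" 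
    "submodule_over \<O> scale N" using latticeE[OF N] by metis
  have dX: "dual N \<subseteq> X" by (auto simp: dual_lattice_def)
  note dsub = submodule_dual[OF S(4)]
  let ?rep = "\<lambda>s ps. set ps \<subseteq> dual N \<times> N \<and>
    (\<forall>z\<in>X. scale s z = sum_list (map (\<lambda>(f, x). scale (2 * \<phi> z f) x) ps))"
  define T where "T = {s\<in>\<O>. \<exists>ps. ?rep s ps}"
  have memT: "s \<in> T" if "s \<in> \<O>" "?rep s ps" for s ps using that by (auto simp: T_def)
  have T: "submodule_over \<O> (*) T" unfolding submodule_over_def
  proof (intro conjI ballI)
    show "0 \<in> T" by (rule memT[of _ "[]"]) auto
  next
    fix s t assume "s \<in> T" "t \<in> T"
    then obtain ps qs where "s \<in> \<O>" "t \<in> \<O>" "?rep s ps" "?rep t qs" by (auto simp: T_def)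
    then show "s + t \<in> T" by (intro memT[of _ "ps @ qs"]) (auto simp: scale_left_distrib)
  next
    fix c s :: 'f assume c: "c \<in> \<O>" and "s \<in> T"
    then obtain ps where s: "s \<in> \<O>" and ps: "?rep s ps" by (auto simp: T_def)
    let ?qs = "map (\<lambda>(f, x). (scale c f, x)) ps"
    show "c * s \<in> T"
    proof (rule memT[of _ ?qs], intro ring_of_integers_closed c s, intro conjI ballI)
      show "set ?qs \<subseteq> dual N \<times> N" using ps submodule_overD(3)[OF dsub c] by auto
      fix z assume z: "z \<in> X"
      have aux: "sum_list (map (\<lambda>(f, x). scale (2 * \<phi> z f) x) (map (\<lambda>(f, x). (scale c f, x)) qs)) =
        scale c (sum_list (map (\<lambda>(f, x). scale (2 * \<phi> z f) x) qs))" if "set qs \<subseteq> dual N \<times> N" for qs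
        using that dX z by (induction qs) (auto simp: scale_right scale_right_distrib subset_iff ac_simps)
      show "scale (c * s) z = sum_list (map (\<lambda>(f, x). scale (2 * \<phi> z f) x) ?qs)"
        using aux[of ps] ps z by (metis scale_scale)
    qed
  qed
  have "1 \<in> T"
  proof (rule local_global[OF vector_space_self T])
    fix m :: "'f set" assume m: "prime_ideal m"
    note R = subring_loc_ring[OF m]
    obtain v where v: "local_basis m N v" using ex_local_basis[OF m N] by blast
    note vb = local_basisD(1)[OF v]
    obtain w where d: "dual_basis v w" using ex_dual_basis[OF vb] by blast
    have wb: "is_basis w" "length w = length v" using d by (auto simp: dual_basis_def)
    have w: "local_basis m (dual N) w" by (rule local_basis_dual[OF m N v d])
    obtain s where s: "s \<in> \<O> - m" "\<forall>x\<in>set v. scale s x \<in> N"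
      using common_denominator[OF m vs S(5), of "set v"] basis_subset_local_lattice[OF R vb] v
      by (auto simp: local_basis_def)
    obtain t where t: "t \<in> \<O> - m" "\<forall>x\<in>set w. scale t x \<in> dual N"
      using common_denominator[OF m vs dsub, of "set w"] basis_subset_local_lattice[OF R wb(1)] w
      by (auto simp: local_basis_def)
    let ?ps = "map (\<lambda>i. (scale t (w ! i), scale s (v ! i))) [0..<length v]"
    have "?rep (s * t) ?ps"
    proof (intro conjI ballI)
      show "set ?ps \<subseteq> dual N \<times> N" using s(2) t(2) wb(2) by auto
      fix z assume z: "z \<in> X"
      have "scale (s * t) z = (\<Sum>i<length v. scale (s * t * representation (set v) z (v ! i)) (v ! i))"
        using basis_expand[OF vb z] by (metis (no_types, lifting) scale_scale scale_sum_right sum.cong)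
      also have "\<dots> = (\<Sum>i<length v. scale (2 * \<phi> z (scale t (w ! i))) (scale s (v ! i)))"
        using representation_dual_basis[OF wb(1) dual_basis_sym[OF vb d] z] wb is_basisD(5)[OF wb(1)] z
        by (intro sum.cong) (auto simp: scale_right ac_simps)
      finally show "scale (s * t) z = sum_list (map (\<lambda>(f, x). scale (2 * \<phi> z f) x) ?ps)"
        by (simp add: comp_def interv_sum_list_conv_sum_set_nat atLeast0LessThan)
    qed
    then have "s * t \<in> T" using denominators(3)[OF m s(1) t(1)] by (intro memT[of _ ?ps]) auto
    then show "1 \<in> loc (*) m T" using denominators(3)[OF m s(1) t(1)] by (auto simp: loc_def intro!: bexI[of _ "s * t"])
  qed
  then obtain ps where ps: "set ps \<subseteq> dual N \<times> N"
    "\<And>z. z \<in> X \<Longrightarrow> z = sum_list (map (\<lambda>(f, x). scale (2 * \<phi> z f) x) ps)" by (auto simp: T_def)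
  let ?F = "fst ` set ps"
  have FX: "?F \<subseteq> dual N" using ps(1) by auto
  have "dual N \<subseteq> integral_span scale ?F"
  proof
    fix f assume f: "f \<in> dual N"
    then have fX: "f \<in> X" using dX by blast
    define y where "y = sum_list (map (\<lambda>(g, x). scale (2 * \<phi> f x) g) ps)"
    have aux: "sum_list (map (\<lambda>(g, x). scale (2 * \<phi> f x) g) qs) \<in> X \<and>
       sum_list (map (\<lambda>(g, x). scale (2 * \<phi> z g) x) qs) \<in> X \<and>
       \<phi> (sum_list (map (\<lambda>(g, x). scale (2 * \<phi> f x) g) qs)) z =
       \<phi> f (sum_list (map (\<lambda>(g, x). scale (2 * \<phi> z g) x) qs))"
      if "set qs \<subseteq> dual N \<times> N" "z \<in> X" for qs z
      using that(1)
    proof (induction qs)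
      case Nil then show ?case using X_closed(1) zero_left fX that(2) by simp
    next
      case (Cons p qs)
      obtain g x where p: "p = (g, x)" by fastforce
      have g: "g \<in> X" "x \<in> X" using Cons.prems p dX S(4) by auto
      show ?case using Cons g X_closed that(2) fX sym[OF g(1) that(2)]
        by (simp add: p add_left add_right scale_left scale_right)
    qed
    have yX: "y \<in> X" using aux[OF ps(1) fX] by (simp add: y_def)
    have "f + scale (-1) y = 0"
    proof (rule nondegenerate)
      show "f + scale (-1) y \<in> X" using fX yX X_closed by blast
      fix z assume z: "z \<in> X"
      have "\<phi> y z = \<phi> f z" using aux[OF ps(1) z] ps(2)[OF z] by (simp add: y_def)
      then show "\<phi> (f + scale (-1) y) z = 0"
        using fX yX z X_closed(3) by (subst add_left) (auto simp: scale_left simp del: scale_minus_left)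
    qed
    then have "f = y" by simp
    also have "y \<in> integral_span scale ?F" unfolding y_def
    proof (rule submodule_over_sum_list[OF submodule_integral_span])
      fix u assume "u \<in> set (map (\<lambda>(g, x). scale (2 * \<phi> f x) g) ps)"
      then obtain g x where gx: "(g, x) \<in> set ps" "u = scale (2 * \<phi> f x) g" by auto
      then have "2 * \<phi> f x \<in> \<O>" using f ps(1) by (auto simp: dual_lattice_def)
      moreover have "g \<in> integral_span scale ?F" using gx(1) integral_span_superset[of ?F] by force
      ultimately show "u \<in> integral_span scale ?F" unfolding gx(2)
        by (rule submodule_overD(3)[OF submodule_integral_span])
    qed
    finally show "f \<in> integral_span scale ?F" .
  qed
  then have eq: "dual N = integral_span scale ?F" using integral_span_minimal[OF dsub FX] by blast
  have "X \<subseteq> span (dual N)"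
  proof -
    obtain m :: "'f set" where m: "prime_ideal m"
      using ideal_in_prime_ideal[of "{0}"] by (auto simp: submodule_over_def)
    obtain v where v: "local_basis m N v" using ex_local_basis[OF m N] by blast
    note vb = local_basisD(1)[OF v]
    obtain w where d: "dual_basis v w" using ex_dual_basis[OF vb] by blast
    have wb: "is_basis w" using d by (auto simp: dual_basis_def)
    have w: "local_basis m (dual N) w" by (rule local_basis_dual[OF m N v d])
    have "set w \<subseteq> span (dual N)"
    proof
      fix x assume "x \<in> set w"
      then have "x \<in> loc scale m (dual N)" using w basis_subset_local_lattice[OF subring_loc_ring[OF m] wb] by (auto simp: local_basis_def)
      then obtain s where s: "s \<in> \<O> - m" "scale s x \<in> dual N" by (auto simp: loc_def)
      then have "scale (inverse s) (scale s x) \<in> span (dual N)" by (intro span_scale span_base)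
      then show "x \<in> span (dual N)" using denominators(2)[OF m s(1)] by simp
    qed
    then show ?thesis using is_basisD(3)[OF wb] span_minimal[OF _ subspace_span] by blast
  qed
  then show ?thesis using latticeI[OF _ eq dX] by simp
qed

lemma loc_discriminant:
  assumes m: "prime_ideal m" and N: "lattice_in_X N" and v: "local_basis m N v"
  shows "loc (*) m (lattice_index scale X (dual N) N) = (\<lambda>r. det (gram v) * r) ` loc_ring m"
proof -
  note vb = local_basisD(1)[OF v]
  obtain w where d: "dual_basis v w" using ex_dual_basis[OF vb] by blast
  show ?thesis
    using loc_lattice_index[OF m dual_lattice_is_lattice[OF N] N local_basis_dual[OF m N v d] v]
    by (simp add: gram_eq_coords[OF vb d])
qed

section \<open>Comparison of integral lattices with maximal ones\<close>

lemma polar_integral: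
  assumes N: "integral_lattice scale X \<phi> N" and xy: "x \<in> N" "y \<in> N"
  shows "2 * \<phi> x y \<in> \<O>"
proof -
  have L: "lattice_in_X N" and i: "\<And>x. x \<in> N \<Longrightarrow> \<phi> x x \<in> \<O>"
    using N by (auto simp: integral_lattice_def)
  obtain S where S: "N \<subseteq> X" "submodule_over \<O> scale N" using latticeE[OF L] by metis
  have X: "x \<in> X" "y \<in> X" using S xy by auto
  have "\<phi> (x + y) (x + y) = \<phi> x x + 2 * \<phi> x y + \<phi> y y"
    using X X_closed(2) sym[OF X] by (simp add: add_left add_right)
  then have "2 * \<phi> x y = \<phi> (x + y) (x + y) - \<phi> x x - \<phi> y y" by simp
  also have "\<dots> \<in> \<O>"
    using i[OF xy(1)] i[OF xy(2)] i[OF submodule_overD(2)[OF S(2) xy]] by (metis ring_of_integers_closed(7))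
  finally show ?thesis .
qed

lemma local_polar_integral:
  assumes m: "prime_ideal m" and N: "integral_lattice scale X \<phi> N"
    and xy: "x \<in> loc scale m N" "y \<in> loc scale m N"
  shows "2 * \<phi> x y \<in> loc_ring m"
proof -
  have L: "lattice_in_X N" using N by (simp add: integral_lattice_def)
  then have "N \<subseteq> X" using latticeE by metis
  then have X: "x \<in> X" "y \<in> X" using loc_subset_X[of m N] m xy by auto
  obtain s where s: "s \<in> \<O> - m" "scale s x \<in> N" using xy by (auto simp: loc_def)
  obtain t where t: "t \<in> \<O> - m" "scale t y \<in> N" using xy by (auto simp: loc_def)
  have "2 * \<phi> (scale s x) (scale t y) \<in> \<O>" by (rule polar_integral[OF N s(2) t(2)])
  moreover have "2 * \<phi> (scale s x) (scale t y) = (s * t) * (2 * \<phi> x y)"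
    using X X_closed(3) by (simp add: scale_left scale_right)
  ultimately show ?thesis using denominators(3)[OF m s(1) t(1)] unfolding loc_def
    by (intro CollectI bexI[of _ "s * t"]) auto
qed

text \<open>
  The form takes integral values on \<open>J + \<O>x\<close>, which therefore equals \<open>J\<close>.
\<close>

lemma maximal_absorbs:
  assumes J: "maximal_lattice scale X \<phi> J" and x: "x \<in> dual J" "\<phi> x x \<in> \<O>"
  shows "x \<in> J"
proof -
  have Ji: "integral_lattice scale X \<phi> J" using J by (simp add: maximal_lattice_def)
  then have L: "lattice_in_X J" and i: "\<And>x. x \<in> J \<Longrightarrow> \<phi> x x \<in> \<O>" by (auto simp: integral_lattice_def)
  obtain S where S: "finite S" "J = integral_span scale S" "S \<subseteq> J" "J \<subseteq> X" "span S = X"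
    "submodule_over \<O> scale J" using latticeE[OF L] by metis
  have xX: "x \<in> X" using x by (simp add: dual_lattice_def)
  define K where "K = {y + scale c x | y c. y \<in> J \<and> c \<in> \<O>}"
  have memK: "y + scale c x \<in> K" if "y \<in> J" "c \<in> \<O>" for y c using that by (auto simp: K_def)
  note Jd = submodule_overD[OF S(6)]
  have Ksub: "submodule_over \<O> scale K" unfolding submodule_over_def
  proof (intro conjI ballI)
    show "0 \<in> K" using memK[of 0 0] Jd(1) by simp
  next
    fix a b assume "a \<in> K" "b \<in> K"
    then obtain y c z d where *: "a = y + scale c x" "b = z + scale d x" "y \<in> J" "z \<in> J" "c \<in> \<O>" "d \<in> \<O>"
      by (auto simp: K_def)
    then have "a + b = (y + z) + scale (c + d) x" by (simp add: scale_left_distrib)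
    moreover have "(y + z) + scale (c + d) x \<in> K" by (rule memK) (use Jd(2) * in auto)
    ultimately show "a + b \<in> K" by (simp only:)
  next
    fix k :: 'f and a assume k: "k \<in> \<O>" and "a \<in> K"
    then obtain y c where *: "a = y + scale c x" "y \<in> J" "c \<in> \<O>" by (auto simp: K_def)
    then have "scale k a = scale k y + scale (k * c) x" by (simp add: scale_right_distrib)
    then show "scale k a \<in> K" using memK[OF Jd(3)[OF k *(2)] ring_of_integers_closed(5)[OF k *(3)]] by simp
  qed
  have JK: "J \<subseteq> K" using memK[of _ 0] by auto
  have xK: "x \<in> K" using memK[of 0 1] Jd(1) by simp
  have "K = integral_span scale (insert x S)"
  proof
    show "integral_span scale (insert x S) \<subseteq> K"
      by (rule integral_span_minimal[OF Ksub]) (use JK xK S(3) in auto)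
    note sp = submodule_overD[OF submodule_integral_span[of "insert x S"]]
    have "J \<subseteq> integral_span scale (insert x S)" unfolding S(2)
      using integral_span_superset[of "insert x S"] by (intro integral_span_minimal submodule_integral_span) auto
    moreover have "x \<in> integral_span scale (insert x S)" using integral_span_superset[of "insert x S"] by auto
    ultimately show "K \<subseteq> integral_span scale (insert x S)" unfolding K_def using sp by blast
  qed
  moreover have "K \<subseteq> X" using S(4) xX X_closed by (auto simp: K_def)
  moreover have "X \<subseteq> span K" using S(3,5) JK span_mono[of S K] by auto
  ultimately have KL: "lattice_in_X K" using latticeI[of "insert x S" K] S(1) by simp
  have "\<phi> z z \<in> \<O>" if "z \<in> K" for z
  proof -
    obtain y c where *: "z = y + scale c x" "y \<in> J" "c \<in> \<O>" using \<open>z \<in> K\<close> by (auto simp: K_def)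
    have yX: "y \<in> X" using * S by auto
    have "\<phi> z z = \<phi> y y + (c * (2 * \<phi> x y) + c * (c * \<phi> x x))"
      using yX xX X_closed(3) sym[OF xX yX]
      by (simp add: *(1) add_left add_right scale_left scale_right X_closed(2) algebra_simps)
    moreover have "2 * \<phi> x y \<in> \<O>" using x * by (auto simp: dual_lattice_def)
    ultimately show ?thesis
      using i[OF *(2)] *(3) x(2) by (metis ring_of_integers_closed(4,5))
  qed
  then have "integral_lattice scale X \<phi> K" using KL by (simp add: integral_lattice_def)
  then have "K = J" using J JK by (simp add: maximal_lattice_def)
  then show ?thesis using xK by simp
qed

text \<open>
  The hypotheses of \<open>det_in_valuation_ring\<close> are checked for the Gram matrix of \<open>J\<close>. For \<open>max\<close>, a row
  of \<open>Z * A\<close> is an element of the localization of \<open>I\<close>, and a row of \<open>Z * A * G\<close> lists its values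
  against a basis of \<open>J\<close>; clearing denominators gives an element of \<open>I\<close> that lies in the dual of \<open>J\<close>,
  which \<open>J\<close> absorbs.
\<close>

lemma det_integral_in_maximal:
  assumes m: "prime_ideal m" and I: "integral_lattice scale X \<phi> I" and J: "maximal_lattice scale X \<phi> J"
    and v: "local_basis m I v" and w: "local_basis m J w"
  shows "det (coords scale w v) \<in> loc_ring m"
proof -
  let ?R = "loc_ring m"
  note R = subring_loc_ring[OF m]
  note vb = local_basisD(1)[OF v]
  note wb = local_basisD(1)[OF w]
  define n where "n = length w"
  have len: "length v = n" using basis_length[OF vb wb] by (simp add: n_def)
  have Ji: "integral_lattice scale X \<phi> J" using J by (simp add: maximal_lattice_def)
  have LI: "lattice_in_X I" and LJ: "lattice_in_X J" and iI: "\<And>x. x \<in> I \<Longrightarrow> \<phi> x x \<in> \<O>"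
    using I Ji by (auto simp: integral_lattice_def)
  have subI: "submodule_over \<O> scale I" using latticeE[OF LI] by metis
  have JX: "J \<subseteq> X" using latticeE[OF LJ] by metis
  let ?A = "coords scale w v"
  have A: "?A \<in> carrier_mat n n" and G: "gram w \<in> carrier_mat n n"
    using coords_square[OF wb vb] by (auto simp: n_def)
  have vI: "v ! i \<in> loc scale m I" if "i < n" for i
    using basis_subset_local_lattice[OF R vb] v that nth_mem[of i v] len by (auto simp: local_basis_def)
  show ?thesis
  proof (rule det_in_valuation_ring[OF valuation_loc_ring[OF number_field m] A G])
    have "over ?R (gram v)"
      unfolding over_def gram_def using local_polar_integral[OF m I vI vI] len by auto
    then show "over ?R (?A * gram w * transpose_mat ?A)"
      using gram_change[OF wb is_basisD(4)[OF vb]] len n_def by simp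
  next
    fix Z assume Z: "Z \<in> carrier_mat n n" "over ?R Z" "over ?R (Z * ?A * gram w)"
    define xs where "xs = map (\<lambda>i. \<Sum>j<n. scale (Z $$ (i, j)) (v ! j)) [0..<n]"
    have lx: "length xs = n" by (simp add: xs_def)
    have xI: "xs ! i \<in> loc scale m I" if i: "i < n" for i
    proof -
      have sub: "submodule_over ?R scale (loc scale m I)" by (rule submodule_loc[OF m vs subI])
      have "(\<Sum>j<n. scale (Z $$ (i, j)) (v ! j)) \<in> loc scale m I"
        by (rule submodule_over_sum[OF sub], rule submodule_overD(3)[OF sub])
          (use overD[OF Z(2,1) i] vI in auto)
      then show ?thesis using i by (simp add: xs_def)
    qed
    have "I \<subseteq> X" using latticeE[OF LI] by metis
    then have xX: "xs ! i \<in> X" if "i < n" for i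
      using loc_subset_X[of m I] m xI[OF that] by auto
    then have xsX: "set xs \<subseteq> X" using lx by (metis in_set_conv_nth subsetI)
    have ZA: "coords scale w xs = Z * ?A"
    proof (rule coords_lincomb[OF wb is_basisD(4)[OF vb]])
      show "Z \<in> carrier_mat (length xs) (length v)" using Z lx len by simp
      fix i assume "i < length xs"
      then show "xs ! i = (\<Sum>j<length v. scale (Z $$ (i, j)) (v ! j))" using lx len by (simp add: xs_def)
    qed
    have "xs ! i \<in> loc scale m J" if i: "i < n" for i
    proof -
      have "2 * \<phi> (xs ! i) (w ! k) \<in> ?R" if k: "k < n" for k
      proof -
        have wX: "w ! l \<in> X" if "l < n" for l using is_basisD(5)[OF wb] that n_def by simp
        have "(\<Sum>l<n. scale ((Z * ?A) $$ (i, l)) (w ! l)) =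
            (\<Sum>l<n. scale (representation (set w) (xs ! i) (w ! l)) (w ! l))"
          unfolding ZA[symmetric] using i lx by (intro sum.cong) (auto simp: coords_def n_def)
        then have expand: "xs ! i = (\<Sum>l<n. scale ((Z * ?A) $$ (i, l)) (w ! l))"
          using basis_expand[OF wb xX[OF i]] by (simp add: n_def)
        have "2 * \<phi> (xs ! i) (w ! k) = 2 * \<phi> (\<Sum>l<n. scale ((Z * ?A) $$ (i, l)) (w ! l)) (w ! k)"
          by (simp add: expand[symmetric])
        also have "\<dots> = (\<Sum>l<n. (Z * ?A) $$ (i, l) * (2 * \<phi> (w ! l) (w ! k)))"
          by (subst lincomb_left) (use wX k in \<open>auto simp: sum_distrib_left ac_simps\<close>)
        also have "\<dots> = (Z * ?A * gram w) $$ (i, k)"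
          using i k Z(1) A unfolding n_def by (subst index_mult_mat) (auto simp: scalar_prod_def atLeast0LessThan gram_def)
        also have "\<dots> \<in> ?R" using Z(3) i k Z(1) A G by (auto simp: over_def)
        finally show ?thesis .
      qed
      then have "xs ! i \<in> loc scale m (dual J)" using loc_dual[OF m LJ w] xX[OF i] n_def by auto
      then obtain s where s: "s \<in> \<O> - m" "scale s (xs ! i) \<in> dual J" by (auto simp: loc_def)
      obtain t where t: "t \<in> \<O> - m" "scale t (xs ! i) \<in> I" using xI[OF i] by (auto simp: loc_def)
      define x where "x = scale (s * t) (xs ! i)"
      have "x = scale s (scale t (xs ! i))" "x = scale t (scale s (xs ! i))" by (simp_all add: x_def mult.commute)
      then have "x \<in> I" "x \<in> dual J"
        using submodule_overD(3)[OF subI _ t(2), of s] submodule_overD(3)[OF submodule_dual[OF JX] _ s(2), of t] s(1) t(1)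
        by (simp_all only: Diff_iff)
      then have "x \<in> J" using maximal_absorbs[OF J] iI by blast
      then show ?thesis using denominators(3)[OF m s(1) t(1)] by (auto simp: loc_def x_def)
    qed
    then have "set xs \<subseteq> local_lattice ?R w" using w lx unfolding local_basis_def by (metis in_set_conv_nth subsetI)
    then show "over ?R (Z * ?A)" using over_coords_iff[OF xsX] ZA by metis
  qed
qed

end

lemma (in quadratic_lattice_space) loc_discriminant_inverse:
  assumes m: "prime_ideal m" and N: "lattice_in_X N" and v: "local_basis m N v"
  shows "loc (*) m (ideal_inverse (lattice_index scale X (dual N) N)) = (\<lambda>r. 1 / det (gram v) * r) ` loc_ring m"
proof -
  note vb = local_basisD(1)[OF v]
  obtain w where d: "dual_basis v w" using ex_dual_basis[OF vb] by blast
  have wb: "is_basis w" using d by (simp add: dual_basis_def)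
  have "det (coords scale v w) = 1 / det (gram v)"
    using det_coords_inverse(1)[OF vb wb] det_gram_nonzero[OF vb] by (simp add: gram_eq_coords[OF vb d] eq_divide_eq)
  then show ?thesis
    using loc_lattice_index[OF m N dual_lattice_is_lattice[OF N] v local_basis_dual[OF m N v d]]
    by (simp add: ideal_inverse_lattice_index[OF dual_lattice_is_lattice[OF N] N])
qed

text \<open>
  Necessity: the determinant and its inverse are integral by \<open>det_integral_in_maximal\<close>, applied
  in both directions. Sufficiency: let \<open>K'\<close> be an integral lattice containing \<open>K\<close>. The index of \<open>K\<close>
  in \<open>K'\<close> divides a local unit, because the remaining factor, which compares \<open>K'\<close> with \<open>M\<close>, is
  integral as well. So \<open>K\<close> and \<open>K'\<close> agree locally.
\<close>

lemma (in quadratic_lattice_space) maximal_iff_local: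
  assumes M: "maximal_lattice scale X \<phi> M" and K: "integral_lattice scale X \<phi> K"
    and loc_k: "\<And>m. prime_ideal m \<Longrightarrow> local_basis m K (k m)"
    and loc_w: "\<And>m. prime_ideal m \<Longrightarrow> local_basis m M (w m)"
  shows "maximal_lattice scale X \<phi> K \<longleftrightarrow>
    (\<forall>m. prime_ideal m \<longrightarrow> 1 / det (coords scale (w m) (k m)) \<in> loc_ring m)"
proof
  assume max: "maximal_lattice scale X \<phi> K"
  show "\<forall>m. prime_ideal m \<longrightarrow> 1 / det (coords scale (w m) (k m)) \<in> loc_ring m"
  proof (intro allI impI)
    fix m :: "'f set" assume m: "prime_ideal m"
    have b: "is_basis (k m)" "is_basis (w m)" using loc_k[OF m] loc_w[OF m] by (auto simp: local_basis_def)
    have "integral_lattice scale X \<phi> M" using M by (simp add: maximal_lattice_def)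
    then have "det (coords scale (k m) (w m)) \<in> loc_ring m"
      using det_integral_in_maximal[OF m _ max loc_w[OF m] loc_k[OF m]] by blast
    moreover have "det (coords scale (k m) (w m)) = 1 / det (coords scale (w m) (k m))"
      using det_coords_inverse[OF b(2,1)] by (simp add: eq_divide_eq mult.commute)
    ultimately show "1 / det (coords scale (w m) (k m)) \<in> loc_ring m" by simp
  qed
next
  assume D: "\<forall>m. prime_ideal m \<longrightarrow> 1 / det (coords scale (w m) (k m)) \<in> loc_ring m"
  have LK: "lattice_in_X K" using K by (simp add: integral_lattice_def)
  then have sK: "submodule_over \<O> scale K" using latticeE by metis
  have "K' \<subseteq> K" if K': "integral_lattice scale X \<phi> K'" "K \<subseteq> K'" for K'
  proof
    fix x assume x: "x \<in> K'"
    show "x \<in> K"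
    proof (rule local_global[OF vs sK])
      fix m :: "'f set" assume m: "prime_ideal m"
      let ?R = "loc_ring m"
      note R = subring_loc_ring[OF m]
      have LK': "lattice_in_X K'" using K' by (simp add: integral_lattice_def)
      obtain l where l: "local_basis m K' l" using ex_local_basis[OF m LK'] by blast
      have b: "is_basis (k m)" "is_basis (w m)" "is_basis l"
        using loc_k[OF m] loc_w[OF m] l by (auto simp: local_basis_def)
      have l': "det (coords scale (w m) l) \<in> ?R" by (rule det_integral_in_maximal[OF m K'(1) M l loc_w[OF m]])
      have "set (k m) \<subseteq> local_lattice ?R (k m)" by (rule basis_subset_local_lattice[OF R b(1)])
      also have "\<dots> \<subseteq> local_lattice ?R l" using loc_mono[OF m, of K K' scale] K'(2) loc_k[OF m] l by (simp add: local_basis_def)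
      finally have ov: "over ?R (coords scale l (k m))" using over_coords_iff[OF is_basisD(4)[OF b(1)]] by blast
      have dm: "det (coords scale (w m) (k m)) = det (coords scale l (k m)) * det (coords scale (w m) l)"
        by (rule det_coords_mult[OF b(2,3) is_basisD(4)[OF b(1)] basis_length[OF b(1,3)]])
      have "1 / det (coords scale l (k m)) = det (coords scale (w m) l) * (1 / det (coords scale (w m) (k m)))"
        using dm det_coords_inverse(2)[OF b(2,3)] by simp
      also have "\<dots> \<in> ?R" using D m l' subringD(6)[OF R] by blast
      finally have "1 / det (coords scale l (k m)) \<in> ?R" .
      then have "over ?R (coords scale (k m) l)"
        by (intro over_inverse[OF R coords_square[OF b(3,1) refl] ov coords_square[OF b(1,3) basis_length[OF b(1,3)]]
              coords_inverse[OF b(3,1)]])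
      then have "set l \<subseteq> local_lattice ?R (k m)" using over_coords_iff[OF is_basisD(4)[OF b(3)]] by blast
      then have "local_lattice ?R l \<subseteq> local_lattice ?R (k m)"
        by (rule local_lattice_minimal[OF b(3) submodule_local_lattice[OF R b(1)]])
      moreover have "x \<in> local_lattice ?R l" using x loc_superset[OF m vs, of K'] l by (auto simp: local_basis_def)
      ultimately show "x \<in> loc scale m K" using loc_k[OF m] by (auto simp: local_basis_def)
    qed
  qed
  then show "maximal_lattice scale X \<phi> K" using K by (auto simp: maximal_lattice_def)
qed

section \<open>The lattice cut out by an orthogonal complement\<close>

locale anisotropic_vector = quadratic_lattice_space scale UNIV \<phi>
  for scale :: "'f::field_char_0 \<Rightarrow> 'v::ab_group_add \<Rightarrow> 'v" and \<phi> :: "'v \<Rightarrow> 'v \<Rightarrow> 'f" +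
  fixes h :: 'v
  assumes anisotropic: "\<phi> h h \<noteq> 0"
begin

definition W :: "'v set" where "W = {x. \<phi> x h = 0}"

lemma W_iff: "x \<in> W \<longleftrightarrow> \<phi> h x = 0"
  using sym[of x h] by (simp add: W_def)

lemma in_W_minus:
  assumes "\<phi> h y \<noteq> 0" shows "x - scale (\<phi> h x / \<phi> h y) y \<in> W"
proof -
  have "\<phi> h (x + scale (- (\<phi> h x / \<phi> h y)) y) = 0" using assms
    by (subst add_right) (auto simp: scale_right simp del: scale_minus_left)
  then show ?thesis by (simp add: W_iff)
qed

lemma quadratic_lattice_space_W: "quadratic_lattice_space scale W \<phi>"
proof
  show "algebraic_number_field TYPE('f)" by (rule number_field)
  show sub: "subspace W" unfolding subspace_def
    by (auto simp: W_iff add_right scale_right zero_left)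
  obtain B where B: "B \<subseteq> W" "independent B" "W \<subseteq> span B" using maximal_independent_subset[of W] by blast
  obtain T where T: "finite T" "span T = UNIV" using finite_dim by blast
  have "finite B" using independent_span_bound[OF T(1) B(2)] T(2) by auto
  then show "\<exists>B. finite B \<and> span B = W" using B span_minimal[OF B(1) sub] by blast
next
  fix x assume x: "x \<in> W" and orth: "\<And>y. y \<in> W \<Longrightarrow> \<phi> x y = 0"
  show "x = 0"
  proof (rule nondegenerate)
    fix z
    let ?c = "\<phi> h z / \<phi> h h"
    have "z = (z - scale ?c h) + scale ?c h" by simp
    then have "\<phi> x z = \<phi> x (z - scale ?c h) + ?c * \<phi> x h"
      using add_right[of "z - scale ?c h" "scale ?c h" x] scale_right[of h x ?c] by simp
    also have "\<dots> = 0" using orth[OF in_W_minus[OF anisotropic]] x by (simp add: W_def)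
    finally show "\<phi> x z = 0" .
  qed simp
qed (auto intro: sym simp: add_left scale_left)

interpretation W: quadratic_lattice_space scale W \<phi>
  by (rule quadratic_lattice_space_W)

lemma functional_nonzero:
  assumes "span S = UNIV" shows "\<exists>s\<in>S. \<phi> h s \<noteq> 0"
proof (rule ccontr)
  assume "\<not> ?thesis"
  then have "S \<subseteq> W" by (auto simp: W_iff)
  then have "span S \<subseteq> W" using span_minimal W.subspace_X by blast
  then show False using assms anisotropic by (auto simp: W_iff)
qed

lemma submodule_functional:
  assumes "subring R"
  shows "submodule_over R scale {x. c * \<phi> h x \<in> R}"
proof -
  note Rd = subringD[OF assms]
  have "c * \<phi> h (scale a x) \<in> R" if "a \<in> R" "c * \<phi> h x \<in> R" for a x
    using Rd(6)[OF that] by (simp add: scale_right ac_simps)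
  then show ?thesis using Rd(1,4) by (auto simp: submodule_over_def add_right zero_left distrib_left)
qed

text \<open>
  Among the values \<open>\<phi>(h,s)\<close> at generators \<open>s\<close> of \<open>L\<close> one divides all the others locally.
\<close>

lemma ex_local_generator:
  assumes m: "prime_ideal m" and L: "lattice_in_X L"
  shows "\<exists>y\<in>L. \<phi> h y \<noteq> 0 \<and> (\<forall>x\<in>loc scale m L. \<phi> h x / \<phi> h y \<in> loc_ring m)"
proof -
  obtain S where S: "finite S" "L = integral_span scale S" "S \<subseteq> L" "span S = UNIV" using latticeE[OF L] by metis
  obtain s1 where "s1 \<in> S" "\<phi> h s1 \<noteq> 0" using functional_nonzero[OF S(4)] by blast
  then obtain y where y: "y \<in> S" "\<phi> h y \<noteq> 0" "\<forall>b\<in>\<phi> h ` S. b / \<phi> h y \<in> loc_ring m"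
    using valuation_ring_dominant[OF valuation_loc_ring[OF number_field m] finite_imageI[OF S(1)], of "\<phi> h s1" "\<phi> h"]
    by auto
  have "loc scale m L \<subseteq> {x. 1 / \<phi> h y * \<phi> h x \<in> loc_ring m}"
    unfolding S(2) loc_ring_span[OF m vs]
    by (rule ring_span_minimal[OF submodule_functional[OF subring_loc_ring[OF m]]]) (use y(3) in auto)
  then show ?thesis using y S(3) by (intro bexI[of _ y]) auto
qed

lemma ideal_inverse_image_iff:
  "b \<in> ideal_inverse (\<phi> h ` L) \<longleftrightarrow> (\<forall>x\<in>L. b * \<phi> h x \<in> \<O>)"
  by (auto simp: ideal_inverse_def)

text \<open>
  The ideal \<open>\<phi>(h,L)\<close> is locally principal, and it is finitely generated, so a multiple of the
  inverse of a local generator by some denominator belongs to the global inverse ideal.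
\<close>

lemma functional_ideal_invertible:
  assumes L: "lattice_in_X L"
  shows "1 \<in> ideal_mult (ideal_inverse (\<phi> h ` L)) (\<phi> h ` L)"
proof (rule local_global[OF vector_space_self])
  show "submodule_over \<O> (*) (ideal_mult (ideal_inverse (\<phi> h ` L)) (\<phi> h ` L))"
    by (simp add: ideal_mult_def integral_span_eq submodule_ring_span vector_space_self subring_ring_of_integers)
  fix m :: "'f set" assume m: "prime_ideal m"
  obtain S where S: "finite S" "L = integral_span scale S" "S \<subseteq> L" using latticeE[OF L] by metis
  obtain y where y: "y \<in> L" "\<phi> h y \<noteq> 0" "\<And>x. x \<in> loc scale m L \<Longrightarrow> \<phi> h x / \<phi> h y \<in> loc_ring m"
    using ex_local_generator[OF m L] by blast
  have "(\<lambda>x. \<phi> h x / \<phi> h y) ` S \<subseteq> loc_ring m" using y(3) S(3) loc_superset[OF m vs, of L] by blast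
  then obtain s where s: "s \<in> \<O> - m" "\<And>x. x \<in> S \<Longrightarrow> s * (\<phi> h x / \<phi> h y) \<in> \<O>"
    using common_denominator[OF m vector_space_self _ finite_imageI[OF S(1)], of \<O> "\<lambda>x. \<phi> h x / \<phi> h y"]
    by (auto simp: submodule_over_def)
  have "L \<subseteq> {x. s / \<phi> h y * \<phi> h x \<in> \<O>}" unfolding S(2)
    by (rule integral_span_minimal[OF submodule_functional[OF subring_ring_of_integers]]) (use s(2) in auto)
  then have "s / \<phi> h y \<in> ideal_inverse (\<phi> h ` L)" by (auto simp: ideal_inverse_image_iff)
  then have "s / \<phi> h y * \<phi> h y \<in> ideal_mult (ideal_inverse (\<phi> h ` L)) (\<phi> h ` L)"
    unfolding ideal_mult_def integral_span_eq using y(1)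
    by (intro subsetD[OF ring_span_superset[OF vector_space_self subring_ring_of_integers]]) blast
  then show "1 \<in> loc (*) m (ideal_mult (ideal_inverse (\<phi> h ` L)) (\<phi> h ` L))"
    using s(1) y(2) by (auto simp: loc_def intro!: bexI[of _ s])
qed

lemma scaled_into_lattice:
  assumes L: "lattice_in_X L" shows "\<exists>d\<in>\<O>. d \<noteq> 0 \<and> scale d x \<in> L"
proof -
  obtain S where S: "finite S" "L = integral_span scale S" "S \<subseteq> L" "span S = UNIV"
    "submodule_over \<O> scale L" using latticeE[OF L] by metis
  note Ld = submodule_overD[OF S(5)]
  define U where "U = {x. \<exists>d\<in>\<O>. d \<noteq> 0 \<and> scale d x \<in> L}"
  have U: "x \<in> U" if "d \<in> \<O>" "d \<noteq> 0" "scale d x \<in> L" for d x using that by (auto simp: U_def)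
  have "subspace U" unfolding subspace_def
  proof (intro conjI ballI allI)
    show "0 \<in> U" using U[of 1 0] Ld(1) by simp
  next
    fix x y assume "x \<in> U" "y \<in> U"
    then obtain d e where de: "d \<in> \<O>" "d \<noteq> 0" "scale d x \<in> L" "e \<in> \<O>" "e \<noteq> 0" "scale e y \<in> L"
      by (auto simp: U_def)
    have "scale (d * e) (x + y) = scale e (scale d x) + scale d (scale e y)"
      by (simp add: scale_right_distrib mult.commute)
    also have "\<dots> \<in> L" by (rule Ld(2)[OF Ld(3) Ld(3)]) (use de in auto)
    finally show "x + y \<in> U" using de by (intro U[of "d * e"] ring_of_integers_closed) auto
  next
    fix c :: 'f and x assume "x \<in> U"
    then obtain d where d: "d \<in> \<O>" "d \<noteq> 0" "scale d x \<in> L" by (auto simp: U_def)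
    obtain e where e: "e \<in> \<O>" "e \<noteq> 0" "e * c \<in> \<O>"
      using integral_denominator[OF number_field, of c] by blast
    have "scale (e * d) (scale c x) = scale (e * c) (scale d x)" by (simp add: ac_simps)
    also have "\<dots> \<in> L" by (rule Ld(3)[OF e(3) d(3)])
    finally show "scale c x \<in> U" using d e by (intro U[of "e * d"] ring_of_integers_closed) auto
  qed
  moreover have "S \<subseteq> U" using U[of 1] S(3) by auto
  ultimately have "x \<in> U" using span_minimal[of S U] S(4) by auto
  then show ?thesis by (simp add: U_def)
qed

text \<open>
  Writing \<open>1 = \<Sum> c\<^sub>p b\<^sub>p \<phi>(h,l\<^sub>p)\<close> with \<open>b\<^sub>p\<close> in the inverse of \<open>\<phi>(h,L)\<close>, the map
  \<open>x \<mapsto> x - \<Sum> c\<^sub>p b\<^sub>p \<phi>(h,x) l\<^sub>p\<close> is a projection of \<open>L\<close> onto \<open>L \<inter> W\<close>. So \<open>L \<inter> W\<close> is generated by the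
  images of the generators of \<open>L\<close>.
\<close>

lemma lattice_inter_W:
  assumes L: "lattice_in_X L" shows "W.lattice_in_X (L \<inter> W)"
proof -
  obtain S where S: "finite S" "L = integral_span scale S" "S \<subseteq> L" "span S = UNIV"
    "submodule_over \<O> scale L" using latticeE[OF L] by metis
  note Ld = submodule_overD[OF S(5)]
  let ?P = "{b * a | b a. b \<in> ideal_inverse (\<phi> h ` L) \<and> a \<in> \<phi> h ` L}"
  obtain T c where T: "finite T" "T \<subseteq> ?P" "\<forall>p\<in>T. c p \<in> \<O>" "1 = (\<Sum>p\<in>T. c p * p)"
    using functional_ideal_invertible[OF L] unfolding ideal_mult_def integral_span_def by auto
  have "\<forall>p\<in>T. \<exists>b l. p = b * \<phi> h l \<and> b \<in> ideal_inverse (\<phi> h ` L) \<and> l \<in> L" using T(2) by fastforce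
  then obtain b l where bl: "\<And>p. p \<in> T \<Longrightarrow> p = b p * \<phi> h (l p)"
    "\<And>p. p \<in> T \<Longrightarrow> b p \<in> ideal_inverse (\<phi> h ` L)" "\<And>p. p \<in> T \<Longrightarrow> l p \<in> L" by metis
  define \<pi> where "\<pi> x = x + scale (-1) (\<Sum>p\<in>T. scale (c p * (b p * \<phi> h x)) (l p))" for x
  have \<pi>W: "\<pi> x \<in> W" for x
  proof -
    have "\<phi> h (\<pi> x) = \<phi> h x - (\<Sum>p\<in>T. (c p * (b p * \<phi> h x)) * \<phi> h (l p))"
      by (simp add: \<pi>_def add_right scale_right lincomb_right del: scale_minus_left)
    also have "(\<Sum>p\<in>T. (c p * (b p * \<phi> h x)) * \<phi> h (l p)) = (\<Sum>p\<in>T. \<phi> h x * (c p * p))"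
    proof (rule sum.cong[OF refl])
      fix p assume p: "p \<in> T"
      have "(c p * (b p * \<phi> h x)) * \<phi> h (l p) = \<phi> h x * (c p * (b p * \<phi> h (l p)))" by simp
      then show "(c p * (b p * \<phi> h x)) * \<phi> h (l p) = \<phi> h x * (c p * p)" using bl(1)[OF p] by (simp only:)
    qed
    also have "\<dots> = \<phi> h x" using T(4) by (simp flip: sum_distrib_left)
    finally show ?thesis by (simp add: W_iff)
  qed
  have \<pi>L: "\<pi> x \<in> L" if x: "x \<in> L" for x
  proof -
    have "(\<Sum>p\<in>T. scale (c p * (b p * \<phi> h x)) (l p)) \<in> L"
      by (rule submodule_over_sum[OF S(5)], rule Ld(3), rule ring_of_integers_closed(5))
        (use T(3) bl x in \<open>auto simp: ideal_inverse_image_iff\<close>)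
    then show ?thesis unfolding \<pi>_def using x Ld(3)[of "-1"] by (intro Ld(2)) auto
  qed
  have \<pi>id: "\<pi> x = x" if "x \<in> W" for x using that by (simp add: \<pi>_def W_iff)
  have \<pi>add: "\<pi> (x + y) = \<pi> x + \<pi> y" for x y
    by (simp add: \<pi>_def add_right distrib_left scale_left_distrib sum.distrib scale_right_distrib)
  have \<pi>scale: "\<pi> (scale a x) = scale a (\<pi> x)" for a x
    by (simp add: \<pi>_def scale_right scale_sum_right scale_right_distrib ac_simps scale_right_diff_distrib)
  let ?K = "integral_span scale (\<pi> ` S)"
  note Kd = submodule_overD[OF submodule_integral_span[of "\<pi> ` S"]]
  have LW: "submodule_over \<O> scale (L \<inter> W)"
    using Ld W.X_closed by (auto simp: submodule_over_def)
  have "?K \<subseteq> L \<inter> W" by (rule integral_span_minimal[OF LW]) (use \<pi>W \<pi>L S(3) in auto)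
  moreover have "L \<inter> W \<subseteq> ?K"
  proof
    fix x assume x: "x \<in> L \<inter> W"
    have "submodule_over \<O> scale {x. \<pi> x \<in> ?K}"
      using Kd \<pi>id[OF W.X_closed(1)] by (auto simp: submodule_over_def \<pi>add \<pi>scale)
    then have "L \<subseteq> {x. \<pi> x \<in> ?K}" unfolding S(2)
      by (rule integral_span_minimal) (use integral_span_superset[of "\<pi> ` S"] in auto)
    then have "\<pi> x \<in> ?K" using x by blast
    then show "x \<in> ?K" using \<pi>id x by simp
  qed
  ultimately have eq: "L \<inter> W = ?K" by blast
  have "W \<subseteq> span (L \<inter> W)"
  proof
    fix x assume x: "x \<in> W"
    obtain d where d: "d \<noteq> 0" "scale d x \<in> L" using scaled_into_lattice[OF L] by blast
    then have "scale d x \<in> L \<inter> W" using x W.X_closed(3) by blast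
    then have "scale (inverse d) (scale d x) \<in> span (L \<inter> W)" by (intro span_scale span_base)
    then show "x \<in> span (L \<inter> W)" using d(1) by simp
  qed
  then show ?thesis using W.latticeI[OF _ eq] S(1) by simp
qed

lemma basis_Cons:
  assumes k: "W.is_basis k" and y: "\<phi> h y \<noteq> 0" shows "is_basis (y # k)"
proof -
  have "y \<notin> span (set k)" using y W.is_basisD(3)[OF k] by (simp add: W_iff)
  then have "independent (set (y # k))" "y \<notin> set k"
    using W.is_basisD(2)[OF k] independent_insertI span_base by auto
  moreover have "x \<in> span (set (y # k))" for x
  proof -
    have "x - scale (\<phi> h x / \<phi> h y) y \<in> span (set k)" using in_W_minus[OF y] W.is_basisD(3)[OF k] by simp
    then have "x - scale (\<phi> h x / \<phi> h y) y \<in> span (set (y # k))" using span_mono[of "set k" "set (y # k)"] by auto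
    moreover have "scale (\<phi> h x / \<phi> h y) y \<in> span (set (y # k))" by (intro span_scale span_base) simp
    ultimately have "(x - scale (\<phi> h x / \<phi> h y) y) + scale (\<phi> h x / \<phi> h y) y \<in> span (set (y # k))" by (rule span_add)
    then show ?thesis by simp
  qed
  ultimately show ?thesis using W.is_basisD(1)[OF k] by (auto simp: ordered_basis_def)
qed

text \<open>
  For \<open>y = h\<close> the Gram matrix splits. In general \<open>y\<close> is \<open>\<phi>(h,y)/\<phi>[h]\<close> times \<open>h\<close> plus an element of \<open>W\<close>,
  so the base change from \<open>h, k\<close> to \<open>y, k\<close> is triangular with this quotient as determinant.
\<close>

lemma det_gram_Cons:
  assumes k: "W.is_basis k" and y: "\<phi> h y \<noteq> 0"
  shows "det (gram (y # k)) = 2 * (\<phi> h y)\<^sup>2 / \<phi> h h * det (gram k)"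
proof -
  let ?u = "h # k" and ?v = "y # k" and ?n = "length k"
  have u: "is_basis ?u" by (rule basis_Cons[OF k anisotropic])
  have kW: "k ! i \<in> W" if "i < ?n" for i using W.is_basisD(5)[OF k that] .
  have "det (gram ?u) = gram ?u $$ (0, 0) * det (mat ?n ?n (\<lambda>(i, j). gram ?u $$ (Suc i, Suc j)))"
    using kW by (intro det_first_column_zero) (auto simp: gram_def W_def)
  also have "mat ?n ?n (\<lambda>(i, j). gram ?u $$ (Suc i, Suc j)) = gram k"
    by (rule eq_matI) (auto simp: gram_def)
  finally have gu: "det (gram ?u) = 2 * \<phi> h h * det (gram k)" by (simp add: gram_def)
  let ?C = "coords scale ?u ?v"
  have C: "?C \<in> carrier_mat (Suc ?n) (Suc ?n)" using coords_carrier[of scale ?u ?v] by simp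
  have Cij: "?C $$ (Suc i, j) = (if Suc i = j then 1 else 0)" if "i < ?n" "j < Suc ?n" for i j
    using representation_nth[OF u, of "Suc i" j] that by (simp add: coords_def)
  have "det ?C = ?C $$ (0, 0) * det (mat ?n ?n (\<lambda>(i, j). ?C $$ (Suc i, Suc j)))"
    using Cij by (intro det_first_column_zero[OF C]) auto
  also have "mat ?n ?n (\<lambda>(i, j). ?C $$ (Suc i, Suc j)) = 1\<^sub>m ?n"
    by (rule eq_matI) (auto simp: Cij)
  finally have dC: "det ?C = representation (set ?u) y h" by (simp add: coords_def)
  let ?c = "\<lambda>i. representation (set ?u) y (?u ! i)"
  have "\<phi> h y = \<phi> h (\<Sum>i<length ?u. scale (?c i) (?u ! i))" using basis_expand[OF u, of y] by simp
  also have "\<dots> = (\<Sum>i<length ?u. ?c i * \<phi> h (?u ! i))" by (rule lincomb_right) auto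
  also have "\<dots> = (\<Sum>i<Suc ?n. ?c i * \<phi> h (?u ! i))" by simp
  also have "\<dots> = ?c 0 * \<phi> h (?u ! 0) + (\<Sum>i<?n. ?c (Suc i) * \<phi> h (?u ! Suc i))" by (rule sum.lessThan_Suc_shift)
  also have "\<dots> = representation (set ?u) y h * \<phi> h h" using kW by (simp add: W_iff)
  finally have "representation (set ?u) y h = \<phi> h y / \<phi> h h" using anisotropic by (simp add: eq_divide_eq)
  then show ?thesis
    using det_gram_change[OF u, of ?v] gu anisotropic by (simp add: dC power2_eq_square)
qed

text \<open>
  Subtracting a multiple of \<open>y\<close> with coefficient \<open>\<phi>(h,x)/\<phi>(h,y)\<close> moves \<open>x\<close> into \<open>W\<close>.
\<close>

lemma local_basis_Cons:
  assumes m: "prime_ideal m" and L: "lattice_in_X L" and k: "W.local_basis m (L \<inter> W) k"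
    and y: "y \<in> L" "\<phi> h y \<noteq> 0" "\<And>x. x \<in> loc scale m L \<Longrightarrow> \<phi> h x / \<phi> h y \<in> loc_ring m"
  shows "local_basis m L (y # k)"
proof -
  let ?R = "loc_ring m" and ?v = "y # k"
  note R = subring_loc_ring[OF m]
  have kb: "W.is_basis k" and kl: "loc scale m (L \<inter> W) = W.local_lattice ?R k" using k by (auto simp: W.local_basis_def)
  have v: "is_basis ?v" by (rule basis_Cons[OF kb y(2)])
  have subL: "submodule_over ?R scale (loc scale m L)" using submodule_loc[OF m vs] latticeE[OF L] by metis
  note Ld = submodule_overD[OF subL]
  have yl: "y \<in> loc scale m L" using y(1) loc_superset[OF m vs, of L] by blast
  have "set k \<subseteq> loc scale m (L \<inter> W)" using W.basis_subset_local_lattice[OF R kb] kl by simp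
  then have "set ?v \<subseteq> loc scale m L" using loc_mono[OF m, of "L \<inter> W" L scale] yl by auto
  then have 1: "local_lattice ?R ?v \<subseteq> loc scale m L" by (rule local_lattice_minimal[OF v subL])
  note Vd = submodule_overD[OF submodule_local_lattice[OF R v]]
  have vv: "set ?v \<subseteq> local_lattice ?R ?v" by (rule basis_subset_local_lattice[OF R v])
  have kv: "W.local_lattice ?R k \<subseteq> local_lattice ?R ?v"
    by (rule W.local_lattice_minimal[OF kb submodule_local_lattice[OF R v]]) (use vv in auto)
  have "loc scale m L \<subseteq> local_lattice ?R ?v"
  proof
    fix x assume x: "x \<in> loc scale m L"
    let ?r = "\<phi> h x / \<phi> h y"
    have r: "?r \<in> ?R" by (rule y(3)[OF x])
    let ?x = "x - scale ?r y"
    have "x + scale (- ?r) y \<in> loc scale m L" by (rule Ld(2)[OF x Ld(3)[OF subringD(3)[OF R r] yl]])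
    then have "?x \<in> loc scale m L" by simp
    then obtain s where s: "s \<in> \<O> - m" "scale s ?x \<in> L" by (auto simp: loc_def)
    have "scale s ?x \<in> L \<inter> W" using s(2) W.X_closed(3)[OF in_W_minus[OF y(2)]] by blast
    then have "?x \<in> loc scale m (L \<inter> W)" using s(1) unfolding loc_def by blast
    then have "?x \<in> local_lattice ?R ?v" using kl kv by blast
    moreover have "y \<in> local_lattice ?R ?v" using vv by simp
    ultimately have "?x + scale ?r y \<in> local_lattice ?R ?v" using Vd(2,3) r by blast
    then show "x \<in> local_lattice ?R ?v" by simp
  qed
  then show ?thesis using v 1 by (auto simp: local_basis_def)
qed

lemma loc_functional_ideal_inverse:
  assumes m: "prime_ideal m" and L: "lattice_in_X L"
    and y: "y \<in> L" "\<phi> h y \<noteq> 0" "\<And>x. x \<in> loc scale m L \<Longrightarrow> \<phi> h x / \<phi> h y \<in> loc_ring m"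
  shows "loc (*) m (ideal_inverse (ideal_mult (\<phi> h ` L) (\<phi> h ` L))) = (\<lambda>r. 1 / (\<phi> h y)\<^sup>2 * r) ` loc_ring m"
proof -
  let ?R = "loc_ring m"
  note R = subring_loc_ring[OF m]
  obtain S where S: "finite S" "L = integral_span scale S" "S \<subseteq> L" using latticeE[OF L] by metis
  let ?Q = "{a * b | a b. a \<in> \<phi> h ` L \<and> b \<in> \<phi> h ` L}"
  have inv: "x \<in> ideal_inverse (ideal_mult (\<phi> h ` L) (\<phi> h ` L)) \<longleftrightarrow>
      (\<forall>z\<in>L. \<forall>z'\<in>L. x * \<phi> h z * \<phi> h z' \<in> \<O>)" for x
  proof
    assume x: "x \<in> ideal_inverse (ideal_mult (\<phi> h ` L) (\<phi> h ` L))"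
    show "\<forall>z\<in>L. \<forall>z'\<in>L. x * \<phi> h z * \<phi> h z' \<in> \<O>"
    proof (intro ballI)
      fix z z' assume "z \<in> L" "z' \<in> L"
      then have "\<phi> h z * \<phi> h z' \<in> ideal_mult (\<phi> h ` L) (\<phi> h ` L)"
        unfolding ideal_mult_def integral_span_eq
        by (intro subsetD[OF ring_span_superset[OF vector_space_self subring_ring_of_integers]]) blast
      then show "x * \<phi> h z * \<phi> h z' \<in> \<O>" using x by (auto simp: ideal_inverse_def mult.assoc)
    qed
  next
    assume x: "\<forall>z\<in>L. \<forall>z'\<in>L. x * \<phi> h z * \<phi> h z' \<in> \<O>"
    have "submodule_over \<O> (*) {a. x * a \<in> \<O>}"
    proof -
      have "x * (c * a) \<in> \<O>" if "c \<in> \<O>" "x * a \<in> \<O>" for c a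
        using ring_of_integers_closed(5)[OF that] by (simp add: ac_simps)
      then show ?thesis by (auto simp: submodule_over_def distrib_left)
    qed
    then have "ideal_mult (\<phi> h ` L) (\<phi> h ` L) \<subseteq> {a. x * a \<in> \<O>}"
      unfolding ideal_mult_def integral_span_eq by (rule ring_span_minimal) (use x in \<open>auto simp: mult.assoc\<close>)
    then show "x \<in> ideal_inverse (ideal_mult (\<phi> h ` L) (\<phi> h ` L))" by (auto simp: ideal_inverse_def)
  qed
  show ?thesis
  proof (intro equalityI subsetI)
    fix x assume "x \<in> loc (*) m (ideal_inverse (ideal_mult (\<phi> h ` L) (\<phi> h ` L)))"
    then obtain s where s: "s \<in> \<O> - m" "s * x \<in> ideal_inverse (ideal_mult (\<phi> h ` L) (\<phi> h ` L))"
      by (auto simp: loc_def)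
    then have "s * x * \<phi> h y * \<phi> h y \<in> \<O>" using y(1) unfolding inv by blast
    then have "x * (\<phi> h y)\<^sup>2 \<in> ?R" using s(1) by (auto simp: loc_def power2_eq_square mult.assoc)
    then show "x \<in> (\<lambda>r. 1 / (\<phi> h y)\<^sup>2 * r) ` ?R" using y(2) by (intro image_eqI[of _ _ "x * (\<phi> h y)\<^sup>2"]) auto
  next
    fix x assume "x \<in> (\<lambda>r. 1 / (\<phi> h y)\<^sup>2 * r) ` ?R"
    then obtain r where r: "r \<in> ?R" "x = 1 / (\<phi> h y)\<^sup>2 * r" by blast
    have SL: "z \<in> loc scale m L" if "z \<in> S" for z using that S(3) loc_superset[OF m vs, of L] by blast
    have "(\<lambda>(z, z'). x * \<phi> h z * \<phi> h z') ` (S \<times> S) \<subseteq> ?R"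
    proof -
      have "x * \<phi> h z * \<phi> h z' \<in> ?R" if z: "z \<in> S" "z' \<in> S" for z z'
      proof -
        have "x * \<phi> h z * \<phi> h z' = r * ((\<phi> h z / \<phi> h y) * (\<phi> h z' / \<phi> h y))"
          by (simp add: r power2_eq_square)
        also have "\<dots> \<in> ?R" by (rule subringD(6)[OF R r(1) subringD(6)[OF R y(3)[OF SL[OF z(1)]] y(3)[OF SL[OF z(2)]]]])
        finally show ?thesis .
      qed
      then show ?thesis by auto
    qed
    moreover have "submodule_over \<O> (*) (\<O> :: 'f set)" by (auto simp: submodule_over_def)
    ultimately obtain t where t: "t \<in> \<O> - m"
      "\<forall>q\<in>(\<lambda>(z, z'). x * \<phi> h z * \<phi> h z') ` (S \<times> S). t * q \<in> \<O>"
      using common_denominator[OF m vector_space_self, of \<O> "(\<lambda>(z, z'). x * \<phi> h z * \<phi> h z') ` (S \<times> S)"] S(1)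
      by auto
    have e1: "L \<subseteq> {z'. (t * x * \<phi> h z) * \<phi> h z' \<in> \<O>}" if z: "z \<in> S" for z
      unfolding S(2) by (rule integral_span_minimal[OF submodule_functional[OF subring_ring_of_integers]])
        (use t(2) z in \<open>auto simp: mult.assoc\<close>)
    have e2: "L \<subseteq> {z. (t * x * \<phi> h z') * \<phi> h z \<in> \<O>}" if z: "z' \<in> L" for z'
      by (subst (1) S(2), rule integral_span_minimal[OF submodule_functional[OF subring_ring_of_integers]])
        (use e1 z in \<open>auto simp: ac_simps\<close>)
    have "t * x \<in> ideal_inverse (ideal_mult (\<phi> h ` L) (\<phi> h ` L))" unfolding inv using e2 by blast
    then show "x \<in> loc (*) m (ideal_inverse (ideal_mult (\<phi> h ` L) (\<phi> h ` L)))" using t(1) by (auto simp: loc_def)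
  qed
qed

text \<open>
  With \<open>c\<close> a local generator of \<open>\<phi>(h,L)\<close> and \<open>D\<close> the determinant of the base change from \<open>M\<close> to \<open>L \<inter> W\<close>,
  the left ideal is locally generated by \<open>\<phi>[h]/c\<^sup>2\<close> and the right one by \<open>\<phi>[h]/(c\<^sup>2 D\<^sup>2)\<close>. As \<open>D\<close> is
  integral, they agree precisely when \<open>D\<close> is a unit.
\<close>

theorem maximal_inter_iff:
  assumes L: "maximal_lattice scale UNIV \<phi> L" and M: "maximal_lattice scale W \<phi> M"
  shows "maximal_lattice scale W \<phi> (L \<inter> W) \<longleftrightarrow>
    (\<lambda>a. \<phi> h h * a) ` ideal_inverse (ideal_mult (\<phi> h ` L) (\<phi> h ` L)) =
    (\<lambda>a. 2 * a) ` ideal_mult (lattice_index scale W (dual_lattice W \<phi> M) M)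
        (ideal_inverse (lattice_index scale UNIV (dual_lattice UNIV \<phi> L) L))"
    (is "_ \<longleftrightarrow> ?lhs = ?rhs")
proof -
  let ?K = "L \<inter> W" and ?q = "\<phi> h h"
  have LL: "lattice_in_X L" and iL: "\<And>x. x \<in> L \<Longrightarrow> \<phi> x x \<in> \<O>"
    using L by (auto simp: maximal_lattice_def integral_lattice_def)
  have LM: "W.lattice_in_X M" using M by (simp add: maximal_lattice_def integral_lattice_def)
  have LK: "W.lattice_in_X ?K" by (rule lattice_inter_W[OF LL])
  then have K: "integral_lattice scale W \<phi> ?K" using iL by (simp add: integral_lattice_def)
  obtain k where k: "\<And>m. prime_ideal m \<Longrightarrow> W.local_basis m ?K (k m)" using W.ex_local_basis[OF _ LK] by metis
  obtain w where w: "\<And>m. prime_ideal m \<Longrightarrow> W.local_basis m M (w m)" using W.ex_local_basis[OF _ LM] by metis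
  have loc_iff: "loc (*) m ?lhs = loc (*) m ?rhs \<longleftrightarrow> 1 / det (coords scale (w m) (k m)) \<in> loc_ring m"
    if m: "prime_ideal m" for m
  proof -
    let ?R = "loc_ring m"
    note R = subring_loc_ring[OF m]
    have kb: "W.is_basis (k m)" and wb: "W.is_basis (w m)" using k[OF m] w[OF m] by (auto simp: W.local_basis_def)
    obtain y where y: "y \<in> L" "\<phi> h y \<noteq> 0" "\<And>x. x \<in> loc scale m L \<Longrightarrow> \<phi> h x / \<phi> h y \<in> ?R"
      using ex_local_generator[OF m LL] by blast
    define c where "c = \<phi> h y"
    define D where "D = det (coords scale (w m) (k m))"
    have c0: "c \<noteq> 0" using y(2) by (simp add: c_def)
    have D0: "D \<noteq> 0" using W.det_coords_inverse(2)[OF wb kb] by (simp add: D_def)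
    let ?g = "det (gram (w m))"
    have g0: "?g \<noteq> 0" by (rule W.det_gram_nonzero[OF wb])
    have DR: "D \<in> ?R" unfolding D_def by (rule W.det_integral_in_maximal[OF m K M k[OF m] w[OF m]])
    have fun_inv: "loc (*) m (ideal_inverse (ideal_mult (\<phi> h ` L) (\<phi> h ` L))) = (\<lambda>r. 1 / c\<^sup>2 * r) ` ?R"
      unfolding c_def by (rule loc_functional_ideal_inverse[OF m LL y])
    have lhs: "loc (*) m ?lhs = (\<lambda>r. ?q / c\<^sup>2 * r) ` ?R"
      unfolding loc_mult_image[OF m] fun_inv by (simp add: image_image)
    have "loc (*) m (ideal_inverse (lattice_index scale UNIV (dual L) L)) = (\<lambda>r. 1 / det (gram (y # k m)) * r) ` ?R"
      by (rule loc_discriminant_inverse[OF m LL local_basis_Cons[OF m LL k[OF m] y]])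
    moreover have "det (gram (y # k m)) = 2 * c\<^sup>2 / ?q * (D\<^sup>2 * ?g)"
      using det_gram_Cons[OF kb y(2)] W.det_gram_change[OF wb W.is_basisD(4)[OF kb] W.basis_length[OF kb wb]]
      by (simp add: c_def D_def)
    ultimately have inv: "loc (*) m (ideal_inverse (lattice_index scale UNIV (dual L) L)) =
        (\<lambda>r. 1 / (2 * c\<^sup>2 / ?q * (D\<^sup>2 * ?g)) * r) ` ?R" by simp
    have "loc (*) m ?rhs = (\<lambda>r. 2 * (?g * (1 / (2 * c\<^sup>2 / ?q * (D\<^sup>2 * ?g)))) * r) ` ?R"
      unfolding loc_mult_image[OF m] loc_ideal_mult[OF m W.loc_discriminant[OF m LM w[OF m]] inv]
      by (simp add: image_image mult.assoc)
    also have "2 * (?g * (1 / (2 * c\<^sup>2 / ?q * (D\<^sup>2 * ?g)))) = ?q / c\<^sup>2 * (1 / D\<^sup>2)" using g0 anisotropic by simp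
    finally have rhs: "loc (*) m ?rhs = (\<lambda>r. ?q / c\<^sup>2 * (1 / D\<^sup>2) * r) ` ?R" .
    let ?e = "?q / c\<^sup>2"
    have e0: "?e \<noteq> 0" using c0 anisotropic by simp
    show ?thesis unfolding lhs rhs D_def[symmetric]
    proof
      assume eq: "(\<lambda>r. ?e * r) ` ?R = (\<lambda>r. ?e * (1 / D\<^sup>2) * r) ` ?R"
      have "?e * (1 / D\<^sup>2) * 1 \<in> (\<lambda>r. ?e * (1 / D\<^sup>2) * r) ` ?R" using subringD(2)[OF R] by (rule imageI)
      then obtain r where r: "r \<in> ?R" "?e * (1 / D\<^sup>2) = ?e * r" unfolding eq[symmetric] by auto
      then have "1 / D\<^sup>2 = r" using mult_left_cancel[OF e0] by blast
      then have "1 / D = D * r" using D0 by (auto simp: power2_eq_square)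
      then show "1 / D \<in> ?R" using subringD(6)[OF R DR r(1)] by simp
    next
      assume D': "1 / D \<in> ?R"
      show "(\<lambda>r. ?e * r) ` ?R = (\<lambda>r. ?e * (1 / D\<^sup>2) * r) ` ?R"
      proof (intro equalityI subsetI)
        fix x assume "x \<in> (\<lambda>r. ?e * r) ` ?R"
        then obtain r where r: "r \<in> ?R" "x = ?e * r" by blast
        have "x = ?e * (1 / D\<^sup>2) * (D * (D * r))" using r D0 by (simp add: power2_eq_square)
        moreover have "D * (D * r) \<in> ?R" using subringD(6)[OF R] DR r by blast
        ultimately show "x \<in> (\<lambda>r. ?e * (1 / D\<^sup>2) * r) ` ?R" by blast
      next
        fix x assume "x \<in> (\<lambda>r. ?e * (1 / D\<^sup>2) * r) ` ?R"
        then obtain r where r: "r \<in> ?R" "x = ?e * (1 / D\<^sup>2) * r" by blast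
        have "x = ?e * (1 / D * (1 / D * r))" using r by (simp add: power2_eq_square)
        moreover have "1 / D * (1 / D * r) \<in> ?R" using subringD(6)[OF R] D' r by blast
        ultimately show "x \<in> (\<lambda>r. ?e * r) ` ?R" by blast
      qed
    qed
  qed
  have subinv: "submodule_over \<O> (*) (ideal_inverse I)" for I :: "'f set"
  proof -
    have "c * x * a \<in> \<O>" if "c \<in> \<O>" "x * a \<in> \<O>" for c x a :: 'f
      using ring_of_integers_closed(5)[OF that] by (simp add: mult.assoc)
    then show ?thesis by (auto simp: submodule_over_def ideal_inverse_def distrib_right)
  qed
  have subimg: "submodule_over \<O> (*) ((\<lambda>a. c * a) ` A)"
    if A: "submodule_over \<O> (*) A" for c and A :: "'f set"
    unfolding submodule_over_def
  proof (intro conjI ballI)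
    show "0 \<in> (\<lambda>a. c * a) ` A" using submodule_overD(1)[OF A] by (intro image_eqI[of _ _ 0]) auto
  next
    fix x y assume "x \<in> (\<lambda>a. c * a) ` A" "y \<in> (\<lambda>a. c * a) ` A"
    then obtain a b where "x = c * a" "y = c * b" "a \<in> A" "b \<in> A" by blast
    then show "x + y \<in> (\<lambda>a. c * a) ` A" using submodule_overD(2)[OF A]
      by (intro image_eqI[of _ _ "a + b"]) (auto simp: distrib_left)
  next
    fix d x :: 'f assume "d \<in> \<O>" "x \<in> (\<lambda>a. c * a) ` A"
    then show "d * x \<in> (\<lambda>a. c * a) ` A" using submodule_overD(3)[OF A] by (auto simp: mult.left_commute)
  qed
  have "submodule_over \<O> (*) (ideal_mult I J)" for I J :: "'f set"
    by (simp add: ideal_mult_def integral_span_eq submodule_ring_span vector_space_self subring_ring_of_integers)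
  then have eq_iff: "?lhs = ?rhs \<longleftrightarrow> (\<forall>m. prime_ideal m \<longrightarrow> loc (*) m ?lhs = loc (*) m ?rhs)"
    by (intro submodules_eq_iff_local subimg subinv)
  have "maximal_lattice scale W \<phi> ?K \<longleftrightarrow>
      (\<forall>m. prime_ideal m \<longrightarrow> 1 / det (coords scale (w m) (k m)) \<in> loc_ring m)"
    by (rule W.maximal_iff_local[OF M K k w])
  also have "\<dots> \<longleftrightarrow> (\<forall>m. prime_ideal m \<longrightarrow> loc (*) m ?lhs = loc (*) m ?rhs)"
    by (intro iff_allI imp_cong[OF refl]) (rule loc_iff[symmetric])
  finally show ?thesis unfolding eq_iff .
qed

end

theorem corollary4p3:
  fixes scale :: "'f::field_char_0 \<Rightarrow> 'v::ab_group_add \<Rightarrow> 'v"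
    and \<phi> \<psi> :: "'v \<Rightarrow> 'v \<Rightarrow> 'f"
    and L W M :: "'v set"
    and h :: 'v
  assumes "algebraic_number_field TYPE('f)"
    and "quadratic_space scale UNIV \<phi>"
    and "vector_space.dim scale (UNIV :: 'v set) > 1"
    and "maximal_lattice scale UNIV \<phi> L"
    and "\<phi> h h \<noteq> 0"
    and "W = {x. \<phi> x h = 0}"
    and "\<And>x y. x \<in> W \<Longrightarrow> y \<in> W \<Longrightarrow> \<psi> x y = \<phi> x y"
    and "maximal_lattice scale W \<psi> M"
  shows "maximal_lattice scale W \<psi> (L \<inter> W) \<longleftrightarrow>
    (\<lambda>a. \<phi> h h * a) ` ideal_inverse (ideal_mult (\<phi> h ` L) (\<phi> h ` L)) =
    (\<lambda>a. 2 * a) `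
      ideal_mult (lattice_index scale W (dual_lattice W \<psi> M) M)
        (ideal_inverse (lattice_index scale UNIV (dual_lattice UNIV \<phi> L) L))"
proof -
  have q: "vector_space scale" "module.subspace scale (UNIV :: 'v set)"
    "\<exists>B. finite B \<and> module.span scale B = UNIV"
    "\<And>x y. \<phi> x y = \<phi> y x" "\<And>x y z. \<phi> (x + y) z = \<phi> x z + \<phi> y z"
    "\<And>c x y. \<phi> (scale c x) y = c * \<phi> x y" "\<And>x. (\<And>y. \<phi> x y = 0) \<Longrightarrow> x = 0"
    using assms(2) by (auto simp: quadratic_space_def)
  interpret vector_space scale by (rule q(1))
  interpret A: anisotropic_vector scale \<phi> h
    by unfold_locales (use assms(1,5) q in auto)
  have W: "A.W = W" by (simp add: A.W_def assms(6))
  have int: "integral_lattice scale W \<psi> N \<longleftrightarrow> integral_lattice scale W \<phi> N" for N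
    using assms(7) by (auto simp: integral_lattice_def is_lattice_def subset_iff)
  have max: "maximal_lattice scale W \<psi> N \<longleftrightarrow> maximal_lattice scale W \<phi> N" for N
    by (simp add: maximal_lattice_def int)
  have "M \<subseteq> W" using assms(8) by (simp add: maximal_lattice_def integral_lattice_def is_lattice_def)
  then have "dual_lattice W \<psi> M = dual_lattice W \<phi> M"
    using assms(7) by (auto simp: dual_lattice_def subset_iff)
  then show ?thesis using A.maximal_inter_iff[OF assms(4), of M] assms(8) by (simp add: W max)
qed

end
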